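(* Let $q=p^h$ with $p$ an odd prime and $h\ge1$, $G_1=\mathrm{GL}(2,\mathbb F_q)$, $G_2=\mathrm{GL}(2,\mathbb F_{q^2})$, and let $\nu\in\widehat{\mathbb F_{q^2}^*}$ be an indecomposable character such that $\nu^\sharp=\nu|_{\mathbb F_q^*}$ is not a square in $\widehat{\mathbb F_q^*}$. Then $(G_2,G_1,\rho_\nu)$ is a multiplicity-free triple and $$\mathrm{Ind}_{G_1}^{G_2}\rho_\nu\sim\left(\bigoplus\widehat\chi_{\xi_1,\xi_2}\right)\oplus\left(\bigoplus\rho_\mu\right)$$ where - the first sum runs over all unordered pairs of distinct characters $\xi_1,\xi_2\in\widehat{\mathbb F_{q^2}^*}$ such that $(\xi_1\xi_2)|_{\mathbb F_q^*}=\nu|_{\mathbb F_q^*}$ but $\overline{\xi_1}\xi_2\ne\nu,\overline\nu$; - the second sum runs over all characters $\mu\in\widehat{\mathbb F_{q^4}^*}$ indecomposable over $\mathbb F_{q^2}^*$ such that $\mu|_{\mathbb F_q^*}=\nu|_{\mathbb F_q^*}$, taken up to conjugation $\mu\mapsto\overline\mu$ over $\mathbb F_{q^2}$ (each unordered pair $\{\mu,\overline\mu\}$ contributes once).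
   Context: For a finite group $G$, $K\le G$ and an irreducible $K$-representation $\theta$, $(G,K,\theta)$ is a multiplicity-free triple if $\mathrm{Ind}_K^G\theta$ contains every irreducible $G$-representation at most once. Let $r$ be $q$ or $q^2$. For $w\in\mathbb F_{r^2}$, $\overline w=w^r$ is the conjugate over $\mathbb F_r$; for $\nu\in\widehat{\mathbb F_{r^2}^*}$ (characters of the multiplicative group), $\overline\nu(w)=\nu(\overline w)$. $\nu$ is decomposable (over $\mathbb F_r^*$) if $\nu(w)=\psi(w\overline w)$ for some $\psi\in\widehat{\mathbb F_r^*}$, otherwise indecomposable. In the first sum the bar on $\xi_1,\nu\in\widehat{\mathbb F_{q^2}^*}$ refers to conjugation over $\mathbb F_q$. Parabolic representations of $\mathrm{GL}(2,\mathbb F_r)$: for $\xi_1\ne\xi_2\in\widehat{\mathbb F_r^*}$, $\widehat\chi_{\xi_1,\xi_2}$ is the irreducible representation induced from the one-dimensional representation $\begin{pmatrix}\alpha&\beta\\0&\delta\end{pmatrix}\mapsto\xi_1(\alpha)\xi_2(\delta)$ of the subgroup of upper triangular matrices. Cuspidal representations of $\mathrm{GL}(2,\mathbb F_r)$: for $\nu\in\widehat{\mathbb F_{r^2}^*}$ indecomposable and $\chi$ a fixed nontrivial additive character of $\mathbb F_r$, put $j(x)=\frac1r\sum_{w\in\mathbb F_{r^2}^*,\,w\overline w=x}\chi(w+\overline w)\nu(w)$ for $x\in\mathbb F_r^*$. $\rho_\nu$ acts on functions $f:\mathbb F_r^*\to\mathbb C$ by $[\rho_\nu(g)f](y)=\nu(\delta)\chi(\delta^{-1}\beta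 y^{-1})f(\delta\alpha^{-1}y)$ if $g=\begin{pmatrix}\alpha&\beta\\0&\delta\end{pmatrix}$, and $[\rho_\nu(g)f](y)=-\sum_{x\in\mathbb F_r^*}\nu(-\gamma x)\chi(\alpha\gamma^{-1}y^{-1}+\gamma^{-1}\delta x^{-1})j(\gamma^{-2}y^{-1}x^{-1}\det g)f(x)$ if $g=\begin{pmatrix}\alpha&\beta\\\gamma&\delta\end{pmatrix}$, $\gamma\ne0$. It is irreducible of dimension $r-1$, and $\rho_\nu\sim\rho_\mu$ iff $\mu\in\{\nu,\overline\nu\}$. *)

theory Defs
  imports "HOL-Analysis.Analysis" "HOL-Computational_Algebra.Primes" "HOL-Algebra.Coset" "HOL-Library.Function_Algebras"
begin

text \<open>Complex representations are modelled on subspaces of the space \<open>'x \<Rightarrow> complex\<close> of all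
  functions on a type; every finite-dimensional representation is equivalent to such a one.\<close>

definition fscale :: "complex \<Rightarrow> ('x \<Rightarrow> complex) \<Rightarrow> 'x \<Rightarrow> complex"
  where "fscale c f = (\<lambda>x. c * f x)"

global_interpretation cfun: vector_space "fscale :: complex \<Rightarrow> ('x \<Rightarrow> complex) \<Rightarrow> 'x \<Rightarrow> complex"
  by unfold_locales (auto simp: fscale_def fun_eq_iff algebra_simps)

definition linear_between ::
  "('x \<Rightarrow> complex) set \<Rightarrow> ('y \<Rightarrow> complex) set \<Rightarrow> (('x \<Rightarrow> complex) \<Rightarrow> 'y \<Rightarrow> complex) \<Rightarrow> bool"
  where "linear_between V W T \<longleftrightarrow>
    T ` V \<subseteq> W \<and> (\<forall>u\<in>V. \<forall>v\<in>V. T (u + v) = T u + T v) \<and> (\<forall>c. \<forall>v\<in>V. T (fscale c v) = fscale c (T v))"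

record ('g, 'x) rep =
  rep_space :: "('x \<Rightarrow> complex) set"
  rep_act :: "'g \<Rightarrow> ('x \<Rightarrow> complex) \<Rightarrow> 'x \<Rightarrow> complex"

definition is_rep :: "'g monoid \<Rightarrow> ('g, 'x) rep \<Rightarrow> bool"
  where "is_rep G \<pi> \<longleftrightarrow>
    cfun.subspace (rep_space \<pi>) \<and>
    (\<forall>g\<in>carrier G. linear_between (rep_space \<pi>) (rep_space \<pi>) (rep_act \<pi> g)) \<and>
    (\<forall>v\<in>rep_space \<pi>. rep_act \<pi> \<one>\<^bsub>G\<^esub> v = v) \<and>
    (\<forall>g\<in>carrier G. \<forall>h\<in>carrier G. \<forall>v\<in>rep_space \<pi>.
       rep_act \<pi> (g \<otimes>\<^bsub>G\<^esub> h) v = rep_act \<pi> g (rep_act \<pi> h v))"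

definition irreducible_rep :: "'g monoid \<Rightarrow> ('g, 'x) rep \<Rightarrow> bool"
  where "irreducible_rep G \<pi> \<longleftrightarrow>
    is_rep G \<pi> \<and> rep_space \<pi> \<noteq> {0} \<and>
    (\<forall>W. cfun.subspace W \<and> W \<subseteq> rep_space \<pi> \<and> (\<forall>g\<in>carrier G. rep_act \<pi> g ` W \<subseteq> W)
       \<longrightarrow> W = {0} \<or> W = rep_space \<pi>)"

definition intertwiner ::
  "'g monoid \<Rightarrow> ('g, 'x) rep \<Rightarrow> ('g, 'y) rep \<Rightarrow> (('x \<Rightarrow> complex) \<Rightarrow> 'y \<Rightarrow> complex) \<Rightarrow> bool"
  where "intertwiner G \<pi> \<sigma> T \<longleftrightarrow>
    linear_between (rep_space \<pi>) (rep_space \<sigma>) T \<and>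
    (\<forall>g\<in>carrier G. \<forall>v\<in>rep_space \<pi>. T (rep_act \<pi> g v) = rep_act \<sigma> g (T v))"

definition rep_equiv :: "'g monoid \<Rightarrow> ('g, 'x) rep \<Rightarrow> ('g, 'y) rep \<Rightarrow> bool"
  where "rep_equiv G \<pi> \<sigma> \<longleftrightarrow>
    (\<exists>T. intertwiner G \<pi> \<sigma> T \<and> bij_betw T (rep_space \<pi>) (rep_space \<sigma>))"

definition rep_embeds :: "'g monoid \<Rightarrow> ('g, 'x) rep \<Rightarrow> ('g, 'y) rep \<Rightarrow> bool"
  where "rep_embeds G \<pi> \<sigma> \<longleftrightarrow> (\<exists>T. intertwiner G \<pi> \<sigma> T \<and> inj_on T (rep_space \<pi>))"

text \<open>An element of the direct sum over \<open>I\<close> (used only for finite \<open>I\<close>) is a family \<open>(f\<^sub>i)\<close>,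
  stored uncurried and set to \<open>0\<close> outside \<open>I\<close>.\<close>

definition rep_Sum :: "'i set \<Rightarrow> ('i \<Rightarrow> ('g, 'x) rep) \<Rightarrow> ('g, 'i \<times> 'x) rep"
  where "rep_Sum I \<pi> = \<lparr>
    rep_space = {f. (\<forall>i\<in>I. curry f i \<in> rep_space (\<pi> i)) \<and> (\<forall>i. i \<notin> I \<longrightarrow> curry f i = 0)},
    rep_act = (\<lambda>g f (i, x). if i \<in> I then rep_act (\<pi> i) g (curry f i) x else 0) \<rparr>"

definition rep_plus :: "('g, 'x) rep \<Rightarrow> ('g, 'y) rep \<Rightarrow> ('g, 'x + 'y) rep"
  where "rep_plus \<pi> \<sigma> = \<lparr>
    rep_space = {f. f \<circ> Inl \<in> rep_space \<pi> \<and> f \<circ> Inr \<in> rep_space \<sigma>},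
    rep_act = (\<lambda>g f. case_sum (rep_act \<pi> g (f \<circ> Inl)) (rep_act \<sigma> g (f \<circ> Inr))) \<rparr>"

text \<open>The induced representation: functions \<open>f\<close> from \<open>G\<close> to the space of \<open>\<theta>\<close> with
  \<open>f (g k) = \<theta> (k\<inverse>) (f g)\<close> for \<open>k \<in> K\<close>, with \<open>G\<close> acting by left translation; again
  stored uncurried and set to \<open>0\<close> outside the carrier.\<close>

definition induced :: "'g monoid \<Rightarrow> 'g set \<Rightarrow> ('g, 'x) rep \<Rightarrow> ('g, 'g \<times> 'x) rep"
  where "induced G K \<theta> = \<lparr>
    rep_space = {f. (\<forall>g\<in>carrier G. curry f g \<in> rep_space \<theta>) \<and>
                    (\<forall>g\<in>carrier G. \<forall>k\<in>K. curry f (g \<otimes>\<^bsub>G\<^esub> k) = rep_act \<theta> (inv\<^bsub>G\<^esub> k) (curry f g)) \<and>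
                    (\<forall>g. g \<notin> carrier G \<longrightarrow> curry f g = 0)},
    rep_act = (\<lambda>g f (g', x). if g' \<in> carrier G then f (inv\<^bsub>G\<^esub> g \<otimes>\<^bsub>G\<^esub> g', x) else 0) \<rparr>"

text \<open>Irreducible representations of a finite group are finite-dimensional, so each of them is
  equivalent to one on a subspace of \<open>nat \<Rightarrow> complex\<close>; quantifying over the latter is quantifying
  over all irreducible representations.\<close>

definition multiplicity_free :: "'g monoid \<Rightarrow> ('g, 'x) rep \<Rightarrow> bool"
  where "multiplicity_free G \<pi> \<longleftrightarrow>
    (\<forall>\<sigma> :: ('g, nat) rep. irreducible_rep G \<sigma> \<longrightarrow>
       (\<forall>m. rep_embeds G (rep_Sum {..<m::nat} (\<lambda>_. \<sigma>)) \<pi> \<longrightarrow> m \<le> 1))"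

definition multiplicity_free_triple :: "'g monoid \<Rightarrow> 'g set \<Rightarrow> ('g, 'x) rep \<Rightarrow> bool"
  where "multiplicity_free_triple G K \<theta> \<longleftrightarrow>
    group G \<and> finite (carrier G) \<and> subgroup K G \<and> irreducible_rep (G\<lparr>carrier := K\<rparr>) \<theta> \<and>
    multiplicity_free G (induced G K \<theta>)"

text \<open>All finite fields are subfields of one ambient field type.\<close>

definition is_subfield :: "'a::field set \<Rightarrow> bool"
  where "is_subfield F \<longleftrightarrow> 0 \<in> F \<and> 1 \<in> F \<and>
    (\<forall>x\<in>F. \<forall>y\<in>F. x + y \<in> F \<and> x * y \<in> F) \<and> (\<forall>x\<in>F. - x \<in> F \<and> inverse x \<in> F)"

definition GL2 :: "'a::field set \<Rightarrow> ('a^2^2) monoid"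
  where "GL2 F = \<lparr> carrier = {A. (\<forall>i j. A $ i $ j \<in> F) \<and> det A \<noteq> 0},
                   monoid.mult = (**), one = mat 1 \<rparr>"

definition upper_triangular :: "'a::field set \<Rightarrow> ('a^2^2) set"
  where "upper_triangular F = {A \<in> carrier (GL2 F). A $ 2 $ 1 = 0}"

text \<open>Characters of the multiplicative group of \<open>F\<close> are extended by \<open>0\<close> to the whole type, so
  that equality of characters is equality of functions.\<close>

definition mult_chars :: "'a::field set \<Rightarrow> ('a \<Rightarrow> complex) set"
  where "mult_chars F = {\<psi>. (\<forall>x\<in>F - {0}. \<psi> x \<noteq> 0) \<and>
    (\<forall>x\<in>F - {0}. \<forall>y\<in>F - {0}. \<psi> (x * y) = \<psi> x * \<psi> y) \<and> (\<forall>x. x \<notin> F - {0} \<longrightarrow> \<psi> x = 0)}"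

definition nontrivial_add_char :: "'a::field set \<Rightarrow> ('a \<Rightarrow> complex) \<Rightarrow> bool"
  where "nontrivial_add_char F \<eta> \<longleftrightarrow> (\<forall>x\<in>F. \<eta> x \<noteq> 0) \<and>
    (\<forall>x\<in>F. \<forall>y\<in>F. \<eta> (x + y) = \<eta> x * \<eta> y) \<and> (\<exists>x\<in>F. \<eta> x \<noteq> 1)"

text \<open>Conjugation over the subfield \<open>F\<close> is \<open>w \<mapsto> w ^ card F\<close>.  On a finite ambient field this is
  an automorphism preserving every subfield, so \<open>conj_char\<close> respects the extension by \<open>0\<close>.\<close>

definition conj_over :: "'a::field set \<Rightarrow> 'a \<Rightarrow> 'a"
  where "conj_over F w = w ^ card F"

definition conj_char :: "'a::field set \<Rightarrow> ('a \<Rightarrow> complex) \<Rightarrow> 'a \<Rightarrow> complex"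
  where "conj_char F \<nu> = (\<lambda>w. \<nu> (conj_over F w))"

text \<open>In the following, \<open>L\<close> is the quadratic extension of \<open>F\<close>.\<close>

definition indecomposable :: "'a::field set \<Rightarrow> 'a set \<Rightarrow> ('a \<Rightarrow> complex) \<Rightarrow> bool"
  where "indecomposable F L \<nu> \<longleftrightarrow>
    \<not> (\<exists>\<psi>\<in>mult_chars F. \<forall>w\<in>L - {0}. \<nu> w = \<psi> (w * conj_over F w))"

definition parabolic_rep ::
  "'a::field set \<Rightarrow> ('a \<Rightarrow> complex) \<Rightarrow> ('a \<Rightarrow> complex) \<Rightarrow> ('a^2^2, ('a^2^2) \<times> unit) rep"
  where "parabolic_rep F \<xi>1 \<xi>2 = induced (GL2 F) (upper_triangular F)
    \<lparr> rep_space = UNIV, rep_act = (\<lambda>A. fscale (\<xi>1 (A $ 1 $ 1) * \<xi>2 (A $ 2 $ 2))) \<rparr>"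

definition cusp_j ::
  "'a::field set \<Rightarrow> 'a set \<Rightarrow> ('a \<Rightarrow> complex) \<Rightarrow> ('a \<Rightarrow> complex) \<Rightarrow> 'a \<Rightarrow> complex"
  where "cusp_j F L \<eta> \<nu> x =
    1 / of_nat (card F) *
      (\<Sum>w\<in>{w\<in>L - {0}. w * conj_over F w = x}. \<eta> (w + conj_over F w) * \<nu> w)"

definition cuspidal_rep ::
  "'a::field set \<Rightarrow> 'a set \<Rightarrow> ('a \<Rightarrow> complex) \<Rightarrow> ('a \<Rightarrow> complex) \<Rightarrow> ('a^2^2, 'a) rep"
  where "cuspidal_rep F L \<eta> \<nu> = \<lparr>
    rep_space = {f. \<forall>y. y \<notin> F - {0} \<longrightarrow> f y = 0},
    rep_act = (\<lambda>A f y.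
      let \<alpha> = A $ 1 $ 1; \<beta> = A $ 1 $ 2; \<gamma> = A $ 2 $ 1; \<delta> = A $ 2 $ 2 in
      if y \<notin> F - {0} then 0
      else if \<gamma> = 0 then \<nu> \<delta> * \<eta> (inverse \<delta> * \<beta> * inverse y) * f (\<delta> * inverse \<alpha> * y)
      else - (\<Sum>x\<in>F - {0}. \<nu> (- \<gamma> * x) *
                 \<eta> (\<alpha> * inverse \<gamma> * inverse y + inverse \<gamma> * \<delta> * inverse x) *
                 cusp_j F L \<eta> \<nu> (inverse (\<gamma>^2) * inverse y * inverse x * det A) * f x)) \<rparr>"

text \<open>\<open>I\<close> contains exactly one member of each class \<open>{s, sw s}\<close>, where \<open>sw\<close> is an involution of \<open>S\<close>.\<close>

definition is_transversal :: "('i \<Rightarrow> 'i) \<Rightarrow> 'i set \<Rightarrow> 'i set \<Rightarrow> bool"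
  where "is_transversal sw S I \<longleftrightarrow> I \<subseteq> S \<and> (\<forall>s\<in>S. \<exists>!t. t \<in> I \<and> t \<in> {s, sw s})"

end

theory Submission
  imports Defs "HOL-Number_Theory.Residues" "HOL-Computational_Algebra.Polynomial"
begin

text \<open>The operator \<open>\<rho>\<^sub>\<nu>(g)\<close> has a kernel that is a sum of \<open>\<nu>\<close> times an additive character over a
  fibre of the norm. Composing two kernels produces Gauss sums of the norm form, which evaluate to the
  kernel of the product; the trace of a matrix with nonzero lower left entry is minus the sum of \<open>\<nu>\<close>
  over its eigenvalues in \<open>L\<close>. The listed representations of \<open>GL(2, q\<^sup>2)\<close> are irreducible and pairwise
  inequivalent. By Frobenius reciprocity each of them maps nontrivially to the induced representation
  once its restriction to \<open>GL(2, q)\<close> has a nonzero intertwiner to \<open>\<rho>\<^sub>\<nu>\<close>. Such intertwiners are averages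
  over \<open>GL(2, q)\<close>, and they do not all vanish because a sum of traces does not: for \<open>\<rho>\<^sub>\<mu>\<close> the elliptic and
  split elements contribute nothing and all other terms are positive; for a parabolic representation
  the sum runs over a nonsplit torus, and orthogonality of characters evaluates it to \<open>q\<^sup>2 - 1\<close>.
  Hence the direct sum embeds, and both sides have dimension \<open>q (q\<^sup>4 - 1)\<close>.\<close>

section \<open>Representations\<close>

subsection \<open>Linear maps and intertwiners\<close>

text \<open>No multiplicity is ever bounded from above by a direct argument. Lower bounds alone
  (nonzero intertwiners, pairwise inequivalence, numbers of characters) already fill the dimension,
  and this forces every multiplicity to be one. It works because \<nu> is not a square on the units
  of the field of order q: a pair with \<xi>1 = \<xi>2 or a decomposable \<mu> would restrict to a
  square, so among the characters with the prescribed restriction none is lost, apart from at most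
  two \<xi>2 for each \<xi>1. Half of (q^2 - 1)(q - 1) ordered pairs give representations of
  dimension q^2 + 1, half of (q + 1)(q^2 + 1) characters give dimension q^2 - 1, and (q^4 - 1)((q -
  1) + (q + 1)) / 2 is the full dimension. The obstacle is that the cuspidal representation is known
  only by its formula, so that even multiplicativity has to be proved. The same kernels provide the
  traces, which enter only as sums of diagonal entries in explicit bases; no general theory of group
  characters is involved.\<close>

abbreviation subrep :: "('g, 'x) rep \<Rightarrow> ('x \<Rightarrow> complex) set \<Rightarrow> ('g, 'x) rep"
  where "subrep R W \<equiv> R\<lparr>rep_space := W\<rparr>"

lemma fscale_apply [simp]: "fscale c f x = c * f x"
  by (simp add: fscale_def)

lemma linear_betweenD:
  assumes "linear_between V W T"
  shows "v \<in> V \<Longrightarrow> T v \<in> W" "u \<in> V \<Longrightarrow> v \<in> V \<Longrightarrow> T (u + v) = T u + T v"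
    "v \<in> V \<Longrightarrow> T (fscale c v) = fscale c (T v)"
  using assms by (auto simp: linear_between_def)

lemma linear_betweenI:
  assumes "\<And>v. v \<in> V \<Longrightarrow> T v \<in> W" "\<And>u v. u \<in> V \<Longrightarrow> v \<in> V \<Longrightarrow> T (u + v) = T u + T v"
    "\<And>c v. v \<in> V \<Longrightarrow> T (fscale c v) = fscale c (T v)"
  shows "linear_between V W T"
  using assms by (auto simp: linear_between_def)

lemma linear_between_0:
  assumes "linear_between V W T" "cfun.subspace V"
  shows "T 0 = 0"
  using linear_betweenD(3)[OF assms(1) cfun.subspace_0[OF assms(2)], of 0] by simp

lemma linear_between_diff:
  assumes T: "linear_between V W T" and V: "cfun.subspace V" and "u \<in> V" "v \<in> V"
  shows "T (u - v) = T u - T v"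
proof -
  have "T (u + fscale (-1) v) = T u + fscale (-1) (T v)"
    using assms linear_betweenD[OF T] cfun.subspace_scale[OF V] by metis
  then show ?thesis by simp
qed

lemma linear_between_sum:
  assumes T: "linear_between V W T" and V: "cfun.subspace V" and "\<And>i. i \<in> I \<Longrightarrow> f i \<in> V"
  shows "T (\<Sum>i\<in>I. f i) = (\<Sum>i\<in>I. T (f i))"
  using assms(3)
proof (induction I rule: infinite_finite_induct)
  case (insert i I)
  then have "T (f i + sum f I) = T (f i) + T (sum f I)"
    by (intro linear_betweenD(2)[OF T] cfun.subspace_sum[OF V]) auto
  then show ?case using insert by (simp add: sum.insert del: plus_fun_apply)
qed (simp_all add: linear_between_0[OF T V])

lemma linear_between_image_subspace:
  assumes T: "linear_between V W T" and V: "cfun.subspace V"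
  shows "cfun.subspace (T ` V)"
proof (rule cfun.subspaceI)
  show "0 \<in> T ` V"
    using linear_between_0[OF T V] cfun.subspace_0[OF V] by (metis imageI)
  show "x + y \<in> T ` V" if "x \<in> T ` V" "y \<in> T ` V" for x y
    using that linear_betweenD(2)[OF T] cfun.subspace_add[OF V] by (auto simp: image_iff) metis
  show "fscale c x \<in> T ` V" if "x \<in> T ` V" for c x
    using that linear_betweenD(3)[OF T] cfun.subspace_scale[OF V] by (auto simp: image_iff) metis
qed

lemma linear_between_inj:
  assumes T: "linear_between V W T" and V: "cfun.subspace V"
  shows "inj_on T V \<longleftrightarrow> (\<forall>v\<in>V. T v = 0 \<longrightarrow> v = 0)"
proof
  show "\<forall>v\<in>V. T v = 0 \<longrightarrow> v = 0" if "inj_on T V"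
    using that linear_between_0[OF T V] cfun.subspace_0[OF V] by (metis inj_onD)
  assume *: "\<forall>v\<in>V. T v = 0 \<longrightarrow> v = 0"
  show "inj_on T V"
  proof (rule inj_onI)
    fix u v assume uv: "u \<in> V" "v \<in> V" "T u = T v"
    then have "T (u - v) = 0" by (simp add: linear_between_diff[OF T V])
    then have "u - v = 0" using * uv cfun.subspace_diff[OF V] by blast
    then show "u = v" by simp
  qed
qed

lemma linear_between_inv_into:
  assumes T: "linear_between V W T" and V: "cfun.subspace V" and b: "bij_betw T V W"
  shows "linear_between W V (inv_into V T)"
proof -
  have i: "inv_into V T w \<in> V" "T (inv_into V T w) = w" if "w \<in> W" for w
    using that b by (auto simp: bij_betw_def inv_into_into f_inv_into_f)
  have l: "inv_into V T (T v) = v" if "v \<in> V" for v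
    using that b by (auto simp: bij_betw_def)
  show ?thesis
  proof (rule linear_betweenI)
    show "inv_into V T w \<in> V" if "w \<in> W" for w using i that by blast
    show "inv_into V T (u + v) = inv_into V T u + inv_into V T v" if "u \<in> W" "v \<in> W" for u v
      using l[of "inv_into V T u + inv_into V T v"] i that
      by (simp add: linear_betweenD[OF T] cfun.subspace_add[OF V])
    show "inv_into V T (fscale c v) = fscale c (inv_into V T v)" if "v \<in> W" for c v
      using l[of "fscale c (inv_into V T v)"] i that
      by (simp add: linear_betweenD[OF T] cfun.subspace_scale[OF V])
  qed
qed

lemma is_repD:
  assumes "is_rep G \<pi>"
  shows "cfun.subspace (rep_space \<pi>)"
    "g \<in> carrier G \<Longrightarrow> linear_between (rep_space \<pi>) (rep_space \<pi>) (rep_act \<pi> g)"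
    "v \<in> rep_space \<pi> \<Longrightarrow> rep_act \<pi> \<one>\<^bsub>G\<^esub> v = v"
    "g \<in> carrier G \<Longrightarrow> h \<in> carrier G \<Longrightarrow> v \<in> rep_space \<pi> \<Longrightarrow>
       rep_act \<pi> (g \<otimes>\<^bsub>G\<^esub> h) v = rep_act \<pi> g (rep_act \<pi> h v)"
    "g \<in> carrier G \<Longrightarrow> v \<in> rep_space \<pi> \<Longrightarrow> rep_act \<pi> g v \<in> rep_space \<pi>"
  using assms linear_betweenD(1) unfolding is_rep_def by blast+

lemma is_rep_subrep:
  assumes R: "is_rep G R" and W: "cfun.subspace W" "W \<subseteq> rep_space R"
    and inv: "\<And>g w. g \<in> carrier G \<Longrightarrow> w \<in> W \<Longrightarrow> rep_act R g w \<in> W"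
  shows "is_rep G (subrep R W)"
  unfolding is_rep_def
proof (intro conjI ballI)
  show "linear_between (rep_space (subrep R W)) (rep_space (subrep R W)) (rep_act (subrep R W) g)"
    if "g \<in> carrier G" for g
    using inv[OF that] linear_betweenD(2,3)[OF is_repD(2)[OF R that]] W(2)
    by (simp add: linear_between_def subset_eq image_subset_iff)
qed (use is_repD[OF R] W in auto)

lemma intertwinerD:
  assumes "intertwiner G \<pi> \<sigma> T"
  shows "linear_between (rep_space \<pi>) (rep_space \<sigma>) T"
    "v \<in> rep_space \<pi> \<Longrightarrow> T v \<in> rep_space \<sigma>"
    "g \<in> carrier G \<Longrightarrow> v \<in> rep_space \<pi> \<Longrightarrow> T (rep_act \<pi> g v) = rep_act \<sigma> g (T v)"
  using assms by (auto simp: intertwiner_def linear_between_def)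

lemma intertwiner_comp:
  assumes T: "intertwiner G \<pi> \<sigma> T" and S: "intertwiner G \<sigma> \<tau> S"
  shows "intertwiner G \<pi> \<tau> (\<lambda>v. S (T v))"
  unfolding intertwiner_def
proof (intro conjI ballI linear_betweenI)
  show "S (T v) \<in> rep_space \<tau>" if "v \<in> rep_space \<pi>" for v
    using intertwinerD[OF T] intertwinerD[OF S] that by blast
  show "S (T (u + v)) = S (T u) + S (T v)" if "u \<in> rep_space \<pi>" "v \<in> rep_space \<pi>" for u v
    using that intertwinerD(2)[OF T]
    by (simp add: linear_betweenD(2)[OF intertwinerD(1)[OF T]] linear_betweenD(2)[OF intertwinerD(1)[OF S]])
  show "S (T (fscale c v)) = fscale c (S (T v))" if "v \<in> rep_space \<pi>" for c v
    using that intertwinerD(2)[OF T]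
    by (simp add: linear_betweenD(3)[OF intertwinerD(1)[OF T]] linear_betweenD(3)[OF intertwinerD(1)[OF S]])
  show "S (T (rep_act \<pi> g v)) = rep_act \<tau> g (S (T v))" if "g \<in> carrier G" "v \<in> rep_space \<pi>" for g v
    using intertwinerD[OF T] intertwinerD[OF S] that by metis
qed

lemma intertwiner_mono_dom:
  assumes "intertwiner G (subrep R V) \<sigma> T" "W \<subseteq> V"
  shows "intertwiner G (subrep R W) \<sigma> T"
  using assms unfolding intertwiner_def linear_between_def
  by (simp add: subset_eq image_subset_iff)

lemma intertwiner_restrict_cod:
  assumes "intertwiner G \<pi> R T" "\<And>v. v \<in> rep_space \<pi> \<Longrightarrow> T v \<in> W"
  shows "intertwiner G \<pi> (subrep R W) T"
  using assms by (auto simp: intertwiner_def linear_between_def)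

lemma rep_equiv_sym:
  assumes \<pi>: "is_rep G \<pi>" and e: "rep_equiv G \<pi> \<sigma>"
  shows "rep_equiv G \<sigma> \<pi>"
proof -
  obtain T where T: "intertwiner G \<pi> \<sigma> T" and b: "bij_betw T (rep_space \<pi>) (rep_space \<sigma>)"
    using e unfolding rep_equiv_def by blast
  let ?V = "rep_space \<pi>" and ?W = "rep_space \<sigma>"
  have i: "inv_into ?V T w \<in> ?V" "T (inv_into ?V T w) = w" if "w \<in> ?W" for w
    using that b by (auto simp: bij_betw_def inv_into_into f_inv_into_f)
  have l: "inv_into ?V T (T v) = v" if "v \<in> ?V" for v
    using that b by (auto simp: bij_betw_def)
  have "intertwiner G \<sigma> \<pi> (inv_into ?V T)"
    unfolding intertwiner_def
  proof (intro conjI ballI)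
    show "linear_between ?W ?V (inv_into ?V T)"
      by (rule linear_between_inv_into[OF intertwinerD(1)[OF T] is_repD(1)[OF \<pi>] b])
    show "inv_into ?V T (rep_act \<sigma> g w) = rep_act \<pi> g (inv_into ?V T w)"
      if "g \<in> carrier G" "w \<in> ?W" for g w
      using l[of "rep_act \<pi> g (inv_into ?V T w)"] i[OF that(2)] that(1) intertwinerD(3)[OF T]
        is_repD(5)[OF \<pi>] by metis
  qed
  then show ?thesis
    using bij_betw_inv_into[OF b] unfolding rep_equiv_def by blast
qed

lemma rep_equiv_trans:
  assumes "rep_equiv G \<pi> \<sigma>" "rep_equiv G \<sigma> \<tau>"
  shows "rep_equiv G \<pi> \<tau>"
proof -
  obtain T S where "intertwiner G \<pi> \<sigma> T" "bij_betw T (rep_space \<pi>) (rep_space \<sigma>)"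
    "intertwiner G \<sigma> \<tau> S" "bij_betw S (rep_space \<sigma>) (rep_space \<tau>)"
    using assms unfolding rep_equiv_def by blast
  then show ?thesis
    using intertwiner_comp bij_betw_trans unfolding rep_equiv_def comp_def by blast
qed

lemma rep_act_0:
  assumes "is_rep G \<pi>" "g \<in> carrier G"
  shows "rep_act \<pi> g 0 = 0"
  using linear_between_0[OF is_repD(2)[OF assms] is_repD(1)[OF assms(1)]] .

subsection \<open>Schur's lemma\<close>

lemma irreducible_repD:
  assumes "irreducible_rep G \<pi>"
  shows "is_rep G \<pi>" "\<exists>v\<in>rep_space \<pi>. v \<noteq> 0"
    "cfun.subspace W \<Longrightarrow> W \<subseteq> rep_space \<pi> \<Longrightarrow>
      (\<And>g w. g \<in> carrier G \<Longrightarrow> w \<in> W \<Longrightarrow> rep_act \<pi> g w \<in> W) \<Longrightarrow> w \<in> W \<Longrightarrow> w \<noteq> 0 \<Longrightarrow>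
      W = rep_space \<pi>"
proof -
  show r: "is_rep G \<pi>"
    using assms by (simp add: irreducible_rep_def)
  show "\<exists>v\<in>rep_space \<pi>. v \<noteq> 0"
    using assms cfun.subspace_0[OF is_repD(1)[OF r]] unfolding irreducible_rep_def by blast
  show "W = rep_space \<pi>" if "cfun.subspace W" "W \<subseteq> rep_space \<pi>"
      "\<And>g w. g \<in> carrier G \<Longrightarrow> w \<in> W \<Longrightarrow> rep_act \<pi> g w \<in> W" "w \<in> W" "w \<noteq> 0"
  proof -
    have "\<forall>g\<in>carrier G. rep_act \<pi> g ` W \<subseteq> W" using that(3) by blast
    then have "W = {0} \<or> W = rep_space \<pi>"
      using assms that(1,2) unfolding irreducible_rep_def by blast
    then show ?thesis using that(4,5) by blast
  qed
qed

lemma irreducible_repI: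
  assumes "is_rep G \<pi>" "v \<in> rep_space \<pi>" "v \<noteq> 0"
    and "\<And>W w. cfun.subspace W \<Longrightarrow> W \<subseteq> rep_space \<pi> \<Longrightarrow>
      (\<And>g w. g \<in> carrier G \<Longrightarrow> w \<in> W \<Longrightarrow> rep_act \<pi> g w \<in> W) \<Longrightarrow> w \<in> W \<Longrightarrow> w \<noteq> 0 \<Longrightarrow>
      rep_space \<pi> \<subseteq> W"
  shows "irreducible_rep G \<pi>"
  unfolding irreducible_rep_def
proof (intro conjI allI impI)
  show "rep_space \<pi> \<noteq> {0}" using assms(2,3) by blast
  fix W assume W: "cfun.subspace W \<and> W \<subseteq> rep_space \<pi> \<and> (\<forall>g\<in>carrier G. rep_act \<pi> g ` W \<subseteq> W)"
  show "W = {0} \<or> W = rep_space \<pi>"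
  proof (cases "\<exists>w\<in>W. w \<noteq> 0")
    case True
    then obtain w where w: "w \<in> W" "w \<noteq> 0" by blast
    have "rep_act \<pi> g u \<in> W" if "g \<in> carrier G" "u \<in> W" for g u
      using W that by blast
    then have "rep_space \<pi> \<subseteq> W"
      using assms(4)[of W w] W w by simp
    then show ?thesis using W by auto
  next
    case False
    then have "W = {0}" using W cfun.subspace_0[of W] by auto
    then show ?thesis ..
  qed
qed fact

text \<open>The kernel of \<open>T\<close> is an invariant subspace that misses \<open>v\<close>;
  irreducibility of the source leaves only zero for it.\<close>

lemma schur_inj:
  assumes \<pi>: "irreducible_rep G \<pi>" and \<sigma>: "is_rep G \<sigma>" and T: "intertwiner G \<pi> \<sigma> T"
    and v: "v \<in> rep_space \<pi>" "T v \<noteq> 0"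
  shows "inj_on T (rep_space \<pi>)"
proof -
  note r = irreducible_repD(1)[OF \<pi>]
  note Tl = intertwinerD(1)[OF T]
  define K where "K = {v \<in> rep_space \<pi>. T v = 0}"
  have K: "cfun.subspace K"
    unfolding K_def
    by (rule cfun.subspaceI)
       (auto simp: linear_between_0[OF Tl is_repD(1)[OF r]] linear_betweenD[OF Tl]
          cfun.subspace_0[OF is_repD(1)[OF r]] cfun.subspace_add[OF is_repD(1)[OF r]]
          cfun.subspace_scale[OF is_repD(1)[OF r]])
  have Kinv: "rep_act \<pi> g w \<in> K" if "g \<in> carrier G" "w \<in> K" for g w
    using that by (auto simp: K_def intertwinerD(3)[OF T] is_repD(5)[OF r] rep_act_0[OF \<sigma>])
  have "w = 0" if "w \<in> K" for w
  proof (rule ccontr)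
    assume "w \<noteq> 0"
    then have "K = rep_space \<pi>"
      using irreducible_repD(3)[OF \<pi> K _ Kinv that] unfolding K_def by blast
    then show False using v by (auto simp: K_def)
  qed
  then show ?thesis
    unfolding linear_between_inj[OF Tl is_repD(1)[OF r]] by (auto simp: K_def)
qed

text \<open>The dual argument: the image is a nonzero invariant subspace of an irreducible
  target.\<close>

lemma schur_surj:
  assumes \<pi>: "is_rep G \<pi>" and \<sigma>: "irreducible_rep G \<sigma>" and T: "intertwiner G \<pi> \<sigma> T"
    and v: "v \<in> rep_space \<pi>" "T v \<noteq> 0"
  shows "T ` rep_space \<pi> = rep_space \<sigma>"
proof (rule irreducible_repD(3)[OF \<sigma>])
  show "cfun.subspace (T ` rep_space \<pi>)"
    by (rule linear_between_image_subspace[OF intertwinerD(1)[OF T] is_repD(1)[OF \<pi>]])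
  show "T ` rep_space \<pi> \<subseteq> rep_space \<sigma>"
    using intertwinerD(2)[OF T] by blast
  show "rep_act \<sigma> g w \<in> T ` rep_space \<pi>" if "g \<in> carrier G" "w \<in> T ` rep_space \<pi>" for g w
    using that is_repD(5)[OF \<pi>] by (auto simp flip: intertwinerD(3)[OF T])
qed (use v in auto)

lemma schur_equiv:
  assumes "irreducible_rep G \<pi>" "irreducible_rep G \<sigma>" "intertwiner G \<pi> \<sigma> T"
    "v \<in> rep_space \<pi>" "T v \<noteq> 0"
  shows "rep_equiv G \<pi> \<sigma>"
proof -
  have "inj_on T (rep_space \<pi>)"
    by (rule schur_inj[OF assms(1) irreducible_repD(1)[OF assms(2)] assms(3), OF assms(4,5)])
  moreover have "T ` rep_space \<pi> = rep_space \<sigma>"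
    by (rule schur_surj[OF irreducible_repD(1)[OF assms(1)] assms(2,3), OF assms(4,5)])
  ultimately show ?thesis
    using assms(3) unfolding rep_equiv_def bij_betw_def by blast
qed

text \<open>Constituents live on different function types. Passing to images makes them subspaces of
  the single space of \<open>R\<close>, where sums and directness can be discussed.\<close>

lemma irreducible_image:
  assumes \<pi>: "irreducible_rep G \<pi>" and R: "is_rep G R" and T: "intertwiner G \<pi> R T"
    and inj: "inj_on T (rep_space \<pi>)"
  shows "irreducible_rep G (subrep R (T ` rep_space \<pi>))" (is ?irr)
    and "rep_equiv G \<pi> (subrep R (T ` rep_space \<pi>))" (is ?eq)
proof -
  note r = irreducible_repD(1)[OF \<pi>]
  note Tl = intertwinerD(1)[OF T] and V = is_repD(1)[OF irreducible_repD(1)[OF \<pi>]]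
  let ?W = "T ` rep_space \<pi>"
  show ?eq
    unfolding rep_equiv_def
    by (rule exI[of _ T])
       (use inj intertwiner_restrict_cod[OF T, of ?W] in \<open>auto simp: bij_betw_def\<close>)
  have W: "is_rep G (subrep R ?W)"
  proof (rule is_rep_subrep[OF R])
    show "cfun.subspace ?W" by (rule linear_between_image_subspace[OF Tl V])
    show "?W \<subseteq> rep_space R" using intertwinerD(2)[OF T] by blast
    show "rep_act R g w \<in> ?W" if "g \<in> carrier G" "w \<in> ?W" for g w
      using that is_repD(5)[OF r] by (auto simp flip: intertwinerD(3)[OF T])
  qed
  obtain v where v: "v \<in> rep_space \<pi>" "v \<noteq> 0" using irreducible_repD(2)[OF \<pi>] by blast
  show ?irr
  proof (rule irreducible_repI[OF W, of "T v"])
    show "T v \<in> rep_space (subrep R ?W)" using v by simp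
    show "T v \<noteq> 0" using v inj unfolding linear_between_inj[OF Tl V] by blast
    fix U u assume U: "cfun.subspace U" "U \<subseteq> rep_space (subrep R ?W)" "u \<in> U" "u \<noteq> 0"
      and inv: "\<And>g w. g \<in> carrier G \<Longrightarrow> w \<in> U \<Longrightarrow> rep_act (subrep R ?W) g w \<in> U"
    \<comment> \<open>Invariant subspaces of the image are pulled back along \<open>T\<close> and
      tested in the source.\<close>
    define U' where "U' = {v \<in> rep_space \<pi>. T v \<in> U}"
    obtain u' where u': "u' \<in> rep_space \<pi>" "T u' = u" using U by auto
    have "U' = rep_space \<pi>"
    proof (rule irreducible_repD(3)[OF \<pi>, of _ u'])
      show "cfun.subspace U'"
        unfolding U'_def
        by (rule cfun.subspaceI)
          (auto simp: linear_between_0[OF Tl V] linear_betweenD[OF Tl]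
            cfun.subspace_0[OF V] cfun.subspace_add[OF V]
            cfun.subspace_scale[OF V] cfun.subspace_0[OF U(1)] cfun.subspace_add[OF U(1)]
            cfun.subspace_scale[OF U(1)])
      show "rep_act \<pi> g w \<in> U'" if "g \<in> carrier G" "w \<in> U'" for g w
        using that inv by (auto simp: U'_def intertwinerD(3)[OF T] is_repD(5)[OF r])
      show "u' \<noteq> 0" using u' U(4) linear_between_0[OF Tl V] by auto
    qed (use u' U in \<open>auto simp: U'_def\<close>)
    then show "rep_space (subrep R ?W) \<subseteq> U" by (auto simp: U'_def)
  qed
qed

subsection \<open>Sums of pairwise inequivalent irreducible subrepresentations\<close>

definition sum_space :: "'i set \<Rightarrow> ('i \<Rightarrow> ('x \<Rightarrow> complex) set) \<Rightarrow> ('x \<Rightarrow> complex) set"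
  where "sum_space I W = {f. \<exists>w. (\<forall>i\<in>I. w i \<in> W i) \<and> f = (\<Sum>i\<in>I. w i)}"

definition direct :: "'i set \<Rightarrow> ('i \<Rightarrow> ('x \<Rightarrow> complex) set) \<Rightarrow> bool"
  where "direct I W \<longleftrightarrow> (\<forall>w. (\<forall>i\<in>I. w i \<in> W i) \<and> (\<Sum>i\<in>I. w i) = 0 \<longrightarrow> (\<forall>i\<in>I. w i = 0))"

text \<open>An arbitrary choice of summands. It becomes a linear and equivariant projection once the
  sum is direct, by \<open>component_eqI\<close>.\<close>

definition component :: "'i set \<Rightarrow> ('i \<Rightarrow> ('x \<Rightarrow> complex) set) \<Rightarrow> ('x \<Rightarrow> complex) \<Rightarrow> 'i \<Rightarrow> 'x \<Rightarrow> complex"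
  where "component I W f = (SOME w. (\<forall>i\<in>I. w i \<in> W i) \<and> f = (\<Sum>i\<in>I. w i))"

lemma component:
  assumes "f \<in> sum_space I W"
  shows "i \<in> I \<Longrightarrow> component I W f i \<in> W i" "f = (\<Sum>i\<in>I. component I W f i)"
proof -
  have "(\<forall>i\<in>I. component I W f i \<in> W i) \<and> f = (\<Sum>i\<in>I. component I W f i)"
    unfolding component_def
    by (rule someI_ex[of "\<lambda>w. (\<forall>i\<in>I. w i \<in> W i) \<and> f = (\<Sum>i\<in>I. w i)"])
       (use assms in \<open>simp add: sum_space_def\<close>)
  then show "i \<in> I \<Longrightarrow> component I W f i \<in> W i" "f = (\<Sum>i\<in>I. component I W f i)"
    by auto
qed

lemma component_eqI:
  assumes d: "direct I W" and W: "\<And>i. i \<in> I \<Longrightarrow> cfun.subspace (W i)"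
    and w: "\<And>i. i \<in> I \<Longrightarrow> w i \<in> W i" "f = (\<Sum>i\<in>I. w i)" and "i \<in> I"
  shows "component I W f i = w i"
proof -
  have f: "f \<in> sum_space I W" using w by (auto simp: sum_space_def)
  have "\<forall>i\<in>I. component I W f i - w i \<in> W i"
    using component(1)[OF f] w(1) cfun.subspace_diff[OF W] by blast
  moreover have "(\<Sum>i\<in>I. component I W f i - w i) = 0"
    using component(2)[OF f] w(2) by (simp add: sum_subtractf)
  ultimately have "\<forall>i\<in>I. component I W f i - w i = 0"
    using d[unfolded direct_def, rule_format, of "\<lambda>i. component I W f i - w i"] by blast
  then show ?thesis using \<open>i \<in> I\<close> by simp
qed

lemma component_intertwiner:
  assumes R: "is_rep G R" and d: "direct I W"
    and W: "\<And>i. i \<in> I \<Longrightarrow> is_rep G (subrep R (W i))" "\<And>i. i \<in> I \<Longrightarrow> W i \<subseteq> rep_space R"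
    and "i \<in> I"
  shows "intertwiner G (subrep R (sum_space I W)) (subrep R (W i)) (\<lambda>f. component I W f i)"
proof -
  have s: "cfun.subspace (W i)" if "i \<in> I" for i
    using is_repD(1)[OF W(1)[OF that]] by simp
  note c = component
  show ?thesis
    unfolding intertwiner_def
  proof (intro conjI ballI linear_betweenI; simp)
    show "component I W f i \<in> W i" if "f \<in> sum_space I W" for f
      using c(1)[OF that \<open>i \<in> I\<close>] .
    show "component I W (u + v) i = component I W u i + component I W v i"
      if "u \<in> sum_space I W" "v \<in> sum_space I W" for u v
      by (rule component_eqI[OF d s])
         (use c[OF that(1)] c[OF that(2)] \<open>i \<in> I\<close> in
           \<open>auto simp: sum.distrib cfun.subspace_add[OF s] simp del: plus_fun_apply\<close>)
    show "component I W (fscale k v) i = fscale k (component I W v i)"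
      if "v \<in> sum_space I W" for k v
      by (rule component_eqI[OF d s])
         (use c[OF that(1)] \<open>i \<in> I\<close> in
           \<open>auto simp: cfun.scale_sum_right[symmetric] cfun.subspace_scale[OF s] simp del: fscale_apply\<close>)
    show "component I W (rep_act R g v) i = rep_act R g (component I W v i)"
      if "g \<in> carrier G" "v \<in> sum_space I W" for g v
    proof (rule component_eqI[OF d s])
      show "rep_act R g (component I W v j) \<in> W j" if "j \<in> I" for j
        using is_repD(5)[OF W(1)[OF that] \<open>g \<in> carrier G\<close>] c(1)[OF \<open>v \<in> sum_space I W\<close> that]
        by simp
      have "rep_act R g v = rep_act R g (\<Sum>i\<in>I. component I W v i)"
        using c(2)[OF that(2)] by simp
      also have "\<dots> = (\<Sum>i\<in>I. rep_act R g (component I W v i))"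
        by (rule linear_between_sum[OF is_repD(2)[OF R that(1)] is_repD(1)[OF R]])
           (use c(1)[OF that(2)] W(2) in blast)
      finally show "rep_act R g v = (\<Sum>i\<in>I. rep_act R g (component I W v i))" .
    qed (use \<open>i \<in> I\<close> in auto)
  qed
qed

lemma sum_space_subspace:
  assumes "\<And>i. i \<in> I \<Longrightarrow> cfun.subspace (W i)"
  shows "cfun.subspace (sum_space I W)"
proof (rule cfun.subspaceI)
  show "0 \<in> sum_space I W"
    using cfun.subspace_0[OF assms]
    by (auto simp: sum_space_def intro!: exI[of _ "\<lambda>_. 0"])
  show "x + y \<in> sum_space I W" if xy: "x \<in> sum_space I W" "y \<in> sum_space I W" for x y
  proof -
    obtain u v where "\<forall>i\<in>I. u i \<in> W i" "x = sum u I" "\<forall>i\<in>I. v i \<in> W i" "y = sum v I"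
      using xy unfolding sum_space_def by blast
    then show ?thesis
      using cfun.subspace_add[OF assms] unfolding sum_space_def
      by (intro CollectI exI[of _ "\<lambda>i. u i + v i"]) (simp add: sum.distrib del: plus_fun_apply)
  qed
  show "fscale c x \<in> sum_space I W" if x: "x \<in> sum_space I W" for c x
  proof -
    obtain u where "\<forall>i\<in>I. u i \<in> W i" "x = sum u I"
      using x unfolding sum_space_def by blast
    then show ?thesis
      using cfun.subspace_scale[OF assms] unfolding sum_space_def
      by (intro CollectI exI[of _ "\<lambda>i. fscale c (u i)"])
         (simp add: cfun.scale_sum_right del: fscale_apply)
  qed
qed

lemma sum_space_invariant:
  assumes R: "is_rep G R"
    and W: "\<And>i. i \<in> I \<Longrightarrow> is_rep G (subrep R (W i))" "\<And>i. i \<in> I \<Longrightarrow> W i \<subseteq> rep_space R"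
    and f: "f \<in> sum_space I W" and g: "g \<in> carrier G"
  shows "rep_act R g f \<in> sum_space I W"
proof -
  have "rep_act R g f = rep_act R g (\<Sum>i\<in>I. component I W f i)"
    using component(2)[OF f] by simp
  also have "\<dots> = (\<Sum>i\<in>I. rep_act R g (component I W f i))"
    by (rule linear_between_sum[OF is_repD(2)[OF R g] is_repD(1)[OF R]])
       (use component(1)[OF f] W(2) in blast)
  finally show ?thesis
    using is_repD(5)[OF W(1) g] component(1)[OF f]
    by (auto simp: sum_space_def intro!: exI[of _ "\<lambda>i. rep_act R g (component I W f i)"])
qed

text \<open>The constituents after embedding. From these data alone follow directness of the sum
  and, if the sum is everything, multiplicity freeness.\<close>

locale irreducible_family =
  fixes G :: "'g monoid" and R :: "('g, 'x) rep" and I :: "'i set" and W :: "'i \<Rightarrow> ('x \<Rightarrow> complex) set"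
  assumes R: "is_rep G R" and finite_I: "finite I"
    and W_sub: "i \<in> I \<Longrightarrow> W i \<subseteq> rep_space R"
    and W_irr: "i \<in> I \<Longrightarrow> irreducible_rep G (subrep R (W i))"
    and W_ineq: "i \<in> I \<Longrightarrow> j \<in> I \<Longrightarrow> i \<noteq> j \<Longrightarrow> \<not> rep_equiv G (subrep R (W i)) (subrep R (W j))"
begin

lemma W_rep: "i \<in> I \<Longrightarrow> is_rep G (subrep R (W i))"
  using W_irr irreducible_repD(1) by blast

lemma W_subspace: "i \<in> I \<Longrightarrow> cfun.subspace (W i)"
  using is_repD(1)[OF W_rep] by simp

text \<open>Induction over subsets. If a nonzero vector of \<open>W j\<close> lay in the sum of the
  others, irreducibility would put all of \<open>W j\<close> there, and a nonzero component map
  would be an equivalence between inequivalent members by Schur's lemma.\<close>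

lemma direct_subset:
  assumes "J \<subseteq> I"
  shows "direct J W"
proof -
  have "finite J" using assms finite_I finite_subset by blast
  then show ?thesis
    using assms
  proof (induction J rule: finite_induct)
    case empty
    then show ?case by (simp add: direct_def)
  next
    case (insert j J)
    then have IH: "direct J W" and j: "j \<in> I" and JI: "\<And>i. i \<in> J \<Longrightarrow> i \<in> I" by auto
    show ?case
      unfolding direct_def
    proof (intro allI impI)
      fix w assume w: "(\<forall>i\<in>insert j J. w i \<in> W i) \<and> (\<Sum>i\<in>insert j J. w i) = 0"
      have S: "cfun.subspace (sum_space J W)"
        by (rule sum_space_subspace) (use W_subspace JI in blast)
      have wj: "w j = 0"
      proof (rule ccontr)
        assume nz: "w j \<noteq> 0"
        have "w j + (\<Sum>i\<in>J. w i) = 0" using w insert.hyps by simp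
        then have "w j = - (\<Sum>i\<in>J. w i)" by (simp add: eq_neg_iff_add_eq_0)
        moreover have "(\<Sum>i\<in>J. w i) \<in> sum_space J W"
          using w by (auto simp: sum_space_def)
        ultimately have wS: "w j \<in> sum_space J W"
          using cfun.subspace_neg[OF S] by simp
        have "W j \<inter> sum_space J W = rep_space (subrep R (W j))"
        proof (rule irreducible_repD(3)[OF W_irr[OF j], of _ "w j"])
          show "cfun.subspace (W j \<inter> sum_space J W)"
            by (rule cfun.subspace_inter[OF W_subspace[OF j] S])
          show "rep_act (subrep R (W j)) g x \<in> W j \<inter> sum_space J W"
            if "g \<in> carrier G" "x \<in> W j \<inter> sum_space J W" for g x
            using is_repD(5)[OF W_rep[OF j], of g x] that
              sum_space_invariant[OF R, of J W x g] W_rep W_sub JI by simp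
        qed (use w nz wS in auto)
        then have sub: "W j \<subseteq> sum_space J W" by auto
        have "component J W (w j) i = 0" if "i \<in> J" for i
        proof (rule ccontr)
          assume "component J W (w j) i \<noteq> 0"
          moreover have "intertwiner G (subrep R (W j)) (subrep R (W i)) (\<lambda>f. component J W f i)"
            by (rule intertwiner_mono_dom[OF component_intertwiner[OF R IH W_rep W_sub that] sub])
               (use JI in auto)
          ultimately have "rep_equiv G (subrep R (W j)) (subrep R (W i))"
            using schur_equiv[OF W_irr[OF j] W_irr[OF JI[OF that]], of _ "w j"] w by simp
          then show False using W_ineq[OF j JI[OF that]] that insert.hyps by blast
        qed
        then show False using component(2)[OF wS] nz by simp
      qed
      then have "(\<Sum>i\<in>J. w i) = 0" using w insert.hyps by simp
      then show "\<forall>i\<in>insert j J. w i = 0" using IH w wj unfolding direct_def by blast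
    qed
  qed
qed

text \<open>Suppose two copies of \<sigma> embed. Inequivalence forces both images into the same
  \<open>W i\<close>. The first copy already fills it, so a nonzero vector of the second copy has
  the same image as a vector of the first, against injectivity. Only the surjectivity half of
  Schur's lemma is involved in this last step, not the scalar form.\<close>

lemma multiplicity_free:
  assumes full: "rep_space R \<subseteq> sum_space I W"
  shows "multiplicity_free G R"
  unfolding multiplicity_free_def
proof (intro allI impI)
  fix \<sigma> :: "('g, nat) rep" and m :: nat
  assume \<sigma>: "irreducible_rep G \<sigma>" and e: "rep_embeds G (rep_Sum {..<m} (\<lambda>_. \<sigma>)) R"
  have d: "direct I W" by (rule direct_subset) simp
  show "m \<le> 1"
  proof (rule ccontr)
    assume "\<not> m \<le> 1"
    then have m: "0 < m" "1 < m" by auto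
    obtain T where T: "intertwiner G (rep_Sum {..<m} (\<lambda>_. \<sigma>)) R T"
        and injT: "inj_on T (rep_space (rep_Sum {..<m} (\<lambda>_. \<sigma>)))"
      using e unfolding rep_embeds_def by blast
    note r = irreducible_repD(1)[OF \<sigma>]
    define \<iota> :: "nat \<Rightarrow> (nat \<Rightarrow> complex) \<Rightarrow> nat \<times> nat \<Rightarrow> complex"
      where "\<iota> k v = (\<lambda>(i, x). if i = k then v x else 0)" for k v
    have curry_\<iota>: "curry (\<iota> k v) i = (if i = k then v else 0)" for k v i
      by (auto simp: \<iota>_def fun_eq_iff)
    have \<iota>_space: "\<iota> k v \<in> rep_space (rep_Sum {..<m} (\<lambda>_. \<sigma>))" if "k < m" "v \<in> rep_space \<sigma>" for k v
      using that cfun.subspace_0[OF is_repD(1)[OF r]] by (auto simp: rep_Sum_def curry_\<iota>)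
    have \<iota>: "intertwiner G \<sigma> (rep_Sum {..<m} (\<lambda>_. \<sigma>)) (\<iota> k)" if "k < m" for k
      unfolding intertwiner_def
    proof (intro conjI ballI linear_betweenI)
      show "\<iota> k (rep_act \<sigma> g v) = rep_act (rep_Sum {..<m} (\<lambda>_. \<sigma>)) g (\<iota> k v)"
        if "g \<in> carrier G" "v \<in> rep_space \<sigma>" for g v
        using \<open>k < m\<close> that by (auto simp: rep_Sum_def curry_\<iota> rep_act_0[OF r, unfolded zero_fun_def] fun_eq_iff \<iota>_def zero_fun_def)
    qed (use that \<iota>_space in \<open>auto simp: \<iota>_def fun_eq_iff\<close>)
    define a where "a k v = T (\<iota> k v)" for k v
    have a: "intertwiner G \<sigma> (subrep R (sum_space I W)) (a k)" if "k < m" for k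
      unfolding a_def
    proof (rule intertwiner_restrict_cod[OF intertwiner_comp[OF \<iota> T]])
      show "T (\<iota> k v) \<in> sum_space I W" if "v \<in> rep_space \<sigma>" for v
        using intertwinerD(2)[OF T \<iota>_space[OF \<open>k < m\<close> that]] full by blast
    qed fact
    obtain v0 where v0: "v0 \<in> rep_space \<sigma>" "v0 \<noteq> 0" using irreducible_repD(2)[OF \<sigma>] by blast
    have a_sum: "a k v \<in> sum_space I W" if "k < m" "v \<in> rep_space \<sigma>" for k v
      using intertwinerD(2)[OF a[OF that(1)] that(2)] by simp
    have pa: "intertwiner G \<sigma> (subrep R (W i)) (\<lambda>v. component I W (a k v) i)" if "k < m" "i \<in> I" for k i
      by (rule intertwiner_comp[OF a component_intertwiner[OF R d W_rep W_sub]]) (use that in auto)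
    have "a 0 v0 \<noteq> 0"
    proof
      assume "a 0 v0 = 0"
      then have "T (\<iota> 0 v0) = T (\<iota> 0 0)"
        using linear_between_0[OF intertwinerD(1)[OF a[OF m(1)]] is_repD(1)[OF r]] by (simp add: a_def)
      then have "\<iota> 0 v0 = \<iota> 0 0"
        using injT \<iota>_space m v0 cfun.subspace_0[OF is_repD(1)[OF r]] by (auto dest: inj_onD)
      then have "curry (\<iota> 0 v0) 0 = curry (\<iota> 0 0) 0" by simp
      then show False using v0 by (simp add: curry_\<iota>)
    qed
    then obtain i where i: "i \<in> I" "component I W (a 0 v0) i \<noteq> 0"
      using component(2)[OF a_sum[OF m(1) v0(1)]] by (metis sum.neutral)
    have eqi: "rep_equiv G \<sigma> (subrep R (W i))"
      by (rule schur_equiv[OF \<sigma> W_irr[OF i(1)] pa[OF m(1) i(1)], OF v0(1) i(2)])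
    have zero: "component I W (a k v) j = 0" if "k < m" "j \<in> I" "j \<noteq> i" "v \<in> rep_space \<sigma>" for k j v
    proof (rule ccontr)
      assume "component I W (a k v) j \<noteq> 0"
      then have "rep_equiv G \<sigma> (subrep R (W j))"
        by (rule schur_equiv[OF \<sigma> W_irr[OF that(2)] pa[OF that(1,2)], OF that(4)])
      then have "rep_equiv G (subrep R (W i)) (subrep R (W j))"
        using rep_equiv_trans rep_equiv_sym[OF r eqi] by blast
      then show False using W_ineq i that by blast
    qed
    have ai: "a k v = component I W (a k v) i" if "k < m" "v \<in> rep_space \<sigma>" for k v
    proof -
      have "a k v = (\<Sum>j\<in>I. component I W (a k v) j)"
        by (rule component(2)[OF a_sum[OF that]])
      also have "\<dots> = (\<Sum>j\<in>{i}. component I W (a k v) j)"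
        by (rule sum.mono_neutral_right) (use finite_I i zero that in auto)
      finally show ?thesis by simp
    qed
    have "(\<lambda>v. component I W (a 0 v) i) ` rep_space \<sigma> = rep_space (subrep R (W i))"
      by (rule schur_surj[OF r W_irr[OF i(1)] pa[OF m(1) i(1)], OF v0(1) i(2)])
    moreover have "a 1 v0 \<in> W i"
      using ai[OF m(2) v0(1)] component(1)[OF a_sum[OF m(2) v0(1)] i(1)] by simp
    ultimately have "a 1 v0 \<in> (\<lambda>v. component I W (a 0 v) i) ` rep_space \<sigma>" by simp
    then obtain v where v: "v \<in> rep_space \<sigma>" "a 1 v0 = component I W (a 0 v) i"
      by (rule imageE)
    then have "T (\<iota> 0 v) = T (\<iota> 1 v0)" using ai[OF m(1) v(1)] v(2) by (simp add: a_def)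
    then have "\<iota> 0 v = \<iota> 1 v0" using injT \<iota>_space m v v0 by (auto dest: inj_onD)
    then have "curry (\<iota> 0 v) 1 = curry (\<iota> 1 v0) 1" by simp
    then show False using v0 by (simp add: curry_\<iota>)
  qed
qed

end

subsection \<open>Counting dimensions\<close>

text \<open>Dimensions are only compared: constituents get lower bounds from independent families,
  the induced space an upper bound from a finite set of points that determines its
  functions.\<close>

definition dim_at_least :: "('x \<Rightarrow> complex) set \<Rightarrow> nat \<Rightarrow> bool"
  where "dim_at_least V n \<longleftrightarrow> (\<exists>b. (\<forall>j<n. b j \<in> V) \<and>
    (\<forall>c. (\<Sum>j<n. fscale (c j) (b j)) = 0 \<longrightarrow> (\<forall>j<n. c j = 0)))"

lemma sum_fun_apply: "(\<Sum>i\<in>I. f i) x = (\<Sum>i\<in>I. f i x)" for f :: "'i \<Rightarrow> 'x \<Rightarrow> complex"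
  by (induction I rule: infinite_finite_induct) auto

lemma dim_at_least_image:
  assumes T: "linear_between V W T" and V: "cfun.subspace V" and inj: "inj_on T V"
    and n: "dim_at_least V n"
  shows "dim_at_least (T ` V) n"
proof -
  obtain b where b: "\<forall>j<n. b j \<in> V" "\<forall>c. (\<Sum>j<n. fscale (c j) (b j)) = 0 \<longrightarrow> (\<forall>j<n. c j = 0)"
    using n unfolding dim_at_least_def by blast
  have "\<forall>j<n. c j = 0" if "(\<Sum>j<n. fscale (c j) (T (b j))) = 0" for c
  proof -
    have "T (\<Sum>j<n. fscale (c j) (b j)) = (\<Sum>j<n. T (fscale (c j) (b j)))"
      by (rule linear_between_sum[OF T V]) (use b cfun.subspace_scale[OF V] in auto)
    also have "\<dots> = (\<Sum>j<n. fscale (c j) (T (b j)))"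
      by (rule sum.cong) (use b linear_betweenD(3)[OF T] in auto)
    finally have "T (\<Sum>j<n. fscale (c j) (b j)) = 0" using that by simp
    moreover have "(\<Sum>j<n. fscale (c j) (b j)) \<in> V"
      by (rule cfun.subspace_sum[OF V]) (use b cfun.subspace_scale[OF V] in auto)
    ultimately have "(\<Sum>j<n. fscale (c j) (b j)) = 0"
      using inj unfolding linear_between_inj[OF T V] by blast
    then show ?thesis using b(2) by blast
  qed
  then show ?thesis
    using b(1) unfolding dim_at_least_def by (intro exI[of _ "\<lambda>j. T (b j)"]) auto
qed

text \<open>Evaluation at the points of \<open>E\<close> is dual to the family, so a linear relation
  read off at each point has zero coefficients.\<close>

lemma dim_at_least_dual:
  assumes E: "finite E" and v: "\<And>e. e \<in> E \<Longrightarrow> v e \<in> V"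
    and dual: "\<And>e e'. e \<in> E \<Longrightarrow> e' \<in> E \<Longrightarrow> v e e' = (if e = e' then 1 else 0)"
  shows "dim_at_least V (card E)"
proof -
  obtain h where h: "bij_betw h {..<card E} E"
    using ex_bij_betw_nat_finite[OF E] by (auto simp: atLeast0LessThan)
  have hE: "h j \<in> E" if "j < card E" for j
    using h that by (auto simp: bij_betw_def)
  have hinj: "h j = h k \<longleftrightarrow> j = k" if "j < card E" "k < card E" for j k
    using h that by (auto simp: bij_betw_def dest: inj_onD)
  have "c k = 0" if c: "(\<Sum>j<card E. fscale (c j) (v (h j))) = 0" and k: "k < card E" for c k
  proof -
    have "0 = (\<Sum>j<card E. c j * v (h j) (h k))"
      using fun_cong[OF c, of "h k"] by (simp add: sum_fun_apply)
    also have "\<dots> = (\<Sum>j<card E. if j = k then c j else 0)"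
      by (rule sum.cong) (use k dual hE hinj in auto)
    finally show ?thesis using k by simp
  qed
  then show ?thesis
    using v hE unfolding dim_at_least_def by (intro exI[of _ "\<lambda>j. v (h j)"]) auto
qed

text \<open>Gaussian elimination: an unknown with nonzero coefficient in the equation
  \<open>d\<close> is solved for and substituted into the others.\<close>

lemma underdetermined_system:
  fixes b :: "'j \<Rightarrow> 'd \<Rightarrow> complex"
  assumes "finite D" "finite J" "card D < card J"
  shows "\<exists>c. (\<exists>j\<in>J. c j \<noteq> 0) \<and> (\<forall>d\<in>D. (\<Sum>j\<in>J. c j * b j d) = 0)"
  using assms
proof (induction D arbitrary: J b rule: finite_induct)
  case empty
  then obtain j where "j \<in> J" by fastforce
  then show ?case by (intro exI[of _ "\<lambda>_. 1"]) auto
next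
  case (insert d D)
  show ?case
  proof (cases "\<forall>j\<in>J. b j d = 0")
    case True
    have "card D < card J" using insert.hyps insert.prems by simp
    then obtain c where "\<exists>j\<in>J. c j \<noteq> 0" "\<forall>x\<in>D. (\<Sum>j\<in>J. c j * b j x) = 0"
      using insert.IH[of J b] insert.prems by blast
    then show ?thesis using True by (intro exI[of _ c]) auto
  next
    case False
    then obtain k where k: "k \<in> J" "b k d \<noteq> 0" by blast
    define J' where "J' = J - {k}"
    define b' where "b' j x = b j x - b j d / b k d * b k x" for j x
    have "card D < card J'" using insert.hyps insert.prems k by (simp add: J'_def)
    then obtain c where c: "\<exists>j\<in>J'. c j \<noteq> 0" "\<forall>x\<in>D. (\<Sum>j\<in>J'. c j * b' j x) = 0"
      using insert.IH[of J' b'] insert.prems by (auto simp: J'_def)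
    \<comment> \<open>Minus this is the value of the eliminated unknown. With it, the sum over
      \<open>J\<close> in the old coefficients equals the sum over \<open>J'\<close> in the reduced
      ones.\<close>
    define s where "s = (\<Sum>j\<in>J'. c j * (b j d / b k d))"
    define c' where "c' = c(k := - s)"
    have split: "(\<Sum>j\<in>J. c' j * b j x) = (\<Sum>j\<in>J'. c j * b' j x)" for x
    proof -
      have "(\<Sum>j\<in>J. c' j * b j x) = - s * b k x + (\<Sum>j\<in>J'. c' j * b j x)"
        using sum.remove[OF insert.prems(1) k(1), of "\<lambda>j. c' j * b j x"]
        by (simp add: c'_def J'_def)
      also have "(\<Sum>j\<in>J'. c' j * b j x) = (\<Sum>j\<in>J'. c j * b j x)"
        by (rule sum.cong) (auto simp: c'_def J'_def)
      also have "- s * b k x + (\<Sum>j\<in>J'. c j * b j x) = (\<Sum>j\<in>J'. c j * b' j x)"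
        by (simp add: s_def b'_def sum_distrib_left sum_subtractf algebra_simps)
      finally show ?thesis .
    qed
    have "(\<Sum>j\<in>J. c' j * b j x) = 0" if "x \<in> insert d D" for x
      using that c(2) k unfolding split by (auto simp: b'_def)
    moreover have "\<exists>j\<in>J. c' j \<noteq> 0" using c(1) by (auto simp: c'_def J'_def)
    ultimately show ?thesis by blast
  qed
qed

text \<open>Adjoining \<open>f\<close> (in the slot \<open>None\<close>) gives more vectors than
  points of \<open>D\<close>, so a nontrivial combination vanishes on \<open>D\<close> and hence
  everywhere. Independence of the old family keeps the coefficient of \<open>f\<close> from being
  zero.\<close>

lemma spanning_family:
  assumes V: "cfun.subspace V" and D: "finite D" "\<And>f. f \<in> V \<Longrightarrow> \<forall>d\<in>D. f d = 0 \<Longrightarrow> f = 0"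
    and b: "\<And>j. j \<in> J \<Longrightarrow> b j \<in> V" and J: "finite J" "card D \<le> card J"
    and indep: "\<And>c. (\<Sum>j\<in>J. fscale (c j) (b j)) = 0 \<Longrightarrow> \<forall>j\<in>J. c j = 0"
    and f: "f \<in> V"
  shows "\<exists>c. f = (\<Sum>j\<in>J. fscale (c j) (b j))"
proof -
  let ?J = "insert None (Some ` J)"
  define b' where "b' = case_option f b"
  have "card D < card ?J" using J by (simp add: card_image)
  then obtain c where c: "\<exists>j\<in>?J. c j \<noteq> 0" "\<forall>d\<in>D. (\<Sum>j\<in>?J. c j * b' j d) = 0"
    using underdetermined_system[OF D(1), of ?J b'] J by blast
  have split: "(\<Sum>j\<in>?J. fscale (c j) (b' j)) =
      fscale (c None) f + (\<Sum>j\<in>J. fscale (c (Some j)) (b j))"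
    using J(1) by (simp add: sum.reindex b'_def del: plus_fun_apply fscale_apply)
  have "(\<Sum>j\<in>?J. fscale (c j) (b' j)) = 0"
  proof (rule D(2))
    show "(\<Sum>j\<in>?J. fscale (c j) (b' j)) \<in> V"
      by (rule cfun.subspace_sum[OF V])
         (use f b in \<open>auto simp: b'_def intro!: cfun.subspace_scale[OF V] simp del: fscale_apply\<close>)
    show "\<forall>d\<in>D. (\<Sum>j\<in>?J. fscale (c j) (b' j)) d = 0"
      using c(2) by (simp only: sum_fun_apply fscale_apply)
  qed
  then have eq: "fscale (c None) f + (\<Sum>j\<in>J. fscale (c (Some j)) (b j)) = 0"
    using split by simp
  have c0: "c None \<noteq> 0"
  proof
    assume "c None = 0"
    then have "\<forall>j\<in>J. c (Some j) = 0" using indep eq by simp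
    then show False using c(1) \<open>c None = 0\<close> by auto
  qed
  have "f x = (\<Sum>j\<in>J. fscale (- c (Some j) / c None) (b j)) x" for x
  proof -
    have "c None * f x = - (\<Sum>j\<in>J. c (Some j) * b j x)"
      using fun_cong[OF eq, of x] by (simp add: sum_fun_apply eq_neg_iff_add_eq_0)
    then have "f x = - (\<Sum>j\<in>J. c (Some j) * b j x) / c None"
      using c0 by (simp add: field_simps)
    then show ?thesis by (simp add: sum_fun_apply sum_negf sum_divide_distrib)
  qed
  then have "f = (\<Sum>j\<in>J. fscale (- c (Some j) / c None) (b j))" by (rule ext)
  then show ?thesis by (rule exI[of _ "\<lambda>j. - c (Some j) / c None"])
qed

text \<open>By directness the independent families of the members are independent together; having
  at least as many vectors as there are determining points, they span.\<close>

lemma (in irreducible_family) sum_space_full: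
  assumes n: "\<And>i. i \<in> I \<Longrightarrow> dim_at_least (W i) (n i)"
    and D: "finite D" "\<And>f. f \<in> rep_space R \<Longrightarrow> \<forall>d\<in>D. f d = 0 \<Longrightarrow> f = 0"
    and card: "card D \<le> (\<Sum>i\<in>I. n i)"
  shows "rep_space R \<subseteq> sum_space I W"
proof
  fix f assume f: "f \<in> rep_space R"
  have "\<forall>i. \<exists>b. i \<in> I \<longrightarrow> (\<forall>j<n i. b j \<in> W i) \<and>
    (\<forall>c. (\<Sum>j<n i. fscale (c j) (b j)) = 0 \<longrightarrow> (\<forall>j<n i. c j = 0))"
    using n unfolding dim_at_least_def by blast
  from choice[OF this] obtain b where b: "\<And>i j. i \<in> I \<Longrightarrow> j < n i \<Longrightarrow> b i j \<in> W i"
    "\<And>i c. i \<in> I \<Longrightarrow> (\<Sum>j<n i. fscale (c j) (b i j)) = 0 \<Longrightarrow> (\<forall>j<n i. c j = 0)"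
    by blast
  let ?J = "Sigma I (\<lambda>i. {..<n i})"
  have d: "direct I W" by (rule direct_subset) simp
  have split: "(\<Sum>p\<in>?J. fscale (c p) (case p of (i, j) \<Rightarrow> b i j)) =
      (\<Sum>i\<in>I. \<Sum>j<n i. fscale (c (i, j)) (b i j))" for c
    using sum.Sigma[OF finite_I, of "\<lambda>i. {..<n i}" "\<lambda>i j. fscale (c (i, j)) (b i j)"]
    by (simp add: split_def)
  have inW: "(\<Sum>j<n i. fscale (c (i, j)) (b i j)) \<in> W i" if "i \<in> I" for i and c :: "'i \<times> nat \<Rightarrow> complex"
    using that b(1) by (intro cfun.subspace_sum[OF W_subspace] cfun.subspace_scale[OF W_subspace]) auto
  have "\<exists>c. f = (\<Sum>p\<in>?J. fscale (c p) (case p of (i, j) \<Rightarrow> b i j))"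
  proof (rule spanning_family[OF is_repD(1)[OF R] D _ _ _ _ f])
    show "(case p of (i, j) \<Rightarrow> b i j) \<in> rep_space R" if "p \<in> ?J" for p
      using that b(1) W_sub by auto
    show "card D \<le> card ?J" using card finite_I by simp
    show "\<forall>p\<in>?J. c p = 0" if "(\<Sum>p\<in>?J. fscale (c p) (case p of (i, j) \<Rightarrow> b i j)) = 0" for c
    proof -
      have "\<forall>i\<in>I. (\<Sum>j<n i. fscale (c (i, j)) (b i j)) = 0"
        using d[unfolded direct_def, rule_format, of "\<lambda>i. \<Sum>j<n i. fscale (c (i, j)) (b i j)"]
          inW that unfolding split by blast
      then have "c (i, j) = 0" if "i \<in> I" "j < n i" for i j
        using b(2)[of i "\<lambda>j. c (i, j)"] that by simp
      then show ?thesis by auto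
    qed
  qed (use finite_I in auto)
  then obtain c where "f = (\<Sum>i\<in>I. \<Sum>j<n i. fscale (c (i, j)) (b i j))"
    unfolding split by blast
  then show "f \<in> sum_space I W"
    unfolding sum_space_def using inW[of _ c]
    by (intro CollectI exI[of _ "\<lambda>i. \<Sum>j<n i. fscale (c (i, j)) (b i j)"]) auto
qed

subsection \<open>Decomposition into a sum of two families\<close>

lemma is_rep_rep_Sum:
  fixes \<pi> :: "'i \<Rightarrow> ('g, 'x) rep"
  assumes "\<And>i. i \<in> I \<Longrightarrow> is_rep G (\<pi> i)"
  shows "is_rep G (rep_Sum I \<pi>)"
proof -
  note r = is_repD[OF assms]
  have curry_simps: "curry (f + g) i = curry f i + curry g i" "curry (fscale c f) i = fscale c (curry f i)"
    "curry 0 i = 0" for f g :: "'i \<times> 'x \<Rightarrow> complex" and c i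
    by (auto simp: fun_eq_iff)
  have curry_act: "curry (rep_act (rep_Sum I \<pi>) g f) i = (if i \<in> I then rep_act (\<pi> i) g (curry f i) else 0)"
    for g f i by (auto simp: rep_Sum_def fun_eq_iff)
  have mem: "f \<in> rep_space (rep_Sum I \<pi>) \<longleftrightarrow>
      (\<forall>i\<in>I. curry f i \<in> rep_space (\<pi> i)) \<and> (\<forall>i. i \<notin> I \<longrightarrow> curry f i = 0)" for f
    by (auto simp: rep_Sum_def)
  have eqI: "f = g" if "\<And>i. curry f i = curry g i" for f g :: "'i \<times> 'x \<Rightarrow> complex"
    using that by (metis case_prod_curry ext)
  show ?thesis
    unfolding is_rep_def
  proof (intro conjI ballI)
    show "cfun.subspace (rep_space (rep_Sum I \<pi>))"
      by (rule cfun.subspaceI)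
         (auto simp: mem curry_simps cfun.subspace_0[OF r(1)] cfun.subspace_add[OF r(1)]
           cfun.subspace_scale[OF r(1)] simp del: curry_conv plus_fun_apply fscale_apply)
    show "linear_between (rep_space (rep_Sum I \<pi>)) (rep_space (rep_Sum I \<pi>)) (rep_act (rep_Sum I \<pi>) g)"
      if g: "g \<in> carrier G" for g
      by (rule linear_betweenI)
         (use g in \<open>auto simp: mem curry_simps curry_act r(5) intro!: eqI
           simp: linear_betweenD(2,3)[OF r(2)] simp del: curry_conv plus_fun_apply fscale_apply\<close>)
    show "rep_act (rep_Sum I \<pi>) \<one>\<^bsub>G\<^esub> v = v" if "v \<in> rep_space (rep_Sum I \<pi>)" for v
      by (rule eqI) (use that in \<open>simp add: mem curry_act r(3) del: curry_conv\<close>)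
    show "rep_act (rep_Sum I \<pi>) (g \<otimes>\<^bsub>G\<^esub> h) v = rep_act (rep_Sum I \<pi>) g (rep_act (rep_Sum I \<pi>) h v)"
      if "g \<in> carrier G" "h \<in> carrier G" "v \<in> rep_space (rep_Sum I \<pi>)" for g h v
      by (rule eqI) (use that in \<open>simp add: mem curry_act r(4) del: curry_conv\<close>)
  qed
qed

lemma is_rep_rep_plus:
  fixes \<pi> :: "('g, 'x) rep" and \<sigma> :: "('g, 'y) rep"
  assumes \<pi>: "is_rep G \<pi>" and \<sigma>: "is_rep G \<sigma>"
  shows "is_rep G (rep_plus \<pi> \<sigma>)"
proof -
  note r = is_repD[OF \<pi>] and s = is_repD[OF \<sigma>]
  have comp_simps: "(f + g) \<circ> h = (f \<circ> h) + (g \<circ> h)" "fscale c f \<circ> h = fscale c (f \<circ> h)" "0 \<circ> h = 0"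
    for f g :: "'z \<Rightarrow> complex" and h :: "'w \<Rightarrow> 'z" and c
    by (auto simp: fun_eq_iff)
  have act: "rep_act (rep_plus \<pi> \<sigma>) g f \<circ> Inl = rep_act \<pi> g (f \<circ> Inl)"
    "rep_act (rep_plus \<pi> \<sigma>) g f \<circ> Inr = rep_act \<sigma> g (f \<circ> Inr)" for g f
    by (auto simp: rep_plus_def fun_eq_iff)
  have mem: "f \<in> rep_space (rep_plus \<pi> \<sigma>) \<longleftrightarrow> f \<circ> Inl \<in> rep_space \<pi> \<and> f \<circ> Inr \<in> rep_space \<sigma>" for f
    by (auto simp: rep_plus_def)
  have eqI: "f = g" if "f \<circ> Inl = g \<circ> Inl" "f \<circ> Inr = g \<circ> Inr" for f g :: "'x + 'y \<Rightarrow> complex"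
    using that by (metis (no_types) ext comp_apply sum.exhaust)
  show ?thesis
    unfolding is_rep_def
  proof (intro conjI ballI)
    show "cfun.subspace (rep_space (rep_plus \<pi> \<sigma>))"
      by (rule cfun.subspaceI)
         (auto simp: mem comp_simps cfun.subspace_0[OF r(1)] cfun.subspace_add[OF r(1)]
           cfun.subspace_scale[OF r(1)] cfun.subspace_0[OF s(1)] cfun.subspace_add[OF s(1)]
           cfun.subspace_scale[OF s(1)] simp del: comp_apply plus_fun_apply fscale_apply)
    show "linear_between (rep_space (rep_plus \<pi> \<sigma>)) (rep_space (rep_plus \<pi> \<sigma>)) (rep_act (rep_plus \<pi> \<sigma>) g)"
      if g: "g \<in> carrier G" for g
      by (rule linear_betweenI)
         (use g in \<open>auto simp: mem comp_simps act r(5) s(5) linear_betweenD(2,3)[OF r(2)]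
           linear_betweenD(2,3)[OF s(2)] intro!: eqI simp del: comp_apply plus_fun_apply fscale_apply\<close>)
    show "rep_act (rep_plus \<pi> \<sigma>) \<one>\<^bsub>G\<^esub> v = v" if "v \<in> rep_space (rep_plus \<pi> \<sigma>)" for v
      by (rule eqI) (use that in \<open>simp_all add: mem act r(3) s(3)\<close>)
    show "rep_act (rep_plus \<pi> \<sigma>) (g \<otimes>\<^bsub>G\<^esub> h) v = rep_act (rep_plus \<pi> \<sigma>) g (rep_act (rep_plus \<pi> \<sigma>) h v)"
      if "g \<in> carrier G" "h \<in> carrier G" "v \<in> rep_space (rep_plus \<pi> \<sigma>)" for g h v
      by (rule eqI) (use that in \<open>simp_all add: mem act r(4) s(4)\<close>)
  qed
qed

lemma sum_Plus_split:
  fixes f :: "'i + 'j \<Rightarrow> 'b::comm_monoid_add"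
  assumes "finite A" "finite B"
  shows "(\<Sum>k\<in>A <+> B. f k) = (\<Sum>i\<in>A. f (Inl i)) + (\<Sum>j\<in>B. f (Inr j))"
  using assms by (simp add: sum.Plus comp_def)

text \<open>The scheme of the final argument, freed from the groups at hand: for each constituent a
  nonzero intertwiner and a dimension bound, and one inequality between counts that closes the gap.
  The equivalence is the sum \<Phi> of the chosen intertwiners.\<close>

lemma decomposition:
  fixes \<pi> :: "'i \<Rightarrow> ('g, 'x) rep" and \<rho> :: "'j \<Rightarrow> ('g, 'y) rep" and R :: "('g, 'z) rep"
  assumes R: "is_rep G R" and fin: "finite A" "finite B"
    and \<pi>: "\<And>i. i \<in> A \<Longrightarrow> irreducible_rep G (\<pi> i)"
    and \<rho>: "\<And>j. j \<in> B \<Longrightarrow> irreducible_rep G (\<rho> j)"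
    and T: "\<And>i. i \<in> A \<Longrightarrow> \<exists>T. intertwiner G (\<pi> i) R T \<and> (\<exists>v\<in>rep_space (\<pi> i). T v \<noteq> 0)"
    and S: "\<And>j. j \<in> B \<Longrightarrow> \<exists>T. intertwiner G (\<rho> j) R T \<and> (\<exists>v\<in>rep_space (\<rho> j). T v \<noteq> 0)"
    and ineq: "\<And>i i'. i \<in> A \<Longrightarrow> i' \<in> A \<Longrightarrow> i \<noteq> i' \<Longrightarrow> \<not> rep_equiv G (\<pi> i) (\<pi> i')"
      "\<And>j j'. j \<in> B \<Longrightarrow> j' \<in> B \<Longrightarrow> j \<noteq> j' \<Longrightarrow> \<not> rep_equiv G (\<rho> j) (\<rho> j')"
      "\<And>i j. i \<in> A \<Longrightarrow> j \<in> B \<Longrightarrow> \<not> rep_equiv G (\<pi> i) (\<rho> j)"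
    and dim: "\<And>i. i \<in> A \<Longrightarrow> dim_at_least (rep_space (\<pi> i)) m"
      "\<And>j. j \<in> B \<Longrightarrow> dim_at_least (rep_space (\<rho> j)) n"
    and D: "finite D" "\<And>f. f \<in> rep_space R \<Longrightarrow> \<forall>d\<in>D. f d = 0 \<Longrightarrow> f = 0"
    and card: "card D \<le> card A * m + card B * n"
  shows "multiplicity_free G R" "rep_equiv G R (rep_plus (rep_Sum A \<pi>) (rep_Sum B \<rho>))"
proof -
  from T have "\<forall>i\<in>A. \<exists>T. intertwiner G (\<pi> i) R T \<and> (\<exists>v\<in>rep_space (\<pi> i). T v \<noteq> 0)" ..
  from bchoice[OF this] obtain T
    where TT: "\<forall>i\<in>A. intertwiner G (\<pi> i) R (T i) \<and> (\<exists>v\<in>rep_space (\<pi> i). T i v \<noteq> 0)" ..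
  have T: "intertwiner G (\<pi> i) R (T i)" and T0: "\<exists>v\<in>rep_space (\<pi> i). T i v \<noteq> 0" if "i \<in> A" for i
    using TT[rule_format, OF that] by simp_all
  from S have "\<forall>j\<in>B. \<exists>T. intertwiner G (\<rho> j) R T \<and> (\<exists>v\<in>rep_space (\<rho> j). T v \<noteq> 0)" ..
  from bchoice[OF this] obtain S
    where SS: "\<forall>j\<in>B. intertwiner G (\<rho> j) R (S j) \<and> (\<exists>v\<in>rep_space (\<rho> j). S j v \<noteq> 0)" ..
  have S: "intertwiner G (\<rho> j) R (S j)" and S0: "\<exists>v\<in>rep_space (\<rho> j). S j v \<noteq> 0" if "j \<in> B" for j
    using SS[rule_format, OF that] by simp_all
  have Tinj: "inj_on (T i) (rep_space (\<pi> i))" if "i \<in> A" for i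
    using T0[OF that] by (auto intro: schur_inj[OF \<pi>[OF that] R T[OF that]])
  have Sinj: "inj_on (S j) (rep_space (\<rho> j))" if "j \<in> B" for j
    using S0[OF that] by (auto intro: schur_inj[OF \<rho>[OF that] R S[OF that]])
  note \<pi>r = irreducible_repD(1)[OF \<pi>] and \<rho>r = irreducible_repD(1)[OF \<rho>]
  define W where "W = case_sum (\<lambda>i. T i ` rep_space (\<pi> i)) (\<lambda>j. S j ` rep_space (\<rho> j))"
  have W: "W (Inl i) = T i ` rep_space (\<pi> i)" "W (Inr j) = S j ` rep_space (\<rho> j)" for i j
    by (simp_all add: W_def)
  have eqA: "rep_equiv G (\<pi> i) (subrep R (W (Inl i)))" "rep_equiv G (subrep R (W (Inl i))) (\<pi> i)"
    if "i \<in> A" for i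
    using irreducible_image(2)[OF \<pi>[OF that] R T[OF that] Tinj[OF that]] rep_equiv_sym[OF \<pi>r[OF that]]
    by (simp_all add: W)
  have eqB: "rep_equiv G (\<rho> j) (subrep R (W (Inr j)))" "rep_equiv G (subrep R (W (Inr j))) (\<rho> j)"
    if "j \<in> B" for j
    using irreducible_image(2)[OF \<rho>[OF that] R S[OF that] Sinj[OF that]] rep_equiv_sym[OF \<rho>r[OF that]]
    by (simp_all add: W)
  have Wirr: "irreducible_rep G (subrep R (W k))" if "k \<in> A <+> B" for k
    using that irreducible_image(1)[OF \<pi> R T Tinj] irreducible_image(1)[OF \<rho> R S Sinj]
    by (auto simp: W)
  interpret irreducible_family G R "A <+> B" W
  proof
    show "finite (A <+> B)" using fin by simp
    show "W k \<subseteq> rep_space R" if "k \<in> A <+> B" for k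
      using that intertwinerD(2)[OF T] intertwinerD(2)[OF S] by (auto simp: W)
    show "\<not> rep_equiv G (subrep R (W k)) (subrep R (W l))"
      if "k \<in> A <+> B" "l \<in> A <+> B" "k \<noteq> l" for k l
    proof
      assume e: "rep_equiv G (subrep R (W k)) (subrep R (W l))"
      \<comment> \<open>Inequivalence between the two families is given in one order only; the
        opposite order uses the reversed equivalence.\<close>
      have e': "rep_equiv G (subrep R (W l)) (subrep R (W k))"
        by (rule rep_equiv_sym[OF irreducible_repD(1)[OF Wirr[OF that(1)]] e])
      show False
      proof (cases k; cases l)
        fix i i' assume "k = Inl i" "l = Inl i'"
        then show False using that e ineq(1)[of i i'] rep_equiv_trans[OF rep_equiv_trans[OF eqA(1)[of i] _] eqA(2)[of i']] by auto
      next
        fix i j assume "k = Inl i" "l = Inr j"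
        then show False using that e ineq(3)[of i j] rep_equiv_trans[OF rep_equiv_trans[OF eqA(1)[of i] _] eqB(2)[of j]] by auto
      next
        fix j i assume "k = Inr j" "l = Inl i"
        then show False using that e' ineq(3)[of i j] rep_equiv_trans[OF rep_equiv_trans[OF eqA(1)[of i] _] eqB(2)[of j]] by auto
      next
        fix j j' assume "k = Inr j" "l = Inr j'"
        then show False using that e ineq(2)[of j j'] rep_equiv_trans[OF rep_equiv_trans[OF eqB(1)[of j] _] eqB(2)[of j']] by auto
      qed
    qed
  qed (use R Wirr in auto)
  have full: "rep_space R \<subseteq> sum_space (A <+> B) W"
  proof (rule sum_space_full[OF _ D, of "case_sum (\<lambda>_. m) (\<lambda>_. n)"])
    show "dim_at_least (W k) (case_sum (\<lambda>_. m) (\<lambda>_. n) k)" if "k \<in> A <+> B" for k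
      using that
        dim_at_least_image[OF intertwinerD(1)[OF T] is_repD(1)[OF \<pi>r] Tinj dim(1)]
        dim_at_least_image[OF intertwinerD(1)[OF S] is_repD(1)[OF \<rho>r] Sinj dim(2)]
      by (auto simp: W)
    show "card D \<le> (\<Sum>k\<in>A <+> B. case_sum (\<lambda>_. m) (\<lambda>_. n) k)"
      using card fin by (simp add: sum_Plus_split)
  qed
  show "multiplicity_free G R" by (rule multiplicity_free[OF full])
  let ?\<Sigma> = "rep_plus (rep_Sum A \<pi>) (rep_Sum B \<rho>)"
  have \<Sigma>: "is_rep G ?\<Sigma>"
    by (intro is_rep_rep_plus is_rep_rep_Sum \<pi>r \<rho>r)
  define a where "a f i = curry (f \<circ> Inl) i" for f :: "'i \<times> 'x + 'j \<times> 'y \<Rightarrow> complex" and i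
  define b where "b f j = curry (f \<circ> Inr) j" for f :: "'i \<times> 'x + 'j \<times> 'y \<Rightarrow> complex" and j
  have mem: "f \<in> rep_space ?\<Sigma> \<longleftrightarrow> (\<forall>i\<in>A. a f i \<in> rep_space (\<pi> i)) \<and> (\<forall>i. i \<notin> A \<longrightarrow> a f i = 0) \<and>
      (\<forall>j\<in>B. b f j \<in> rep_space (\<rho> j)) \<and> (\<forall>j. j \<notin> B \<longrightarrow> b f j = 0)" for f
    by (auto simp: rep_plus_def rep_Sum_def a_def b_def)
  have ab: "a (f + g) i = a f i + a g i" "a (fscale c f) i = fscale c (a f i)"
     "b (f + g) j = b f j + b g j" "b (fscale c f) j = fscale c (b f j)" for f g c i j
    by (auto simp: a_def b_def fun_eq_iff)
  have ab_act: "i \<in> A \<Longrightarrow> a (rep_act ?\<Sigma> g f) i = rep_act (\<pi> i) g (a f i)"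
     "j \<in> B \<Longrightarrow> b (rep_act ?\<Sigma> g f) j = rep_act (\<rho> j) g (b f j)" for g f i j
    by (auto simp: rep_plus_def rep_Sum_def a_def b_def fun_eq_iff curry_def comp_def)
  define \<Phi> where "\<Phi> f = (\<Sum>k\<in>A <+> B. case_sum (\<lambda>i. T i (a f i)) (\<lambda>j. S j (b f j)) k)" for f
  have \<Phi>W: "case_sum (\<lambda>i. T i (a f i)) (\<lambda>j. S j (b f j)) k \<in> W k"
    if "f \<in> rep_space ?\<Sigma>" "k \<in> A <+> B" for f k
    using that by (auto simp: mem W)
  have \<Phi>: "intertwiner G ?\<Sigma> R \<Phi>"
    unfolding intertwiner_def
  proof (intro conjI ballI linear_betweenI)
    show "\<Phi> f \<in> rep_space R" if "f \<in> rep_space ?\<Sigma>" for f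
      unfolding \<Phi>_def
      by (rule cfun.subspace_sum[OF is_repD(1)[OF R]]) (use \<Phi>W[OF that] W_sub in blast)
    show "\<Phi> (f + g) = \<Phi> f + \<Phi> g" if "f \<in> rep_space ?\<Sigma>" "g \<in> rep_space ?\<Sigma>" for f g
      unfolding \<Phi>_def sum.distrib[symmetric]
      by (rule sum.cong)
         (use that in \<open>auto simp: mem ab linear_betweenD(2)[OF intertwinerD(1)[OF T]]
           linear_betweenD(2)[OF intertwinerD(1)[OF S]] simp del: plus_fun_apply\<close>)
    show "\<Phi> (fscale c f) = fscale c (\<Phi> f)" if "f \<in> rep_space ?\<Sigma>" for c f
      unfolding \<Phi>_def cfun.scale_sum_right
      by (rule sum.cong)
         (use that in \<open>auto simp: mem ab linear_betweenD(3)[OF intertwinerD(1)[OF T]]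
           linear_betweenD(3)[OF intertwinerD(1)[OF S]] simp del: fscale_apply\<close>)
    show "\<Phi> (rep_act ?\<Sigma> g f) = rep_act R g (\<Phi> f)" if "g \<in> carrier G" "f \<in> rep_space ?\<Sigma>" for g f
    proof -
      have "rep_act R g (\<Phi> f) =
          (\<Sum>k\<in>A <+> B. rep_act R g (case_sum (\<lambda>i. T i (a f i)) (\<lambda>j. S j (b f j)) k))"
        unfolding \<Phi>_def
        by (rule linear_between_sum[OF is_repD(2)[OF R that(1)] is_repD(1)[OF R]])
           (use \<Phi>W[OF that(2)] W_sub in blast)
      also have "\<dots> = \<Phi> (rep_act ?\<Sigma> g f)"
        unfolding \<Phi>_def
        by (rule sum.cong)
           (use that in \<open>auto simp: ab_act mem intertwinerD(3)[OF T] intertwinerD(3)[OF S]\<close>)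
      finally show ?thesis by simp
    qed
  qed
  have d: "direct (A <+> B) W" by (rule direct_subset) simp
  have "inj_on \<Phi> (rep_space ?\<Sigma>)"
    unfolding linear_between_inj[OF intertwinerD(1)[OF \<Phi>] is_repD(1)[OF \<Sigma>]]
  proof (intro ballI impI)
    fix f assume f: "f \<in> rep_space ?\<Sigma>" "\<Phi> f = 0"
    then have *: "\<forall>k\<in>A <+> B. case_sum (\<lambda>i. T i (a f i)) (\<lambda>j. S j (b f j)) k = 0"
      using d[unfolded direct_def, rule_format, of "case_sum (\<lambda>i. T i (a f i)) (\<lambda>j. S j (b f j))"] \<Phi>W
      unfolding \<Phi>_def by blast
    have "a f i = 0" for i
    proof (cases "i \<in> A")
      case True
      then show ?thesis
        using *[rule_format, of "Inl i"] f(1) Tinj[OF True]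
        unfolding linear_between_inj[OF intertwinerD(1)[OF T[OF True]] is_repD(1)[OF \<pi>r[OF True]]] mem
        by auto
    qed (use f mem in auto)
    moreover have "b f j = 0" for j
    proof (cases "j \<in> B")
      case True
      then show ?thesis
        using *[rule_format, of "Inr j"] f(1) Sinj[OF True]
        unfolding linear_between_inj[OF intertwinerD(1)[OF S[OF True]] is_repD(1)[OF \<rho>r[OF True]]] mem
        by auto
    qed (use f mem in auto)
    ultimately have "f z = 0" for z
      by (cases z) (auto simp: a_def b_def fun_eq_iff)
    then show "f = 0" by auto
  qed
  moreover have "rep_space R \<subseteq> \<Phi> ` rep_space ?\<Sigma>"
  proof
    fix f assume "f \<in> rep_space R"
    then obtain w where w: "\<And>k. k \<in> A <+> B \<Longrightarrow> w k \<in> W k" "f = (\<Sum>k\<in>A <+> B. w k)"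
      using full unfolding sum_space_def by blast
    define u where "u i = inv_into (rep_space (\<pi> i)) (T i) (w (Inl i))" for i
    define u' where "u' j = inv_into (rep_space (\<rho> j)) (S j) (w (Inr j))" for j
    have u: "u i \<in> rep_space (\<pi> i)" "T i (u i) = w (Inl i)" if "i \<in> A" for i
      using w(1)[OF InlI[OF that]] by (auto simp: W u_def inv_into_into f_inv_into_f)
    have u': "u' j \<in> rep_space (\<rho> j)" "S j (u' j) = w (Inr j)" if "j \<in> B" for j
      using w(1)[OF InrI[OF that]] by (auto simp: W u'_def inv_into_into f_inv_into_f)
    define g where "g = case_sum (\<lambda>(i, x). if i \<in> A then u i x else 0) (\<lambda>(j, y). if j \<in> B then u' j y else 0)"
    have g: "a g i = (if i \<in> A then u i else 0)" "b g j = (if j \<in> B then u' j else 0)" for i j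
      by (auto simp: g_def a_def b_def fun_eq_iff)
    have "g \<in> rep_space ?\<Sigma>" using u u' by (auto simp: mem g)
    moreover have "\<Phi> g = f"
      unfolding \<Phi>_def w(2) by (rule sum.cong) (auto simp: g u u')
    ultimately show "f \<in> \<Phi> ` rep_space ?\<Sigma>" by blast
  qed
  ultimately have "bij_betw \<Phi> (rep_space ?\<Sigma>) (rep_space R)"
    using intertwinerD(2)[OF \<Phi>] unfolding bij_betw_def by blast
  then show "rep_equiv G R ?\<Sigma>"
    using \<Phi> rep_equiv_sym[OF \<Sigma>, of R] unfolding rep_equiv_def by blast
qed

section \<open>Finite fields\<close>

subsection \<open>Counting in fibres and roots\<close>

text \<open>If no fibre exceeds the average size, every fibre attains it. This turns degree bounds
  for polynomials into exact fibre sizes of norm and trace.\<close>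

lemma card_fibre_eq:
  fixes f :: "'u \<Rightarrow> 'v"
  assumes A: "finite A" and B: "finite B" and f: "f ` A \<subseteq> B"
    and le: "\<And>b. b \<in> B \<Longrightarrow> card {a \<in> A. f a = b} \<le> m" and card: "card A = m * card B"
    and b: "b \<in> B"
  shows "card {a \<in> A. f a = b} = m"
proof -
  have "(\<Sum>b\<in>B. card {a \<in> A. f a = b}) = (\<Sum>a\<in>A. 1)"
    using sum.group[OF A B f, of "\<lambda>_. 1::nat"] by simp
  then have "(\<Sum>b\<in>B. card {a \<in> A. f a = b}) = (\<Sum>b\<in>B. m)"
    using card by simp
  then show ?thesis by (rule sum_mono_inv) (use le b B in auto)
qed

lemma card_roots_le:
  fixes P :: "'a::{field,finite} \<Rightarrow> bool"
  assumes "Q \<noteq> 0" "Polynomial.degree Q \<le> n" "\<And>x. P x \<Longrightarrow> poly Q x = 0"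
  shows "card {x. P x} \<le> n"
proof -
  have "card {x. P x} \<le> card {x. poly Q x = 0}"
    by (rule card_mono) (use assms(3) in auto)
  also have "\<dots> \<le> degree Q" by (rule card_poly_roots_bound) fact
  finally show ?thesis using assms(2) by simp
qed

lemma card_roots_power:
  fixes c :: "'a::{field,finite}"
  assumes "0 < n"
  shows "card {x. x ^ n = c} \<le> n"
proof (rule card_roots_le)
  let ?Q = "Polynomial.monom 1 n - [:c:] :: 'a poly"
  have "Polynomial.coeff ?Q n = 1" using assms by (simp add: coeff_pCons split: nat.split)
  then show "?Q \<noteq> 0" by (metis coeff_0 zero_neq_one)
  show "Polynomial.degree ?Q \<le> n" by (rule degree_diff_le) (auto simp: degree_monom_le)
qed (simp add: poly_monom)

lemma card_roots_power_plus:
  fixes a c :: "'a::{field,finite}"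
  assumes "1 < n"
  shows "card {x. x ^ n + a * x = c} \<le> n"
proof (rule card_roots_le)
  let ?Q = "Polynomial.monom 1 n + [:-c, a:] :: 'a poly"
  have "Polynomial.coeff ?Q n = 1" using assms by (auto simp: coeff_pCons split: nat.split)
  then show "?Q \<noteq> 0" by (metis coeff_0 zero_neq_one)
  show "Polynomial.degree ?Q \<le> n"
    by (rule degree_add_le) (use assms in \<open>auto simp: degree_monom_le\<close>)
qed (auto simp: poly_monom algebra_simps)

subsection \<open>Subfields and their characters\<close>

locale subfield =
  fixes F :: "'a::{field,finite} set"
  assumes is_subfield: "is_subfield F"
begin

lemma closed [simp, intro]:
  "0 \<in> F" "1 \<in> F" "x \<in> F \<Longrightarrow> y \<in> F \<Longrightarrow> x + y \<in> F" "x \<in> F \<Longrightarrow> y \<in> F \<Longrightarrow> x * y \<in> F"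
  "x \<in> F \<Longrightarrow> - x \<in> F" "x \<in> F \<Longrightarrow> inverse x \<in> F"
  using is_subfield by (auto simp: is_subfield_def)

lemma closed_diff [simp, intro]: "x \<in> F \<Longrightarrow> y \<in> F \<Longrightarrow> x - y \<in> F"
  using closed(3)[of x "- y"] closed(5) by simp

lemma closed_divide [simp, intro]: "x \<in> F \<Longrightarrow> y \<in> F \<Longrightarrow> x / y \<in> F"
  by (simp add: divide_inverse)

lemma closed_power [simp, intro]: "x \<in> F \<Longrightarrow> x ^ n \<in> F"
  by (induction n) auto

lemma two_le_card: "2 \<le> card F"
proof -
  have "card {0, 1 :: 'a} \<le> card F" by (rule card_mono) auto
  then show ?thesis by simp
qed

lemma card_units: "card (F - {0}) = card F - 1"
  by (simp add: card_Diff_singleton)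

lemma bij_mult: "c \<in> F - {0} \<Longrightarrow> bij_betw (\<lambda>x. c * x) F F"
  by (rule bij_betwI[where g = "\<lambda>x. inverse c * x"]) (auto simp: field_simps)

lemma bij_mult_units: "c \<in> F - {0} \<Longrightarrow> bij_betw (\<lambda>x. c * x) (F - {0}) (F - {0})"
  by (rule bij_betwI[where g = "\<lambda>x. inverse c * x"]) (auto simp: field_simps)

lemma bij_inverse_units: "bij_betw inverse (F - {0}) (F - {0})"
  by (rule bij_betwI[where g = inverse]) auto

lemma power_card_units:
  assumes "x \<in> F - {0}"
  shows "x ^ (card F - 1) = 1"
proof -
  have "(\<Prod>y\<in>F - {0}. y) = (\<Prod>y\<in>F - {0}. x * y)"
    using prod.reindex_bij_betw[OF bij_mult_units[OF assms], of "\<lambda>y. y"] by simp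
  also have "\<dots> = x ^ (card F - 1) * (\<Prod>y\<in>F - {0}. y)"
    by (simp add: prod.distrib card_units)
  finally show ?thesis by simp
qed

lemma power_card:
  assumes "x \<in> F"
  shows "x ^ card F = x"
proof (cases "x = 0")
  case True
  then show ?thesis using two_le_card by simp
next
  case False
  have "x ^ card F = x ^ (Suc (card F - 1))" using two_le_card by simp
  also have "\<dots> = x" using power_card_units[of x] assms False by (simp only: power_Suc) simp
  finally show ?thesis .
qed

text \<open>The polynomial X^(card F) - X has no room for roots outside \<open>F\<close>. Membership
  thus becomes an equation, and \<open>F\<close> the fixed set of conjugation over
  \<open>F\<close>.\<close>

lemma mem_iff: "x \<in> F \<longleftrightarrow> x ^ card F = x"
proof -
  have "card {x::'a. x ^ card F = x} \<le> card F"
    using card_roots_power_plus[of "card F" "-1" 0] two_le_card by simp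
  then have "F = {x. x ^ card F = x}"
    by (intro card_seteq) (auto simp: power_card)
  then show ?thesis by blast
qed

text \<open>The subfield is recast as a ring with explicit carrier, to which the cyclicity of the
  unit group of a finite field applies.\<close>

lemma units_generator: "\<exists>g\<in>F - {0}. \<forall>x\<in>F - {0}. \<exists>i::nat. x = g ^ i"
proof -
  define R :: "'a ring" where "R = \<lparr>carrier = F, monoid.mult = (*), one = 1, zero = 0, add = (+)\<rparr>"
  have R_simps: "carrier R = F" "monoid.mult R = (*)" "one R = 1" "zero R = 0" "add R = (+)"
    by (simp_all add: R_def)
  have "cring R"
  proof (rule cringI)
    show "abelian_group R"
      by (rule abelian_groupI) (auto simp: R_simps algebra_simps intro: bexI[of _ "- x" for x])
    show "comm_monoid R"
      by (rule comm_monoidI) (auto simp: R_simps algebra_simps)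
  qed (auto simp: R_simps algebra_simps)
  then interpret field R
    by (rule cring.cring_fieldI2)
       (auto simp: R_simps intro!: bexI[of _ "inverse x" for x])
  have pow: "x [^]\<^bsub>R\<^esub> i = x ^ i" for x and i :: nat
    by (induction i) (simp_all add: nat_pow_def R_simps mult.commute)
  have "finite (carrier R)" by (simp add: R_simps)
  from finite_field_mult_group_has_gen[OF this] obtain g
    where g: "g \<in> carrier (mult_of R)" "carrier (mult_of R) = {g [^]\<^bsub>R\<^esub> i |i::nat. i \<in> UNIV}" ..
  have "carrier (mult_of R) = F - {0}" by (simp add: R_simps)
  then show ?thesis using g unfolding pow by blast
qed

end

context
  fixes F :: "'a::field set" and \<psi> :: "'a \<Rightarrow> complex"
  assumes \<psi>: "\<psi> \<in> mult_chars F"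
begin

lemma mult_char_nonzero: "x \<in> F - {0} \<Longrightarrow> \<psi> x \<noteq> 0"
  using \<psi> by (simp add: mult_chars_def)

lemma mult_char_mult: "x \<in> F - {0} \<Longrightarrow> y \<in> F - {0} \<Longrightarrow> \<psi> (x * y) = \<psi> x * \<psi> y"
  using \<psi> by (simp add: mult_chars_def)

lemma mult_char_outside: "x \<notin> F - {0} \<Longrightarrow> \<psi> x = 0"
  using \<psi> unfolding mult_chars_def by blast

end

lemma mult_char_eqI:
  assumes "\<psi> \<in> mult_chars F" "\<phi> \<in> mult_chars F" "\<And>x. x \<in> F - {0} \<Longrightarrow> \<psi> x = \<phi> x"
  shows "\<psi> = \<phi>"
proof
  show "\<psi> x = \<phi> x" for x
    using assms mult_char_outside[OF assms(1), of x] mult_char_outside[OF assms(2), of x] by (cases "x \<in> F - {0}") auto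
qed

context subfield
begin

lemma mult_char_1: "\<psi> \<in> mult_chars F \<Longrightarrow> \<psi> 1 = 1"
  using mult_char_mult[of \<psi> F 1 1] mult_char_nonzero[of \<psi> F 1] by simp

lemma mult_char_inverse:
  assumes "\<psi> \<in> mult_chars F" "x \<in> F - {0}"
  shows "\<psi> (inverse x) = inverse (\<psi> x)"
  using mult_char_mult[OF assms(1), of x "inverse x"] mult_char_1[OF assms(1)] assms(2)
    mult_char_nonzero[OF assms]
  by (auto simp: field_simps inverse_eq_divide)

lemma mult_char_divide:
  assumes "\<psi> \<in> mult_chars F" "x \<in> F - {0}" "y \<in> F - {0}"
  shows "\<psi> (x / y) = \<psi> x / \<psi> y"
  using mult_char_mult[OF assms(1), of x "inverse y"] mult_char_inverse[OF assms(1,3)] assms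
  by (simp add: divide_inverse)

lemma mult_char_power:
  assumes "\<psi> \<in> mult_chars F" "x \<in> F - {0}"
  shows "\<psi> (x ^ n) = \<psi> x ^ n"
  by (induction n) (use assms in \<open>auto simp: mult_char_1 mult_char_mult\<close>)

text \<open>Substituting a x for x, where the two characters differ at \<open>a\<close>, multiplies
  the sum by a factor other than 1. Quotients take the place of complex conjugates.\<close>

lemma mult_char_orthogonal:
  assumes \<psi>: "\<psi> \<in> mult_chars F" and \<phi>: "\<phi> \<in> mult_chars F" and ne: "\<psi> \<noteq> \<phi>"
  shows "(\<Sum>x\<in>F - {0}. \<psi> x / \<phi> x) = 0"
proof -
  obtain a where a: "a \<in> F - {0}" "\<psi> a \<noteq> \<phi> a"
    using ne mult_char_eqI[OF \<psi> \<phi>] by blast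
  have "(\<Sum>x\<in>F - {0}. \<psi> x / \<phi> x) = (\<Sum>x\<in>F - {0}. \<psi> (a * x) / \<phi> (a * x))"
    by (rule sum.reindex_bij_betw[OF bij_mult_units[OF a(1)], symmetric])
  also have "\<dots> = \<psi> a / \<phi> a * (\<Sum>x\<in>F - {0}. \<psi> x / \<phi> x)"
    unfolding sum_distrib_left
    by (rule sum.cong) (use a \<psi> \<phi> in \<open>auto simp: mult_char_mult\<close>)
  finally have "(1 - \<psi> a / \<phi> a) * (\<Sum>x\<in>F - {0}. \<psi> x / \<phi> x) = 0"
    by (simp add: algebra_simps)
  moreover have "1 - \<psi> a / \<phi> a \<noteq> 0"
    using a mult_char_nonzero[OF \<phi> a(1)] by (simp add: field_simps)
  ultimately show ?thesis by (metis mult_eq_0_iff)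
qed

section \<open>Counting characters by their value at a generator of the unit group\<close>

definition generator :: "'a \<Rightarrow> bool"
  where "generator g \<longleftrightarrow> g \<in> F - {0} \<and> (\<forall>x\<in>F - {0}. \<exists>i::nat. x = g ^ i)"

lemma generator_power_eq_iff:
  assumes "generator g"
  shows "g ^ i = g ^ j \<longleftrightarrow> i mod (card F - 1) = j mod (card F - 1)"
proof -
  define n where "n = card F - 1"
  have n: "0 < n" using two_le_card by (simp add: n_def)
  have g: "g \<in> F - {0}" and gen: "\<forall>x\<in>F - {0}. \<exists>i::nat. x = g ^ i"
    using assms by (auto simp: generator_def)
  have gn: "g ^ n = 1" unfolding n_def by (rule power_card_units[OF g])
  have gmod: "g ^ i = g ^ (i mod n)" for i
  proof -
    have "g ^ i = g ^ (n * (i div n) + i mod n)" by simp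
    also have "\<dots> = g ^ (i mod n)" unfolding power_add power_mult gn by simp
    finally show ?thesis .
  qed
  have gF: "g ^ i \<in> F - {0}" for i using g by auto
  have "x \<in> (\<lambda>i. g ^ i) ` {..<n}" if x: "x \<in> F - {0}" for x
  proof -
    obtain i :: nat where "x = g ^ i" using gen x by blast
    then have "x = g ^ (i mod n)" using gmod by simp
    then show ?thesis using n by auto
  qed
  then have "F - {0} \<subseteq> (\<lambda>i. g ^ i) ` {..<n}" by (rule subsetI)
  moreover have "(\<lambda>i. g ^ i) ` {..<n} \<subseteq> F - {0}" by (rule image_subsetI) (rule gF)
  ultimately have im: "(\<lambda>i. g ^ i) ` {..<n} = F - {0}" by (rule equalityI[rotated])
  then have inj: "inj_on (\<lambda>i. g ^ i) {..<n}"
    using card_units by (intro eq_card_imp_inj_on) (auto simp: n_def)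
  have "g ^ (i mod n) = g ^ (j mod n) \<longleftrightarrow> i mod n = j mod n"
    using inj_onD[OF inj, of "i mod n" "j mod n"] n by auto
  then show ?thesis using gmod[of i] gmod[of j] by (simp add: n_def)
qed

lemma mult_chars_bij:
  assumes "generator g"
  shows "bij_betw (\<lambda>\<psi>. \<psi> g) (mult_chars F) {z. z ^ (card F - 1) = 1}"
proof -
  define n where "n = card F - 1"
  have n: "0 < n" using two_le_card by (simp add: n_def)
  have g: "g \<in> F - {0}" and gen: "\<forall>x\<in>F - {0}. \<exists>i::nat. x = g ^ i"
    using assms by (auto simp: generator_def)
  have gF: "g ^ i \<in> F - {0}" for i using g by auto
  \<comment> \<open>A discrete logarithm, determined only modulo the order of \<open>g\<close>;
    roots of unity of that order do not see the choice.\<close>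
  define lg where "lg x = (SOME i. x = g ^ i)" for x
  have lg: "g ^ lg x = x" if "x \<in> F - {0}" for x
  proof -
    have "\<exists>i. x = g ^ i" using gen that by blast
    from someI_ex[OF this] show ?thesis by (simp add: lg_def)
  qed
  define E where "E z = (\<lambda>x. if x \<in> F - {0} then z ^ lg x else 0)" for z :: complex
  have Eg: "E z (g ^ i) = z ^ i" if "z ^ n = 1" for z i
  proof -
    have zmod: "z ^ i = z ^ (i mod n)" for i
    proof -
      have "z ^ i = z ^ (n * (i div n) + i mod n)" by simp
      also have "\<dots> = z ^ (i mod n)" unfolding power_add power_mult that by simp
      finally show ?thesis .
    qed
    have "lg (g ^ i) mod n = i mod n"
      using lg[OF gF, of i] generator_power_eq_iff[OF assms, of "lg (g ^ i)" i] by (simp add: n_def)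
    then show ?thesis using gF[of i] zmod[of i] zmod[of "lg (g ^ i)"] by (auto simp: E_def)
  qed
  have EF: "E z \<in> mult_chars F" if "z ^ n = 1" for z
    unfolding mult_chars_def
  proof (intro CollectI conjI ballI allI impI)
    have "z \<noteq> 0" using that n by (cases n) auto
    then show "E z x \<noteq> 0" if "x \<in> F - {0}" for x using that by (simp add: E_def)
    show "E z (x * y) = E z x * E z y" if "x \<in> F - {0}" "y \<in> F - {0}" for x y
      using Eg[OF \<open>z ^ n = 1\<close>, of "lg x + lg y"] Eg[OF \<open>z ^ n = 1\<close>, of "lg x"]
        Eg[OF \<open>z ^ n = 1\<close>, of "lg y"] lg[OF that(1)] lg[OF that(2)] by (simp add: power_add)
  qed (auto simp: E_def)
  show ?thesis
    unfolding n_def[symmetric]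
  proof (rule bij_betwI[where g = E])
    show "(\<lambda>\<psi>. \<psi> g) \<in> mult_chars F \<rightarrow> {z. z ^ n = 1}"
    proof (intro funcsetI CollectI)
      fix \<psi> assume "\<psi> \<in> mult_chars F"
      then show "\<psi> g ^ n = 1"
        using mult_char_power[of \<psi> g n] power_card_units[OF g] mult_char_1[of \<psi>] g by (simp add: n_def)
    qed
    show "E \<in> {z. z ^ n = 1} \<rightarrow> mult_chars F" using EF by auto
    show "E (\<psi> g) = \<psi>" if \<psi>: "\<psi> \<in> mult_chars F" for \<psi>
    proof (rule ext)
      show "E (\<psi> g) x = \<psi> x" for x
        using mult_char_power[OF \<psi> g, of "lg x"] lg[of x] mult_char_outside[OF \<psi>, of x]
        by (auto simp: E_def)
    qed
    show "E z g = z" if "z \<in> {z. z ^ n = 1}" for z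
      using Eg[of z 1] that by simp
  qed
qed

lemma ex_generator: "\<exists>g. generator g"
  using units_generator by (auto simp: generator_def)

lemma card_mult_chars: "card (mult_chars F) = card F - 1"
proof -
  obtain g where "generator g" using ex_generator ..
  then have "card (mult_chars F) = card {z::complex. z ^ (card F - 1) = 1}"
    by (intro bij_betw_same_card[OF mult_chars_bij])
  also have "\<dots> = card F - 1" by (rule card_nth_roots) (use two_le_card in auto)
  finally show ?thesis .
qed

lemma finite_mult_chars: "finite (mult_chars F)"
  by (rule card_ge_0_finite) (use card_mult_chars two_le_card in simp)

text \<open>A character of \<open>F\<close> is determined by its value \<open>z\<close> at a generator, which can be any root of
  unity of order dividing \<open>card F - 1\<close>; the restriction to \<open>K\<close> prescribes \<open>z ^ m\<close>, where \<open>m\<close> is the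
  index of the unit groups.\<close>

lemma card_mult_chars_extending:
  assumes K: "subfield K" "K \<subseteq> F" and m: "card F - 1 = m * (card K - 1)"
    and \<nu>: "\<nu> \<in> mult_chars K"
  shows "card {\<psi> \<in> mult_chars F. \<forall>x\<in>K - {0}. \<psi> x = \<nu> x} = m"
proof -
  interpret K: subfield K by (rule K(1))
  obtain g where gen: "generator g" using ex_generator ..
  then have g: "g \<in> F - {0}" by (simp add: generator_def)
  define n where "n = card F - 1"
  have n: "0 < n" using two_le_card by (simp add: n_def)
  have K1: "0 < card K - 1" using K.two_le_card by simp
  have m0: "0 < m" using m n by (cases m) (auto simp: n_def)
  have gF: "g ^ i \<in> F - {0}" for i using g by auto
  \<comment> \<open>The units of \<open>K\<close> are the solutions of x^(card K - 1) = 1, hence the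
    powers of \<open>g ^ m\<close>.\<close>
  have gK: "g ^ i \<in> K \<longleftrightarrow> m dvd i" for i
  proof -
    have "g ^ i \<in> K \<longleftrightarrow> (g ^ i) ^ card K = g ^ i" by (rule K.mem_iff)
    also have "\<dots> \<longleftrightarrow> (g ^ i) ^ (card K - 1) = 1"
      using K1 gF[of i] power_Suc[of "g ^ i" "card K - 1"] by auto
    also have "\<dots> \<longleftrightarrow> g ^ (i * (card K - 1)) = g ^ 0" by (simp add: power_mult)
    also have "\<dots> \<longleftrightarrow> n dvd i * (card K - 1)"
      unfolding generator_power_eq_iff[OF gen] by (auto simp: dvd_eq_mod_eq_0 n_def)
    also have "\<dots> \<longleftrightarrow> m dvd i" unfolding n_def m using K1 by simp
    finally show ?thesis .
  qed
  have gm: "g ^ m \<in> K - {0}" using gK[of m] g by auto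
  define c where "c = \<nu> (g ^ m)"
  have c: "c \<noteq> 0" using mult_char_nonzero[OF \<nu> gm] by (simp add: c_def)
  have cK: "c ^ (card K - 1) = 1"
    using K.mult_char_power[OF \<nu> gm, of "card K - 1"] K.power_card_units[OF gm] K.mult_char_1[OF \<nu>]
    by (simp add: c_def)
  have iff: "(\<forall>x\<in>K - {0}. \<psi> x = \<nu> x) \<longleftrightarrow> \<psi> g ^ m = c" if \<psi>: "\<psi> \<in> mult_chars F" for \<psi>
  proof
    assume "\<forall>x\<in>K - {0}. \<psi> x = \<nu> x"
    then show "\<psi> g ^ m = c" using gm mult_char_power[OF \<psi> g, of m] by (simp add: c_def)
  next
    assume eq: "\<psi> g ^ m = c"
    show "\<forall>x\<in>K - {0}. \<psi> x = \<nu> x"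
    proof
      fix x assume x: "x \<in> K - {0}"
      then obtain i :: nat where i: "x = g ^ i" using gen K(2) by (auto simp: generator_def)
      then obtain l where l: "i = m * l" using gK[of i] x by auto
      show "\<psi> x = \<nu> x"
        using K.mult_char_power[OF \<nu> gm, of l] mult_char_power[OF \<psi> g, of i] eq
        by (simp add: i l c_def power_mult)
    qed
  qed
  have "bij_betw (\<lambda>\<psi>. \<psi> g) {\<psi> \<in> mult_chars F. \<forall>x\<in>K - {0}. \<psi> x = \<nu> x} {z. z ^ m = c}"
    unfolding bij_betw_def
  proof
    note b = mult_chars_bij[OF gen, unfolded bij_betw_def]
    show "inj_on (\<lambda>\<psi>. \<psi> g) {\<psi> \<in> mult_chars F. \<forall>x\<in>K - {0}. \<psi> x = \<nu> x}"
      using b by (auto intro: inj_on_subset)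
    have "\<exists>\<psi>\<in>mult_chars F. z = \<psi> g" if "z ^ m = c" for z
    proof -
      have "z ^ (card F - 1) = 1" unfolding m power_mult that by (rule cK)
      then have "z \<in> (\<lambda>\<psi>. \<psi> g) ` mult_chars F" using b by simp
      then show ?thesis by blast
    qed
    then have "(\<lambda>\<psi>. \<psi> g) ` {\<psi> \<in> mult_chars F. \<psi> g ^ m = c} = {z. z ^ m = c}"
      by fast
    moreover have "{\<psi> \<in> mult_chars F. \<forall>x\<in>K - {0}. \<psi> x = \<nu> x} = {\<psi> \<in> mult_chars F. \<psi> g ^ m = c}"
      by (rule Collect_cong) (use iff in blast)
    ultimately show "(\<lambda>\<psi>. \<psi> g) ` {\<psi> \<in> mult_chars F. \<forall>x\<in>K - {0}. \<psi> x = \<nu> x} = {z. z ^ m = c}"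
      by simp
  qed
  then have "card {\<psi> \<in> mult_chars F. \<forall>x\<in>K - {0}. \<psi> x = \<nu> x} = card {z. z ^ m = c}"
    by (rule bij_betw_same_card)
  also have "\<dots> = m" by (rule card_nth_roots[OF c m0])
  finally show ?thesis .
qed

end

subsection \<open>Quadratic extensions\<close>

lemma nontrivial_add_char_0:
  assumes "subfield F" "nontrivial_add_char F \<eta>"
  shows "\<eta> 0 = 1"
proof -
  interpret subfield F by fact
  have "\<eta> (0 + 0) = \<eta> 0 * \<eta> 0" "\<eta> 0 \<noteq> 0"
    using assms(2) closed(1) unfolding nontrivial_add_char_def by blast+
  then show ?thesis by simp
qed

context subfield
begin

context
  fixes \<eta> :: "'a \<Rightarrow> complex"
  assumes \<eta>: "nontrivial_add_char F \<eta>"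
begin

lemma add_char_add: "x \<in> F \<Longrightarrow> y \<in> F \<Longrightarrow> \<eta> (x + y) = \<eta> x * \<eta> y"
  using \<eta> by (simp add: nontrivial_add_char_def)

lemma add_char_0: "\<eta> 0 = 1"
  by (rule nontrivial_add_char_0[OF subfield_axioms \<eta>])

lemma sum_add_char: "(\<Sum>x\<in>F. \<eta> x) = 0"
proof -
  obtain a where a: "a \<in> F" "\<eta> a \<noteq> 1" using \<eta> by (auto simp: nontrivial_add_char_def)
  have "bij_betw (\<lambda>x. a + x) F F"
    by (rule bij_betwI[where g = "\<lambda>x. x - a"]) (use a in auto)
  from sum.reindex_bij_betw[OF this, of \<eta>]
  have "(\<Sum>x\<in>F. \<eta> x) = (\<Sum>x\<in>F. \<eta> (a + x))" by simp
  also have "\<dots> = \<eta> a * (\<Sum>x\<in>F. \<eta> x)"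
    unfolding sum_distrib_left by (rule sum.cong) (use a in \<open>auto simp: add_char_add\<close>)
  finally have "(1 - \<eta> a) * (\<Sum>x\<in>F. \<eta> x) = 0" by (simp add: algebra_simps)
  then show ?thesis using a by (metis mult_eq_0_iff right_minus_eq)
qed

lemma sum_add_char_mult:
  assumes "b \<in> F - {0}"
  shows "(\<Sum>x\<in>F. \<eta> (b * x)) = 0"
  using sum.reindex_bij_betw[OF bij_mult[OF assms], of \<eta>] sum_add_char by simp

lemma sum_add_char_mult_units:
  assumes "b \<in> F - {0}"
  shows "(\<Sum>x\<in>F - {0}. \<eta> (b * x)) = - 1"
  using sum_add_char_mult[OF assms] by (simp add: sum_diff1 add_char_0)

end

end

locale quadratic_extension = F: subfield F + L: subfield L
  for F L :: "'a::{field,finite} set" +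
  assumes F_subset_L: "F \<subseteq> L" and card_L: "card L = (card F)\<^sup>2"
    and card_F_power: "\<exists>n. card F = CHAR('a) ^ n"
begin

lemma FL [simp, intro]: "x \<in> F \<Longrightarrow> x \<in> L"
  using F_subset_L by blast

abbreviation cj :: "'a \<Rightarrow> 'a" where "cj \<equiv> conj_over F"

lemma prime_CHAR: "prime CHAR('a)"
  by (rule prime_CHAR_semidom) (simp add: finite_imp_CHAR_pos)

lemma cj_add: "cj (x + y) = cj x + cj y"
  using card_F_power freshmans_dream'[OF prime_CHAR] by (auto simp: conj_over_def)

lemma cj_mult: "cj (x * y) = cj x * cj y"
  by (simp add: conj_over_def power_mult_distrib)

lemma cj_0 [simp]: "cj 0 = 0"
  using F.two_le_card by (simp add: conj_over_def)

lemma cj_1 [simp]: "cj 1 = 1"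
  by (simp add: conj_over_def)

lemma cj_minus: "cj (- x) = - cj x"
  using cj_add[of x "- x"] by (simp add: eq_neg_iff_add_eq_0 add.commute)

lemma cj_diff: "cj (x - y) = cj x - cj y"
  using cj_add[of x "- y"] by (simp add: cj_minus)

lemma cj_inverse: "cj (inverse x) = inverse (cj x)"
  by (simp add: conj_over_def power_inverse)

lemma cj_divide: "cj (x / y) = cj x / cj y"
  by (simp add: conj_over_def power_divide)

lemma cj_eq_0_iff [simp]: "cj x = 0 \<longleftrightarrow> x = 0"
  using F.two_le_card by (simp add: conj_over_def)

lemma cj_fixed_iff: "cj x = x \<longleftrightarrow> x \<in> F"
  by (simp add: conj_over_def F.mem_iff)

lemma cj_F [simp]: "x \<in> F \<Longrightarrow> cj x = x"
  by (simp add: cj_fixed_iff)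

lemma cj_L [simp, intro]: "x \<in> L \<Longrightarrow> cj x \<in> L"
  by (simp add: conj_over_def)

lemma cj_cj [simp]: "x \<in> L \<Longrightarrow> cj (cj x) = x"
  using L.power_card[of x] by (simp add: conj_over_def card_L power2_eq_square flip: power_mult)

definition Nm :: "'a \<Rightarrow> 'a" where "Nm w = w * cj w"
definition Tr :: "'a \<Rightarrow> 'a" where "Tr w = w + cj w"

lemma Nm_F [simp, intro]: "w \<in> L \<Longrightarrow> Nm w \<in> F"
  unfolding cj_fixed_iff[symmetric] by (simp add: Nm_def cj_mult mult.commute)

lemma Tr_F [simp, intro]: "w \<in> L \<Longrightarrow> Tr w \<in> F"
  unfolding cj_fixed_iff[symmetric] by (simp add: Tr_def cj_add add.commute)

lemma Nm_mult: "Nm (v * w) = Nm v * Nm w"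
  by (simp add: Nm_def cj_mult)

lemma Nm_divide: "Nm (v / w) = Nm v / Nm w"
  by (simp add: Nm_def cj_divide)

lemma Nm_inverse: "Nm (inverse w) = inverse (Nm w)"
  by (simp add: Nm_def cj_inverse)

lemma Nm_1 [simp]: "Nm 1 = 1"
  by (simp add: Nm_def)

lemma Nm_0 [simp]: "Nm 0 = 0"
  by (simp add: Nm_def)

lemma Nm_eq_0_iff [simp]: "Nm w = 0 \<longleftrightarrow> w = 0"
  by (simp add: Nm_def)

lemma Nm_of_F: "a \<in> F \<Longrightarrow> Nm a = a\<^sup>2"
  by (simp add: Nm_def power2_eq_square)

lemma Nm_cj: "w \<in> L \<Longrightarrow> Nm (cj w) = Nm w"
  by (simp add: Nm_def mult.commute)

lemma Tr_cj: "w \<in> L \<Longrightarrow> Tr (cj w) = Tr w"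
  by (simp add: Tr_def add.commute)

lemma Tr_add: "Tr (v + w) = Tr v + Tr w"
  by (simp add: Tr_def cj_add algebra_simps)

lemma Tr_minus: "Tr (- v) = - Tr v"
  by (simp add: Tr_def cj_minus)

lemma Tr_mult_F: "a \<in> F \<Longrightarrow> Tr (a * v) = a * Tr v"
  by (simp add: Tr_def cj_mult algebra_simps)

lemma card_L_eq: "card L = card F * card F"
  by (simp add: card_L power2_eq_square)

lemma card_L_units: "card (L - {0}) = (card F + 1) * card (F - {0})"
proof -
  obtain k where "card F = Suc k" using F.two_le_card by (cases "card F") auto
  then show ?thesis by (simp add: L.card_units F.card_units card_L_eq)
qed

lemma Nm_power: "Nm w = w ^ (card F + 1)"
  by (simp add: Nm_def conj_over_def)

text \<open>The norm is the power with exponent \<open>card F + 1\<close>, which bounds its fibres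
  by that number; by \<open>card_L_units\<close> this is also their average size.\<close>

lemma card_Nm_fibre:
  assumes "x \<in> F - {0}"
  shows "card {w \<in> L - {0}. Nm w = x} = card F + 1"
proof (rule card_fibre_eq[OF _ _ _ _ card_L_units assms])
  show "card {w \<in> L - {0}. Nm w = b} \<le> card F + 1" for b
  proof -
    have "card {w \<in> L - {0}. Nm w = b} \<le> card {w. w ^ (card F + 1) = b}"
      by (rule card_mono) (auto simp: Nm_power)
    also have "\<dots> \<le> card F + 1" by (rule card_roots_power) simp
    finally show ?thesis .
  qed
qed auto

lemma card_Tr_fibre:
  assumes "x \<in> F"
  shows "card {w \<in> L. Tr w = x} = card F"
proof (rule card_fibre_eq[OF _ _ _ _ card_L_eq assms])
  show "card {w \<in> L. Tr w = b} \<le> card F" for b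
  proof -
    have "card {w \<in> L. Tr w = b} \<le> card {w. w ^ card F + 1 * w = b}"
      by (rule card_mono) (auto simp: Tr_def conj_over_def add.commute)
    also have "\<dots> \<le> card F" by (rule card_roots_power_plus) (use F.two_le_card in simp)
    finally show ?thesis .
  qed
qed auto

text \<open>Norm and trace are the coefficients of the quadratic polynomial with roots
  \<open>z\<close> and \<open>cj z\<close>, and \<open>v\<close> is a root of the polynomial formed
  from its own norm and trace.\<close>

lemma same_Nm_Tr_iff: "Nm v = Nm z \<and> Tr v = Tr z \<longleftrightarrow> v = z \<or> v = cj z" if "z \<in> L"
proof
  assume "Nm v = Nm z \<and> Tr v = Tr z"
  then have *: "Nm v = z * cj z" "Tr v = z + cj z" by (auto simp: Nm_def Tr_def)
  have "(v - z) * (v - cj z) = v * v - v * (z + cj z) + z * cj z" by (simp add: algebra_simps)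
  also have "\<dots> = v * v - v * Tr v + Nm v" using * by simp
  also have "\<dots> = 0" by (simp add: Nm_def Tr_def algebra_simps)
  finally show "v = z \<or> v = cj z" by simp
qed (use that in \<open>auto simp: Nm_cj Tr_cj\<close>)

text \<open>The witness is w = 1 + 1/u, for which \<open>cj w\<close> is 1 + u. It degenerates at u
  = -1, where any nonzero element of trace zero serves.\<close>

lemma hilbert_90:
  assumes "u \<in> L" "Nm u = 1"
  obtains w where "w \<in> L - {0}" "u = cj w / w"
proof (cases "u = - 1")
  case True
  have "card {w \<in> L. Tr w = 0} = card F" by (rule card_Tr_fibre) simp
  then have "\<not> {w \<in> L. Tr w = 0} \<subseteq> {0}"
    using F.two_le_card card_mono[of "{0}" "{w \<in> L. Tr w = 0}"] by auto
  then obtain w where w: "w \<in> L" "Tr w = 0" "w \<noteq> 0" by blast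
  then have "cj w = - w" by (simp add: Tr_def eq_neg_iff_add_eq_0 add.commute)
  then show ?thesis using that[of w] w True by simp
next
  case False
  have u0: "u \<noteq> 0" using assms by auto
  have "cj u = inverse u" using assms(2) u0 by (simp add: Nm_def field_simps)
  moreover have "1 + inverse u \<noteq> 0"
    using False u0 by (auto simp: field_simps eq_neg_iff_add_eq_0 add.commute)
  moreover have "u = (1 + u) / (1 + inverse u)"
    using False u0 by (auto simp: field_simps eq_neg_iff_add_eq_0 add.commute)
  ultimately show ?thesis
    using that[of "1 + inverse u"] assms(1) by (simp add: cj_add cj_inverse)
qed

subsection \<open>Indecomposable characters\<close>

text \<open>A character that is trivial on the kernel of the norm factors through the norm, which
  maps onto the units of \<open>F\<close>; the factor is \<psi> below. Later arguments exploit
  indecomposability through the element \<open>u\<close> found here.\<close>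

lemma indecomposable_Nm_1:
  assumes \<nu>: "\<nu> \<in> mult_chars L" and ind: "indecomposable F L \<nu>"
  obtains u where "u \<in> L - {0}" "Nm u = 1" "\<nu> u \<noteq> 1"
proof (rule ccontr)
  assume "\<not> thesis"
  then have triv: "\<nu> u = 1" if "u \<in> L - {0}" "Nm u = 1" for u
    using that \<open>\<And>u. u \<in> L - {0} \<Longrightarrow> Nm u = 1 \<Longrightarrow> \<nu> u \<noteq> 1 \<Longrightarrow> thesis\<close> by blast
  define s where "s x = (SOME w. w \<in> L - {0} \<and> Nm w = x)" for x
  have s: "s x \<in> L - {0}" "Nm (s x) = x" if "x \<in> F - {0}" for x
  proof -
    have "0 < card {w \<in> L - {0}. Nm w = x}" unfolding card_Nm_fibre[OF that] by simp
    then have "\<exists>w. w \<in> L - {0} \<and> Nm w = x" by (auto simp: card_gt_0_iff)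
    from someI_ex[OF this] show "s x \<in> L - {0}" "Nm (s x) = x" by (auto simp: s_def)
  qed
  have eq: "\<nu> v = \<nu> w" if "v \<in> L - {0}" "w \<in> L - {0}" "Nm v = Nm w" for v w
  proof -
    have "\<nu> (v / w) = 1" by (rule triv) (use that in \<open>auto simp: Nm_divide\<close>)
    then show ?thesis using L.mult_char_divide[OF \<nu> that(1,2)] mult_char_nonzero[OF \<nu> that(2)] by simp
  qed
  define \<psi> where "\<psi> x = (if x \<in> F - {0} then \<nu> (s x) else 0)" for x
  have "\<psi> \<in> mult_chars F"
    unfolding mult_chars_def
  proof (intro CollectI conjI ballI allI impI)
    show "\<psi> x \<noteq> 0" if "x \<in> F - {0}" for x
      using that s[OF that] mult_char_nonzero[OF \<nu>] by (auto simp: \<psi>_def)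
    show "\<psi> (x * y) = \<psi> x * \<psi> y" if "x \<in> F - {0}" "y \<in> F - {0}" for x y
    proof -
      have xy: "x * y \<in> F - {0}" using that by auto
      have "\<nu> (s (x * y)) = \<nu> (s x * s y)"
        by (rule eq) (use s[OF that(1)] s[OF that(2)] s[OF xy] in \<open>auto simp: Nm_mult\<close>)
      then show ?thesis using that xy s mult_char_mult[OF \<nu>] by (simp add: \<psi>_def)
    qed
  qed (auto simp: \<psi>_def)
  moreover have "\<nu> w = \<psi> (w * cj w)" if "w \<in> L - {0}" for w
  proof -
    have "Nm w \<in> F - {0}" using that by auto
    then have "\<psi> (Nm w) = \<nu> (s (Nm w))" "s (Nm w) \<in> L - {0}" "Nm (s (Nm w)) = Nm w"
      using s by (simp_all add: \<psi>_def)
    then show ?thesis using eq[of w "s (Nm w)"] that by (simp add: Nm_def)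
  qed
  ultimately show False using ind unfolding indecomposable_def by blast
qed

lemma conj_char_mem: "\<nu> \<in> mult_chars L \<Longrightarrow> conj_char F \<nu> \<in> mult_chars L"
  unfolding mult_chars_def conj_char_def
proof (intro CollectI conjI ballI allI impI)
  assume \<nu>: "\<nu> \<in> {\<psi>. (\<forall>x\<in>L - {0}. \<psi> x \<noteq> 0) \<and>
    (\<forall>x\<in>L - {0}. \<forall>y\<in>L - {0}. \<psi> (x * y) = \<psi> x * \<psi> y) \<and> (\<forall>x. x \<notin> L - {0} \<longrightarrow> \<psi> x = 0)}"
  show "\<nu> (cj x) \<noteq> 0" if "x \<in> L - {0}" for x using \<nu> that by auto
  show "\<nu> (cj (x * y)) = \<nu> (cj x) * \<nu> (cj y)" if "x \<in> L - {0}" "y \<in> L - {0}" for x y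
    using \<nu> that by (auto simp: cj_mult)
  show "\<nu> (cj x) = 0" if x: "x \<notin> L - {0}" for x
  proof -
    have "cj x \<notin> L - {0}"
    proof
      assume a: "cj x \<in> L - {0}"
      obtain n where "card F * card F = CHAR('a) ^ n"
        using card_F_power by (auto simp flip: power_add)
      \<comment> \<open>Here \<open>x\<close> is an arbitrary element of the ambient field, so
        \<open>cj_cj\<close> does not apply; injectivity of a power of Frobenius gives the same
        equation.\<close>
      then have "(cj (cj x) - x) ^ (card F * card F) = cj (cj x) ^ (card F * card F) - x ^ (card F * card F)"
        using freshmans_dream'[OF prime_CHAR, of "card F * card F" n "cj (cj x) - x" x] by simp
      also have "x ^ (card F * card F) = cj (cj x)"
        by (simp add: conj_over_def power_mult)
      also have "cj (cj x) ^ (card F * card F) = cj (cj x)"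
        using a L.power_card[of "cj (cj x)"] by (simp add: card_L_eq)
      finally have "cj (cj x) = x" using F.two_le_card by simp
      then have "x \<in> L" using a by (metis Diff_iff cj_L)
      then show False using x a by auto
    qed
    then show ?thesis using \<nu> by blast
  qed
qed

lemma conj_char_conj_char: "\<nu> \<in> mult_chars L \<Longrightarrow> conj_char F (conj_char F \<nu>) = \<nu>"
  by (rule mult_char_eqI[of _ L]) (use conj_char_mem in blast, auto simp: conj_char_def)

text \<open>By Hilbert 90 a character invariant under conjugation is trivial on every element of
  norm 1.\<close>

lemma conj_char_neq:
  assumes \<nu>: "\<nu> \<in> mult_chars L" and ind: "indecomposable F L \<nu>"
  shows "conj_char F \<nu> \<noteq> \<nu>"
proof
  assume eq: "conj_char F \<nu> = \<nu>"
  obtain u where u: "u \<in> L - {0}" "Nm u = 1" "\<nu> u \<noteq> 1"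
    by (rule indecomposable_Nm_1[OF \<nu> ind])
  obtain w where w: "w \<in> L - {0}" "u = cj w / w"
    using hilbert_90[of u] u by auto
  have "\<nu> u = \<nu> (cj w) / \<nu> w"
    unfolding w(2) by (rule L.mult_char_divide[OF \<nu>]) (use w in auto)
  also have "\<nu> (cj w) = \<nu> w" using eq by (metis conj_char_def)
  finally show False using u(3) mult_char_nonzero[OF \<nu> w(1)] by simp
qed

text \<open>Multiplication by an element of norm 1 at which \<nu> is not 1 permutes the fibre. This
  vanishing removes the boundary terms from the exponential sums, both for products of kernels and
  for traces.\<close>

lemma sum_norm_fibre:
  assumes \<nu>: "\<nu> \<in> mult_chars L" and ind: "indecomposable F L \<nu>"
  shows "(\<Sum>v\<in>{v \<in> L - {0}. Nm v = d}. \<nu> v) = 0"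
proof -
  obtain u where u: "u \<in> L - {0}" "Nm u = 1" "\<nu> u \<noteq> 1"
    by (rule indecomposable_Nm_1[OF \<nu> ind])
  let ?A = "{v \<in> L - {0}. Nm v = d}"
  have "bij_betw (\<lambda>v. u * v) ?A ?A"
    by (rule bij_betwI[where g = "\<lambda>v. inverse u * v"]) (use u in \<open>auto simp: Nm_mult Nm_inverse\<close>)
  from sum.reindex_bij_betw[OF this, of \<nu>]
  have "(\<Sum>v\<in>?A. \<nu> v) = (\<Sum>v\<in>?A. \<nu> (u * v))" by simp
  also have "\<dots> = \<nu> u * (\<Sum>v\<in>?A. \<nu> v)"
    unfolding sum_distrib_left by (rule sum.cong) (use u \<nu> in \<open>auto simp: mult_char_mult\<close>)
  finally have "(1 - \<nu> u) * (\<Sum>v\<in>?A. \<nu> v) = 0" by (simp add: algebra_simps)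
  then show ?thesis using u(3) by (metis mult_eq_0_iff right_minus_eq)
qed

subsection \<open>Gauss sums of the norm form\<close>

context
  fixes \<eta> :: "'a \<Rightarrow> complex"
  assumes \<eta>: "nontrivial_add_char F \<eta>"
begin

lemma sum_add_char_Tr:
  assumes "c \<in> L"
  shows "(\<Sum>u\<in>L. \<eta> (- Tr (u * c))) = (if c = 0 then of_nat (card F) ^ 2 else 0)"
proof (cases "c = 0")
  case True
  then show ?thesis by (simp add: Tr_def F.add_char_0[OF \<eta>] card_L)
next
  case False
  then have c: "- c \<in> L - {0}" using assms by auto
  have "(\<Sum>u\<in>L. \<eta> (- Tr (u * c))) = (\<Sum>u\<in>L. \<eta> (Tr (- c * u)))"
    by (simp add: Tr_minus mult.commute)
  also have "\<dots> = (\<Sum>u\<in>L. \<eta> (Tr u))"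
    by (rule sum.reindex_bij_betw[OF L.bij_mult[OF c]])
  also have "\<dots> = (\<Sum>t\<in>F. \<Sum>u\<in>{u \<in> L. Tr u = t}. \<eta> (Tr u))"
    by (rule sum.group[symmetric]) auto
  also have "\<dots> = (\<Sum>t\<in>F. of_nat (card F) * \<eta> t)"
    by (rule sum.cong) (simp_all add: card_Tr_fibre)
  also have "\<dots> = 0" by (simp add: F.sum_add_char[OF \<eta>] flip: sum_distrib_left)
  finally show ?thesis using False by simp
qed

text \<open>The fibres over nonzero values have \<open>card F + 1\<close> points each and contribute
  -(card F + 1) in total; the point 0 adds 1.\<close>

lemma sum_add_char_Nm:
  assumes "b \<in> F - {0}"
  shows "(\<Sum>u\<in>L. \<eta> (b * Nm u)) = - of_nat (card F)"
proof -
  have "(\<Sum>u\<in>L - {0}. \<eta> (b * Nm u)) = (\<Sum>t\<in>F - {0}. \<Sum>u\<in>{u \<in> L - {0}. Nm u = t}. \<eta> (b * Nm u))"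
    by (rule sum.group[symmetric]) auto
  also have "\<dots> = (\<Sum>t\<in>F - {0}. of_nat (card F + 1) * \<eta> (b * t))"
  proof (rule sum.cong)
    fix t assume t: "t \<in> F - {0}"
    have "(\<Sum>u\<in>{u \<in> L - {0}. Nm u = t}. \<eta> (b * Nm u)) = (\<Sum>u\<in>{u \<in> L - {0}. Nm u = t}. \<eta> (b * t))"
      by (rule sum.cong) auto
    also have "\<dots> = of_nat (card F + 1) * \<eta> (b * t)"
      using card_Nm_fibre[OF t] by (simp only: sum_constant)
    finally show "(\<Sum>u\<in>{u \<in> L - {0}. Nm u = t}. \<eta> (b * Nm u)) = of_nat (card F + 1) * \<eta> (b * t)" .
  qed simp
  also have "\<dots> = - of_nat (card F + 1)"
    by (simp add: F.sum_add_char_mult_units[OF \<eta> assms] flip: sum_distrib_left)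
  finally have "(\<Sum>u\<in>L - {0}. \<eta> (b * Nm u)) = - of_nat (card F + 1)" .
  then show ?thesis by (simp add: sum_diff1 F.add_char_0[OF \<eta>] eq_neg_iff_add_eq_0 add.commute)
qed

lemma sum_add_char_quadratic:
  assumes A: "A \<in> F" and B: "B \<in> F" and c: "c \<in> L"
  shows "(\<Sum>u\<in>L. \<eta> (A + B * Nm u - Tr (u * c))) =
    (if B \<noteq> 0 then - of_nat (card F) * \<eta> (A - Nm c / B)
     else if c = 0 then of_nat (card F) ^ 2 * \<eta> A else 0)"
proof (cases "B = 0")
  case True
  have "(\<Sum>u\<in>L. \<eta> (A + B * Nm u - Tr (u * c))) = (\<Sum>u\<in>L. \<eta> A * \<eta> (- Tr (u * c)))"
  proof (rule sum.cong)
    fix u assume "u \<in> L"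
    then show "\<eta> (A + B * Nm u - Tr (u * c)) = \<eta> A * \<eta> (- Tr (u * c))"
      using F.add_char_add[OF \<eta> A, of "- Tr (u * c)"] True c by simp
  qed simp
  then show ?thesis
    using True by (simp add: sum_add_char_Tr[OF c] flip: sum_distrib_left)
next
  case False
  have cB: "cj c / B \<in> L" using c B by auto
  \<comment> \<open>The shift that completes the square: B Nm (u + cj c / B) = B Nm u + Tr (u c) +
    Nm c / B.\<close>
  have b: "bij_betw (\<lambda>u. u + cj c / B) L L"
    by (rule bij_betwI[where g = "\<lambda>u. u - cj c / B"]) (use cB in auto)
  have "(\<Sum>u\<in>L. \<eta> (A + B * Nm u - Tr (u * c))) =
      (\<Sum>u\<in>L. \<eta> (A + B * Nm (u + cj c / B) - Tr ((u + cj c / B) * c)))"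
    by (rule sum.reindex_bij_betw[OF b, symmetric])
  also have "\<dots> = (\<Sum>u\<in>L. \<eta> (A - Nm c / B) * \<eta> (B * Nm u))"
  proof (rule sum.cong)
    fix u assume u: "u \<in> L"
    have "B * Nm (u + cj c / B) - Tr ((u + cj c / B) * c) = B * Nm u - Nm c / B"
    proof -
      have e: "cj (u + cj c / B) = cj u + c / B"
        using B c by (simp add: cj_add cj_divide)
      have "B * Nm (u + cj c / B) = B * Nm u + (u * c + cj u * cj c) + Nm c / B"
        unfolding Nm_def e using False by (simp add: distrib_left distrib_right add_ac mult_ac)
      moreover have "Tr ((u + cj c / B) * c) = (u * c + cj u * cj c) + (Nm c / B + Nm c / B)"
        unfolding Nm_def Tr_def cj_mult e by (simp add: ring_distribs add_ac mult_ac)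
      moreover have "s + t + n - (t + (n + n)) = s - n" for s t n :: 'a
        by simp
      ultimately show ?thesis by (simp only:)
    qed
    then have e: "A + B * Nm (u + cj c / B) - Tr ((u + cj c / B) * c) = (A - Nm c / B) + B * Nm u"
      by (metis add_diff_eq diff_add_eq)
    show "\<eta> (A + B * Nm (u + cj c / B) - Tr ((u + cj c / B) * c)) = \<eta> (A - Nm c / B) * \<eta> (B * Nm u)"
      unfolding e by (rule F.add_char_add[OF \<eta>]) (use A B c u in auto)
  qed simp
  also have "\<dots> = - of_nat (card F) * \<eta> (A - Nm c / B)"
    using False B by (simp add: sum_add_char_Nm flip: sum_distrib_left)
  finally show ?thesis using False by simp
qed

end

end

section \<open>Cuspidal representations\<close>

locale cuspidal = quadratic_extension F L
  for F L :: "'a::{field,finite} set" +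
  fixes \<eta> \<nu> :: "'a \<Rightarrow> complex"
  assumes add_char: "nontrivial_add_char F \<eta>" and mult_char: "\<nu> \<in> mult_chars L"
    and indec: "indecomposable F L \<nu>"
begin

text \<open>The kernel of the action on functions on the units of \<open>F\<close>. In the case \<open>\<gamma> \<noteq> 0\<close> it is the
  one of the definition after the substitution \<open>v = - \<gamma> x w\<close> in \<^const>\<open>cusp_j\<close>.\<close>

definition ker :: "'a \<Rightarrow> 'a \<Rightarrow> 'a \<Rightarrow> 'a \<Rightarrow> 'a \<Rightarrow> 'a \<Rightarrow> complex"
  where "ker \<alpha> \<beta> \<gamma> \<delta> y x =
    (if \<gamma> = 0 then if x = \<delta> / \<alpha> * y then \<nu> \<delta> * \<eta> (\<beta> / (\<delta> * y)) else 0
     else - (1 / of_nat (card F)) *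
       (\<Sum>v\<in>{v \<in> L - {0}. Nm v = x / y * (\<alpha> * \<delta> - \<beta> * \<gamma>)}.
          \<nu> v * \<eta> ((\<alpha> * x / y + \<delta> - Tr v) / (\<gamma> * x))))"

text \<open>After this rescaling the fibre is cut out by \<open>x / y\<close> and the determinant
  alone. Both are multiplicative along a product of kernels, so the fibre of the product consists of
  products of elements of the two fibres.\<close>

lemma cusp_j_sum:
  assumes "\<gamma> \<in> F - {0}" "x \<in> F - {0}" "y \<in> F - {0}" "\<alpha> \<in> F" "\<delta> \<in> F"
  shows "\<nu> (- \<gamma> * x) * \<eta> (\<alpha> * inverse \<gamma> * inverse y + inverse \<gamma> * \<delta> * inverse x) *
      cusp_j F L \<eta> \<nu> (inverse (\<gamma>\<^sup>2) * inverse y * inverse x * d) =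
    1 / of_nat (card F) * (\<Sum>v\<in>{v \<in> L - {0}. Nm v = x / y * d}.
          \<nu> v * \<eta> ((\<alpha> * x / y + \<delta> - Tr v) / (\<gamma> * x)))"
proof -
  let ?A = "{w \<in> L - {0}. Nm w = inverse (\<gamma>\<^sup>2) * inverse y * inverse x * d}"
  let ?e = "\<alpha> * inverse \<gamma> * inverse y + inverse \<gamma> * \<delta> * inverse x"
  define k where "k = - \<gamma> * x"
  have k: "k \<in> F - {0}" and kL: "k \<in> L - {0}" using assms by (auto simp: k_def)
  have k2: "Nm k = \<gamma>\<^sup>2 * x\<^sup>2" using k by (simp add: Nm_of_F k_def power_mult_distrib)
  have "bij_betw (\<lambda>w. k * w) ?A {v \<in> L - {0}. Nm v = x / y * d}"
    by (rule bij_betwI[where g = "\<lambda>v. inverse k * v"])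
       (use kL assms in \<open>auto simp: Nm_mult Nm_inverse Nm_divide k2 power2_eq_square field_simps\<close>)
  from sum.reindex_bij_betw[OF this, of "\<lambda>v. \<nu> v * \<eta> ((\<alpha> * x / y + \<delta> - Tr v) / (\<gamma> * x))", symmetric]
  have "(\<Sum>v\<in>{v \<in> L - {0}. Nm v = x / y * d}. \<nu> v * \<eta> ((\<alpha> * x / y + \<delta> - Tr v) / (\<gamma> * x))) =
    (\<Sum>w\<in>?A. \<nu> (k * w) * \<eta> ((\<alpha> * x / y + \<delta> - Tr (k * w)) / (\<gamma> * x)))" .
  also have "\<dots> = (\<Sum>w\<in>?A. \<nu> k * \<eta> ?e * (\<eta> (Tr w) * \<nu> w))"
  proof (rule sum.cong)
    fix w assume w: "w \<in> ?A"
    have "Tr (k * w) = k * Tr w" using k by (simp add: Tr_mult_F)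
    then have "(\<alpha> * x / y + \<delta> - Tr (k * w)) / (\<gamma> * x) = ?e + Tr w"
      using assms by (simp add: k_def field_simps)
    moreover have "\<eta> (?e + Tr w) = \<eta> ?e * \<eta> (Tr w)"
      by (rule F.add_char_add[OF add_char]) (use w assms in auto)
    moreover have "\<nu> (k * w) = \<nu> k * \<nu> w"
      by (rule mult_char_mult[OF mult_char kL]) (use w in auto)
    ultimately show "\<nu> (k * w) * \<eta> ((\<alpha> * x / y + \<delta> - Tr (k * w)) / (\<gamma> * x)) =
        \<nu> k * \<eta> ?e * (\<eta> (Tr w) * \<nu> w)" by simp
  qed simp
  finally show ?thesis
    unfolding cusp_j_def Nm_def[symmetric] Tr_def[symmetric] k_def
    by (simp only: sum_distrib_left mult_ac)
qed

section \<open>The action as an operator with kernel, and the products of kernels\<close>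

abbreviation "\<rho> \<equiv> cuspidal_rep F L \<eta> \<nu>"

lemma rho_space: "rep_space \<rho> = {f. \<forall>y. y \<notin> F - {0} \<longrightarrow> f y = 0}"
  by (simp add: cuspidal_rep_def)

lemma GL2_carrier: "A \<in> carrier (GL2 F) \<longleftrightarrow>
    A $ 1 $ 1 \<in> F \<and> A $ 1 $ 2 \<in> F \<and> A $ 2 $ 1 \<in> F \<and> A $ 2 $ 2 \<in> F \<and>
    A $ 1 $ 1 * A $ 2 $ 2 - A $ 1 $ 2 * A $ 2 $ 1 \<noteq> 0"
  by (auto simp: GL2_def det_2 forall_2)

lemma rho_act:
  assumes A: "A \<in> carrier (GL2 F)"
  shows "rep_act \<rho> A f y = (if y \<in> F - {0} then
    \<Sum>x\<in>F - {0}. ker (A $ 1 $ 1) (A $ 1 $ 2) (A $ 2 $ 1) (A $ 2 $ 2) y x * f x else 0)"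
proof (cases "y \<in> F - {0}")
  case y: True
  note A' = A[unfolded GL2_carrier]
  show ?thesis
  proof (cases "A $ 2 $ 1 = 0")
    case True
    let ?x = "A $ 2 $ 2 / A $ 1 $ 1 * y"
    have x: "?x \<in> F - {0}" using A' True y by auto
    have "(\<Sum>x\<in>F - {0}. ker (A $ 1 $ 1) (A $ 1 $ 2) (A $ 2 $ 1) (A $ 2 $ 2) y x * f x) =
        (\<Sum>x\<in>F - {0}. if x = ?x then \<nu> (A $ 2 $ 2) * \<eta> (A $ 1 $ 2 / (A $ 2 $ 2 * y)) * f x else 0)"
      by (rule sum.cong) (use True in \<open>auto simp: ker_def\<close>)
    also have "\<dots> = \<nu> (A $ 2 $ 2) * \<eta> (A $ 1 $ 2 / (A $ 2 $ 2 * y)) * f ?x"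
      using x by simp
    finally show ?thesis
      using y True by (simp add: cuspidal_rep_def Let_def divide_inverse mult_ac)
  next
    case False
    have "rep_act \<rho> A f y = - (\<Sum>x\<in>F - {0}. \<nu> (- A $ 2 $ 1 * x) *
        \<eta> (A $ 1 $ 1 * inverse (A $ 2 $ 1) * inverse y + inverse (A $ 2 $ 1) * A $ 2 $ 2 * inverse x) *
        cusp_j F L \<eta> \<nu> (inverse ((A $ 2 $ 1)\<^sup>2) * inverse y * inverse x * det A) * f x)"
      using y False by (simp add: cuspidal_rep_def Let_def)
    also have "\<dots> = - (\<Sum>x\<in>F - {0}. - ker (A $ 1 $ 1) (A $ 1 $ 2) (A $ 2 $ 1) (A $ 2 $ 2) y x * f x)"
    proof (intro arg_cong[where f = uminus] sum.cong refl)
      fix x assume x: "x \<in> F - {0}"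
      have c: "A $ 2 $ 1 \<in> F - {0}" and aF: "A $ 1 $ 1 \<in> F" and dF: "A $ 2 $ 2 \<in> F" using A' False by auto
      show "\<nu> (- A $ 2 $ 1 * x) *
        \<eta> (A $ 1 $ 1 * inverse (A $ 2 $ 1) * inverse y + inverse (A $ 2 $ 1) * A $ 2 $ 2 * inverse x) *
        cusp_j F L \<eta> \<nu> (inverse ((A $ 2 $ 1)\<^sup>2) * inverse y * inverse x * det A) * f x =
        - ker (A $ 1 $ 1) (A $ 1 $ 2) (A $ 2 $ 1) (A $ 2 $ 2) y x * f x"
        unfolding cusp_j_sum[OF c x y aF dF] using False by (simp add: ker_def det_2)
    qed
    finally show ?thesis using y by (simp add: sum_negf)
  qed
qed (auto simp: cuspidal_rep_def)

text \<open>The exponent A - Nm c / B left by completing the square has to be the exponent in the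
  kernel of the product matrix. Here \<open>t\<close> stands for Tr v, the expression x / y (D1 D2)
  for Nm v, and \<open>g\<close> is the lower left entry of the product.\<close>

lemma exponent_identity:
  fixes x y :: 'a
  assumes nz: "g1 \<noteq> 0" "g2 \<noteq> 0" "x \<noteq> 0" "y \<noteq> 0" "D1 \<noteq> 0" "g \<noteq> 0"
    and g: "g = g1 * a2 + d1 * g2" and D1: "D1 = a1 * d1 - b1 * g1" and D2: "D2 = a2 * d2 - b2 * g2"
  shows "a1 / (g1 * y) + d2 / (g2 * x) -
      ((D1 / (g1 * y))\<^sup>2 + D1 / (g1 * y) * t / (g2 * x) + x / y * (D1 * D2) / (g2 * x)\<^sup>2) / (D1 * g / (g1 * g2 * y)) =
    ((a1 * a2 + b1 * g2) * x / y + (g1 * b2 + d1 * d2) - t) / (g * x)"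
proof -
  have "((D1 / (g1 * y))\<^sup>2 + D1 / (g1 * y) * t / (g2 * x) + x / y * (D1 * D2) / (g2 * x)\<^sup>2) / (D1 * g / (g1 * g2 * y))
      = (D1 * g2 / (g1 * y) + t / x + D2 * g1 / (g2 * x)) / g"
    using nz by (simp add: power2_eq_square field_simps)
  moreover have "a1 / (g1 * y) = (D1 * g2 + (a1 * a2 + b1 * g2) * g1) / (g1 * y * g)"
  proof -
    have "a1 * g = D1 * g2 + (a1 * a2 + b1 * g2) * g1" by (simp add: g D1 algebra_simps)
    then show ?thesis using nz by (metis nonzero_mult_divide_mult_cancel_right)
  qed
  moreover have "d2 / (g2 * x) = (D2 * g1 + (g1 * b2 + d1 * d2) * g2) / (g2 * x * g)"
  proof -
    have "d2 * g = D2 * g1 + (g1 * b2 + d1 * d2) * g2" by (simp add: g D2 algebra_simps)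
    then show ?thesis using nz by (metis nonzero_mult_divide_mult_cancel_right)
  qed
  moreover have "(D1 * g2 + P * g1) / (g1 * y * g) + (D2 * g1 + Q * g2) / (g2 * x * g) -
      (D1 * g2 / (g1 * y) + t / x + D2 * g1 / (g2 * x)) / g = (P * x / y + Q - t) / (g * x)" for P Q
    using nz by (simp add: add_divide_distrib diff_divide_distrib mult.commute)
  ultimately show ?thesis by (simp only:)
qed

text \<open>The composition of two kernels in the big cell: grouping the pairs \<open>(v\<^sub>1, v\<^sub>2)\<close> by their
  product \<open>v\<close> leaves a sum over \<open>u = 1 / v\<^sub>1\<close> of a quadratic exponential; completing the
  square evaluates it, and the missing term \<open>u = 0\<close> vanishes by the lemma \<open>sum_norm_fibre\<close>.\<close>

lemma ker_big_big:
  assumes F: "a1 \<in> F" "b1 \<in> F" "g1 \<in> F - {0}" "d1 \<in> F" "a2 \<in> F" "b2 \<in> F" "g2 \<in> F - {0}" "d2 \<in> F"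
    and D1_def: "D1 = a1 * d1 - b1 * g1" and D2_def: "D2 = a2 * d2 - b2 * g2"
    and D0: "D1 \<noteq> 0" "D2 \<noteq> 0" and x: "x \<in> F - {0}" and y: "y \<in> F - {0}"
    and g_def: "g = g1 * a2 + d1 * g2"
  shows "(\<Sum>z\<in>F - {0}. ker a1 b1 g1 d1 y z * ker a2 b2 g2 d2 z x) =
    (1 / of_nat (card F))\<^sup>2 * (\<Sum>v\<in>{v \<in> L - {0}. Nm v = x / y * (D1 * D2)}. \<nu> v *
      (\<Sum>u\<in>L. \<eta> (a1 / (g1 * y) + d2 / (g2 * x) + D1 * g / (g1 * g2 * y) * Nm u
        - Tr (u * (D1 / (g1 * y) + v / (g2 * x))))))"
proof -
  let ?V = "{v \<in> L - {0}. Nm v = x / y * (D1 * D2)}"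
  define A B where "A = a1 / (g1 * y) + d2 / (g2 * x)" and "B = D1 * g / (g1 * g2 * y)"
  define c where "c v = D1 / (g1 * y) + v / (g2 * x)" for v
  define S where "S z = {v \<in> L - {0}. Nm v = z / y * D1}" for z
  have D1F: "D1 \<in> F - {0}" and D2F: "D2 \<in> F - {0}" using F D0 by (auto simp: D1_def D2_def)
  have gF: "g \<in> F" using F by (auto simp: g_def)
  define e1 where "e1 z v = (a1 * z / y + d1 - Tr v) / (g1 * z)" for z v
  define e2 where "e2 z v = (a2 * x / z + d2 - Tr v) / (g2 * x)" for z v
  have inner: "ker a1 b1 g1 d1 y z * ker a2 b2 g2 d2 z x =
      (1 / of_nat (card F))\<^sup>2 * (\<Sum>v\<in>?V. \<nu> v * (\<Sum>w\<in>S z. \<eta> (A + B * Nm (inverse w) - Tr (inverse w * c v))))"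
    if z: "z \<in> F - {0}" for z
  proof -
    let ?S2 = "{v \<in> L - {0}. Nm v = x / z * D2}"
    have "ker a1 b1 g1 d1 y z * ker a2 b2 g2 d2 z x =
        (1 / of_nat (card F))\<^sup>2 * ((\<Sum>w\<in>S z. \<nu> w * \<eta> (e1 z w)) * (\<Sum>v\<in>?S2. \<nu> v * \<eta> (e2 z v)))"
      using F by (simp add: ker_def S_def e1_def e2_def D1_def D2_def power2_eq_square)
    also have "(\<Sum>w\<in>S z. \<nu> w * \<eta> (e1 z w)) * (\<Sum>v\<in>?S2. \<nu> v * \<eta> (e2 z v)) =
        (\<Sum>w\<in>S z. \<Sum>v\<in>?S2. (\<nu> w * \<eta> (e1 z w)) * (\<nu> v * \<eta> (e2 z v)))"
      by (rule sum_product)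
    also have "\<dots> = (\<Sum>w\<in>S z. \<Sum>v\<in>?V. \<nu> v * \<eta> (A + B * Nm (inverse w) - Tr (inverse w * c v)))"
    proof (rule sum.cong)
      fix w assume w: "w \<in> S z"
      then have wL: "w \<in> L - {0}" and Nw: "Nm w = z / y * D1" by (auto simp: S_def)
      have b: "bij_betw (\<lambda>v. inverse w * v) ?V ?S2"
        by (rule bij_betwI[where g = "\<lambda>v. w * v"])
           (use wL x y z D1F in \<open>auto simp: Nm_mult Nm_inverse Nm_divide Nw field_simps\<close>)
      have "(\<Sum>v\<in>?S2. (\<nu> w * \<eta> (e1 z w)) * (\<nu> v * \<eta> (e2 z v))) =
          (\<Sum>v\<in>?V. (\<nu> w * \<eta> (e1 z w)) * (\<nu> (inverse w * v) * \<eta> (e2 z (inverse w * v))))"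
        by (rule sum.reindex_bij_betw[OF b, symmetric])
      also have "\<dots> = (\<Sum>v\<in>?V. \<nu> v * \<eta> (A + B * Nm (inverse w) - Tr (inverse w * c v)))"
      proof (rule sum.cong)
        fix v assume v: "v \<in> ?V"
        then have vL: "v \<in> L - {0}" by simp
        have "\<nu> w * \<nu> (inverse w * v) = \<nu> (w * (inverse w * v))"
          by (rule mult_char_mult[OF mult_char, symmetric]) (use wL vL in auto)
        moreover have "w * (inverse w * v) = v" using wL by (simp flip: mult.assoc)
        ultimately have \<nu>: "\<nu> w * \<nu> (inverse w * v) = \<nu> v" by simp
        have e1F: "e1 z w \<in> F" using F wL z y by (auto simp: e1_def)
        have e2F: "e2 z (inverse w * v) \<in> F" using F wL vL z x by (auto simp: e2_def)
        \<comment> \<open>Within the fibre \<open>S z\<close> the norm of w determines z.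
          Eliminating 1 / z makes both exponents quadratic in u = 1 / w.\<close>
        have iz: "1 / z = D1 * Nm (inverse w) / y"
          using z y D1F unfolding Nm_inverse Nw by (simp add: field_simps)
        have Trw: "Tr w * Nm (inverse w) = Tr (inverse w)"
        proof -
          have "cj w \<noteq> 0" "w \<noteq> 0" using wL by auto
          then show ?thesis unfolding Tr_def Nm_def cj_inverse by (simp add: field_simps)
        qed
        have Trc: "Tr (inverse w * c v) = D1 / (g1 * y) * Tr (inverse w) + Tr (inverse w * v) / (g2 * x)"
        proof -
          have "inverse w * c v = D1 / (g1 * y) * inverse w + 1 / (g2 * x) * (inverse w * v)"
            by (simp add: c_def algebra_simps)
          also have "Tr \<dots> = D1 / (g1 * y) * Tr (inverse w) + 1 / (g2 * x) * Tr (inverse w * v)"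
            unfolding Tr_add using F x y D1F by (subst (1 2) Tr_mult_F) auto
          finally show ?thesis by simp
        qed
        have "e1 z w = a1 / (g1 * y) + (d1 - Tr w) / g1 * (1 / z)"
          using F z by (simp add: e1_def add_divide_distrib diff_divide_distrib)
        also have "\<dots> = a1 / (g1 * y) + d1 * D1 / (g1 * y) * Nm (inverse w) - D1 / (g1 * y) * (Tr w * Nm (inverse w))"
          unfolding iz by (simp add: diff_divide_distrib algebra_simps)
        finally have e1: "e1 z w = a1 / (g1 * y) + d1 * D1 / (g1 * y) * Nm (inverse w) - D1 / (g1 * y) * Tr (inverse w)"
          unfolding Trw .
        have "e2 z (inverse w * v) = a2 / g2 * (1 / z) + d2 / (g2 * x) - Tr (inverse w * v) / (g2 * x)"
          using F x by (simp add: e2_def add_divide_distrib diff_divide_distrib)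
        then have e2: "e2 z (inverse w * v) = a2 * D1 / (g2 * y) * Nm (inverse w) + d2 / (g2 * x) - Tr (inverse w * v) / (g2 * x)"
          unfolding iz by simp
        have B: "B = d1 * D1 / (g1 * y) + a2 * D1 / (g2 * y)"
          using F y by (simp add: B_def g_def field_simps)
        have "e1 z w + e2 z (inverse w * v) = A + B * Nm (inverse w) - Tr (inverse w * c v)"
          unfolding e1 e2 B A_def Trc by (simp add: algebra_simps)
        then have "\<eta> (e1 z w) * \<eta> (e2 z (inverse w * v)) = \<eta> (A + B * Nm (inverse w) - Tr (inverse w * c v))"
          using F.add_char_add[OF add_char e1F e2F] by simp
        then show "(\<nu> w * \<eta> (e1 z w)) * (\<nu> (inverse w * v) * \<eta> (e2 z (inverse w * v))) =
            \<nu> v * \<eta> (A + B * Nm (inverse w) - Tr (inverse w * c v))"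
          using \<nu> by (metis (no_types) mult.assoc mult.left_commute)
      qed simp
      finally show "(\<Sum>v\<in>?S2. (\<nu> w * \<eta> (e1 z w)) * (\<nu> v * \<eta> (e2 z v))) =
          (\<Sum>v\<in>?V. \<nu> v * \<eta> (A + B * Nm (inverse w) - Tr (inverse w * c v)))" .
    qed simp
    also have "\<dots> = (\<Sum>v\<in>?V. \<nu> v * (\<Sum>w\<in>S z. \<eta> (A + B * Nm (inverse w) - Tr (inverse w * c v))))"
      unfolding sum_distrib_left by (rule sum.swap)
    finally show ?thesis .
  qed
  \<comment> \<open>The fibres \<open>S z\<close> partition the units of \<open>L\<close>, so the
    two sums merge into one over u = 1 / w, which is then completed by the term u = 0.\<close>
  have outer: "(\<Sum>z\<in>F - {0}. \<Sum>w\<in>S z. \<eta> (A + B * Nm (inverse w) - Tr (inverse w * c v))) =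
      (\<Sum>u\<in>L. \<eta> (A + B * Nm u - Tr (u * c v))) - \<eta> A" for v
  proof -
    have S: "S z = {w. w \<in> L - {0} \<and> Nm w * y / D1 = z}" for z
      using y D1F by (auto simp: S_def field_simps)
    have "(\<Sum>z\<in>F - {0}. \<Sum>w\<in>S z. \<eta> (A + B * Nm (inverse w) - Tr (inverse w * c v))) =
        (\<Sum>w\<in>L - {0}. \<eta> (A + B * Nm (inverse w) - Tr (inverse w * c v)))"
      unfolding S by (rule sum.group) (use y D1F in auto)
    also have "\<dots> = (\<Sum>u\<in>L - {0}. \<eta> (A + B * Nm u - Tr (u * c v)))"
      by (rule sum.reindex_bij_betw[OF L.bij_inverse_units])
    also have "\<dots> = (\<Sum>u\<in>L. \<eta> (A + B * Nm u - Tr (u * c v))) - \<eta> A"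
      by (simp add: sum_diff1 Tr_def)
    finally show ?thesis .
  qed
  have "(\<Sum>z\<in>F - {0}. ker a1 b1 g1 d1 y z * ker a2 b2 g2 d2 z x) =
      (\<Sum>z\<in>F - {0}. (1 / of_nat (card F))\<^sup>2 *
        (\<Sum>v\<in>?V. \<nu> v * (\<Sum>w\<in>S z. \<eta> (A + B * Nm (inverse w) - Tr (inverse w * c v)))))"
    by (rule sum.cong) (simp_all add: inner)
  also have "\<dots> = (1 / of_nat (card F))\<^sup>2 * (\<Sum>v\<in>?V. \<nu> v *
      (\<Sum>z\<in>F - {0}. \<Sum>w\<in>S z. \<eta> (A + B * Nm (inverse w) - Tr (inverse w * c v))))"
    unfolding sum_distrib_left[symmetric]
    by (subst sum.swap) (simp add: sum_distrib_left)
  also have "(\<Sum>v\<in>?V. \<nu> v * (\<Sum>z\<in>F - {0}. \<Sum>w\<in>S z. \<eta> (A + B * Nm (inverse w) - Tr (inverse w * c v)))) =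
      (\<Sum>v\<in>?V. \<nu> v * (\<Sum>u\<in>L. \<eta> (A + B * Nm u - Tr (u * c v)))) - (\<Sum>v\<in>?V. \<nu> v) * \<eta> A"
    unfolding outer by (simp add: right_diff_distrib sum_subtractf sum_distrib_right)
  also have "(\<Sum>v\<in>?V. \<nu> v) = 0" by (rule sum_norm_fibre[OF mult_char indec])
  finally show ?thesis by (simp add: A_def B_def c_def)
qed

lemma card_F_nonzero: "complex_of_nat (card F) \<noteq> 0"
  using F.two_le_card by (metis not_numeral_le_zero of_nat_eq_0_iff)

text \<open>The lower left entry \<open>g\<close> of the product decides. If it is nonzero, the
  quadratic sum yields a kernel of the big cell. If it is zero, the quadratic term disappears and
  the sum over u is a delta function at \<open>c v = 0\<close>, which reproduces the triangular
  kernel.\<close>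

lemma ker_mult_big_big:
  assumes F: "a1 \<in> F" "b1 \<in> F" "g1 \<in> F - {0}" "d1 \<in> F" "a2 \<in> F" "b2 \<in> F" "g2 \<in> F - {0}" "d2 \<in> F"
    and D: "a1 * d1 - b1 * g1 \<noteq> 0" "a2 * d2 - b2 * g2 \<noteq> 0"
    and x: "x \<in> F - {0}" and y: "y \<in> F - {0}"
  shows "(\<Sum>z\<in>F - {0}. ker a1 b1 g1 d1 y z * ker a2 b2 g2 d2 z x) =
    ker (a1 * a2 + b1 * g2) (a1 * b2 + b1 * d2) (g1 * a2 + d1 * g2) (g1 * b2 + d1 * d2) y x"
proof -
  define D1 D2 where D12: "D1 = a1 * d1 - b1 * g1" "D2 = a2 * d2 - b2 * g2"
  define g where "g = g1 * a2 + d1 * g2"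
  define a where "a = a1 * a2 + b1 * g2"
  define b where "b = a1 * b2 + b1 * d2"
  define d where "d = g1 * b2 + d1 * d2"
  define A B where "A = a1 / (g1 * y) + d2 / (g2 * x)" and "B = D1 * g / (g1 * g2 * y)"
  define c where "c v = D1 / (g1 * y) + v / (g2 * x)" for v
  let ?V = "{v \<in> L - {0}. Nm v = x / y * (D1 * D2)}"
  let ?r = "complex_of_nat (card F)"
  note r = card_F_nonzero
  have D0: "D1 \<noteq> 0" "D2 \<noteq> 0" using D by (simp_all add: D12)
  have D1F: "D1 \<in> F" using F by (auto simp: D12)
  have gF: "g \<in> F" using F by (auto simp: g_def)
  have AF: "A \<in> F" and BF: "B \<in> F" using F x y gF D1F by (auto simp: A_def B_def)
  have cL: "c v \<in> L" if "v \<in> L" for v using F x y D1F that by (auto simp: c_def)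
  have det: "a * d - b * g = D1 * D2" by (simp add: a_def b_def g_def d_def D12 algebra_simps)
  have main: "(\<Sum>z\<in>F - {0}. ker a1 b1 g1 d1 y z * ker a2 b2 g2 d2 z x) =
    (1 / ?r)\<^sup>2 * (\<Sum>v\<in>?V. \<nu> v * (\<Sum>u\<in>L. \<eta> (A + B * Nm u - Tr (u * c v))))"
    using ker_big_big[OF F D12 D0 x y g_def] by (simp only: A_def B_def c_def)
  have sums: "(\<Sum>u\<in>L. \<eta> (A + B * Nm u - Tr (u * c v))) =
      (if B \<noteq> 0 then - ?r * \<eta> (A - Nm (c v) / B) else if c v = 0 then ?r\<^sup>2 * \<eta> A else 0)"
    if "v \<in> ?V" for v
    by (rule sum_add_char_quadratic[OF add_char AF BF]) (use cL that in auto)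
  show ?thesis
  proof (cases "g = 0")
    case False
    then have B: "B \<noteq> 0" using F D0 y by (simp add: B_def)
    have "(\<Sum>v\<in>?V. \<nu> v * (\<Sum>u\<in>L. \<eta> (A + B * Nm u - Tr (u * c v)))) =
        (\<Sum>v\<in>?V. - ?r * (\<nu> v * \<eta> ((a * x / y + d - Tr v) / (g * x))))"
    proof (rule sum.cong)
      fix v assume v: "v \<in> ?V"
      have s: "D1 / (g1 * y) \<in> F" "1 / (g2 * x) \<in> F" using F x y D1F by auto
      have "cj (c v) = D1 / (g1 * y) + cj v / (g2 * x)"
      proof -
        have "cj (v / (g2 * x)) = cj v / (g2 * x)" unfolding cj_divide using F x by simp
        then show ?thesis unfolding c_def cj_add cj_F[OF s(1)] by simp
      qed
      then have "Nm (c v) = (D1 / (g1 * y))\<^sup>2 + D1 / (g1 * y) * Tr v / (g2 * x) + Nm v / (g2 * x)\<^sup>2"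
        by (simp add: Nm_def Tr_def c_def power2_eq_square algebra_simps add_divide_distrib)
      then have "A - Nm (c v) / B = (a * x / y + d - Tr v) / (g * x)"
        using exponent_identity[OF _ _ _ _ D0(1) False g_def D12, of x y "Tr v"] F x y v
        by (simp add: A_def B_def a_def d_def)
      then show "\<nu> v * (\<Sum>u\<in>L. \<eta> (A + B * Nm u - Tr (u * c v))) =
          - ?r * (\<nu> v * \<eta> ((a * x / y + d - Tr v) / (g * x)))"
        using sums[OF v] B by simp
    qed simp
    also have "\<dots> = - ?r * (\<Sum>v\<in>?V. \<nu> v * \<eta> ((a * x / y + d - Tr v) / (g * x)))"
      by (simp only: sum_distrib_left)
    finally have "(\<Sum>z\<in>F - {0}. ker a1 b1 g1 d1 y z * ker a2 b2 g2 d2 z x) = ker a b g d y x"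
      unfolding main using False det r by (simp add: ker_def power2_eq_square)
    then show ?thesis by (simp only: a_def b_def g_def d_def)
  next
    case True
    then have B: "B = 0" by (simp add: B_def)
    have ga: "g1 * a = - (D1 * g2)"
    proof -
      have "g1 * a + D1 * g2 = a1 * g" by (simp add: a_def g_def D12 algebra_simps)
      then show ?thesis using True by (simp add: eq_neg_iff_add_eq_0)
    qed
    have gd: "g2 * d = - (D2 * g1)"
    proof -
      have "g2 * d + D2 * g1 = d2 * g" by (simp add: d_def g_def D12 algebra_simps)
      then show ?thesis using True by (simp add: eq_neg_iff_add_eq_0)
    qed
    have a: "a = - (D1 * g2) / g1" and d: "d = - (D2 * g1) / g2"
      using ga gd F by (auto simp: field_simps)
    have a0: "a \<noteq> 0" and d0: "d \<noteq> 0" using a d F D0 by auto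
    have dF: "d \<in> F" "a \<in> F" using F by (auto simp: a_def d_def)
    \<comment> \<open>The only zero of \<open>c\<close>. It equals a x / y and belongs to the norm
      fibre exactly on the support x = d / a * y of the triangular kernel.\<close>
    define v0 where "v0 = - (g2 * x * D1 / (g1 * y))"
    have c0: "c v = 0 \<longleftrightarrow> v = v0" for v
      using F x y by (auto simp: c_def v0_def field_simps eq_neg_iff_add_eq_0)
    have v0a: "v0 = a * x / y" using F y by (simp add: v0_def a)
    have v0V: "v0 \<in> ?V \<longleftrightarrow> x = d / a * y"
    proof -
      have "D1 * D2 = a * d" using det True by simp
      then have "v0 \<in> ?V \<longleftrightarrow> Nm v0 = x / y * (a * d)"
        using F x y a0 dF by (auto simp: v0a)
      also have "Nm v0 = (a * x / y)\<^sup>2" unfolding v0a by (rule Nm_of_F) (use x y dF in auto)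
      also have "(a * x / y)\<^sup>2 = x / y * (a * d) \<longleftrightarrow> x = d / a * y"
        using x y a0 by (auto simp: power2_eq_square field_simps)
      finally show ?thesis .
    qed
    have "(\<Sum>v\<in>?V. \<nu> v * (\<Sum>u\<in>L. \<eta> (A + B * Nm u - Tr (u * c v)))) =
        (\<Sum>v\<in>?V. if v = v0 then \<nu> v * (?r\<^sup>2 * \<eta> A) else 0)"
    proof (rule sum.cong)
      fix v assume v: "v \<in> ?V"
      show "\<nu> v * (\<Sum>u\<in>L. \<eta> (A + B * Nm u - Tr (u * c v))) = (if v = v0 then \<nu> v * (?r\<^sup>2 * \<eta> A) else 0)"
        unfolding sums[OF v] c0 using B by simp
    qed simp
    also have "\<dots> = (if v0 \<in> ?V then \<nu> v0 * (?r\<^sup>2 * \<eta> A) else 0)"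
      by (subst sum.delta) simp_all
    finally have lhs: "(\<Sum>z\<in>F - {0}. ker a1 b1 g1 d1 y z * ker a2 b2 g2 d2 z x) =
        (if v0 \<in> ?V then \<nu> v0 * \<eta> A else 0)"
      unfolding main using r by (simp add: power2_eq_square)
    have "\<nu> v0 = \<nu> d" "A = b / (d * y)" if xd: "x = d / a * y"
    proof -
      show "\<nu> v0 = \<nu> d" using xd a0 y by (simp add: v0a)
      have "A = (a1 * d / g1 + d2 * a / g2) / (d * y)"
        using F x y a0 d0 by (simp add: A_def xd field_simps)
      also have "a1 * d / g1 + d2 * a / g2 = b + a1 * d2 * g / (g1 * g2)"
        using F by (simp add: a_def b_def d_def g_def field_simps)
      finally show "A = b / (d * y)" using True by simp
    qed
    then have "(\<Sum>z\<in>F - {0}. ker a1 b1 g1 d1 y z * ker a2 b2 g2 d2 z x) = ker a b g d y x"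
      unfolding lhs v0V using True by (auto simp: ker_def)
    then show ?thesis by (simp only: a_def b_def g_def d_def)
  qed
qed

text \<open>A triangular factor is monomial, so a single z survives; the substitution v -> d1 v
  carries the norm fibre of the right factor to that of the product.\<close>

lemma ker_mult_small_left:
  assumes F: "a1 \<in> F - {0}" "b1 \<in> F" "d1 \<in> F - {0}" "a2 \<in> F" "b2 \<in> F" "g2 \<in> F" "d2 \<in> F"
    and D: "a2 * d2 - b2 * g2 \<noteq> 0"
    and x: "x \<in> F - {0}" and y: "y \<in> F - {0}"
  shows "(\<Sum>z\<in>F - {0}. ker a1 b1 0 d1 y z * ker a2 b2 g2 d2 z x) =
    ker (a1 * a2 + b1 * g2) (a1 * b2 + b1 * d2) (d1 * g2) (d1 * d2) y x"
proof -
  let ?z = "d1 / a1 * y"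
  have z: "?z \<in> F - {0}" using F y by auto
  have d1L: "d1 \<in> L - {0}" using F by auto
  have "(\<Sum>z\<in>F - {0}. ker a1 b1 0 d1 y z * ker a2 b2 g2 d2 z x) =
      (\<Sum>z\<in>F - {0}. if z = ?z then \<nu> d1 * \<eta> (b1 / (d1 * y)) * ker a2 b2 g2 d2 z x else 0)"
    by (rule sum.cong) (auto simp: ker_def)
  also have "\<dots> = \<nu> d1 * \<eta> (b1 / (d1 * y)) * ker a2 b2 g2 d2 ?z x"
    using z by simp
  also have "\<dots> = ker (a1 * a2 + b1 * g2) (a1 * b2 + b1 * d2) (d1 * g2) (d1 * d2) y x"
  proof (cases "g2 = 0")
    case True
    then have d2: "d2 \<noteq> 0" "a2 \<noteq> 0" using D by auto
    have iff: "x = d2 / a2 * ?z \<longleftrightarrow> x = d1 * d2 / (a1 * a2) * y"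
      by (simp add: mult_ac)
    have \<nu>: "\<nu> d1 * \<nu> d2 = \<nu> (d1 * d2)"
      by (rule mult_char_mult[OF mult_char, symmetric]) (use F d2 in auto)
    have "\<eta> (b1 / (d1 * y)) * \<eta> (b2 / (d2 * ?z)) = \<eta> (b1 / (d1 * y) + b2 / (d2 * ?z))"
      by (rule F.add_char_add[OF add_char, symmetric]) (use F z y in auto)
    also have "b1 / (d1 * y) + b2 / (d2 * ?z) = (a1 * b2 + b1 * d2) / (d1 * d2 * y)"
      using F y d2 by (simp add: field_simps)
    finally have "\<nu> d1 * \<eta> (b1 / (d1 * y)) * (\<nu> d2 * \<eta> (b2 / (d2 * ?z))) =
        \<nu> (d1 * d2) * \<eta> ((a1 * b2 + b1 * d2) / (d1 * d2 * y))"
      unfolding \<nu>[symmetric] by (simp only: mult_ac)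
    then show ?thesis using True iff by (auto simp: ker_def)
  next
    case False
    let ?D = "a2 * d2 - b2 * g2"
    let ?V = "{v \<in> L - {0}. Nm v = x / ?z * ?D}"
    let ?W = "{v \<in> L - {0}. Nm v = x / y * ((a1 * a2 + b1 * g2) * (d1 * d2) - (a1 * b2 + b1 * d2) * (d1 * g2))}"
    have N: "Nm d1 = d1\<^sup>2" using F by (simp add: Nm_of_F)
    have D': "(a1 * a2 + b1 * g2) * (d1 * d2) - (a1 * b2 + b1 * d2) * (d1 * g2) = a1 * d1 * ?D"
      by (simp add: algebra_simps)
    have fib: "d1\<^sup>2 * (x / ?z * ?D) = x / y * (a1 * d1 * ?D)"
      using F y by (simp add: power2_eq_square field_simps)
    have "bij_betw (\<lambda>v. d1 * v) {v \<in> L - {0}. Nm v = e} {v \<in> L - {0}. Nm v = d1\<^sup>2 * e}" for e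
      by (rule bij_betwI[where g = "\<lambda>v. inverse d1 * v"])
         (use d1L in \<open>auto simp: Nm_mult Nm_inverse N\<close>)
    then have b: "bij_betw (\<lambda>v. d1 * v) ?V ?W" unfolding D' fib[symmetric] .
    have "(\<Sum>v\<in>?W. \<nu> v * \<eta> (((a1 * a2 + b1 * g2) * x / y + d1 * d2 - Tr v) / (d1 * g2 * x))) =
        (\<Sum>v\<in>?V. \<nu> (d1 * v) * \<eta> (((a1 * a2 + b1 * g2) * x / y + d1 * d2 - Tr (d1 * v)) / (d1 * g2 * x)))"
      by (rule sum.reindex_bij_betw[OF b, symmetric])
    also have "\<dots> = (\<Sum>v\<in>?V. \<nu> d1 * \<eta> (b1 / (d1 * y)) * (\<nu> v * \<eta> ((a2 * x / ?z + d2 - Tr v) / (g2 * x))))"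
    proof (rule sum.cong)
      fix v assume v: "v \<in> ?V"
      have \<nu>: "\<nu> (d1 * v) = \<nu> d1 * \<nu> v"
        by (rule mult_char_mult[OF mult_char d1L]) (use v in auto)
      have "((a1 * a2 + b1 * g2) * x / y + d1 * d2 - Tr (d1 * v)) / (d1 * g2 * x) =
          b1 / (d1 * y) + (a2 * x / ?z + d2 - Tr v) / (g2 * x)"
        using F x y False by (simp add: Tr_mult_F field_simps)
      also have "\<eta> \<dots> = \<eta> (b1 / (d1 * y)) * \<eta> ((a2 * x / ?z + d2 - Tr v) / (g2 * x))"
        by (rule F.add_char_add[OF add_char]) (use F x y z v in auto)
      finally show "\<nu> (d1 * v) * \<eta> (((a1 * a2 + b1 * g2) * x / y + d1 * d2 - Tr (d1 * v)) / (d1 * g2 * x)) =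
        \<nu> d1 * \<eta> (b1 / (d1 * y)) * (\<nu> v * \<eta> ((a2 * x / ?z + d2 - Tr v) / (g2 * x)))"
        unfolding \<nu> by (simp only: mult_ac)
    qed simp
    also have "\<dots> = \<nu> d1 * \<eta> (b1 / (d1 * y)) * (\<Sum>v\<in>?V. \<nu> v * \<eta> ((a2 * x / ?z + d2 - Tr v) / (g2 * x)))"
      by (simp only: sum_distrib_left)
    finally show ?thesis using False F by (simp add: ker_def)
  qed
  finally show ?thesis .
qed

text \<open>Mirror image: the surviving z is a2 / d2 * x, and v -> d2 v matches the fibres.\<close>

lemma ker_mult_small_right:
  assumes F: "a1 \<in> F" "b1 \<in> F" "g1 \<in> F - {0}" "d1 \<in> F" "a2 \<in> F - {0}" "b2 \<in> F" "d2 \<in> F - {0}"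
    and D: "a1 * d1 - b1 * g1 \<noteq> 0"
    and x: "x \<in> F - {0}" and y: "y \<in> F - {0}"
  shows "(\<Sum>z\<in>F - {0}. ker a1 b1 g1 d1 y z * ker a2 b2 0 d2 z x) =
    ker (a1 * a2) (a1 * b2 + b1 * d2) (g1 * a2) (g1 * b2 + d1 * d2) y x"
proof -
  let ?z = "a2 / d2 * x"
  have z: "?z \<in> F - {0}" using F x by auto
  have d2L: "d2 \<in> L - {0}" using F by auto
  have "(\<Sum>z\<in>F - {0}. ker a1 b1 g1 d1 y z * ker a2 b2 0 d2 z x) =
      (\<Sum>z\<in>F - {0}. if z = ?z then ker a1 b1 g1 d1 y z * (\<nu> d2 * \<eta> (b2 / (d2 * z))) else 0)"
    by (rule sum.cong) (use F in \<open>auto simp: ker_def\<close>)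
  also have "\<dots> = ker a1 b1 g1 d1 y ?z * (\<nu> d2 * \<eta> (b2 / (a2 * x)))"
    using z F by simp
  also have "\<dots> = ker (a1 * a2) (a1 * b2 + b1 * d2) (g1 * a2) (g1 * b2 + d1 * d2) y x"
  proof -
    let ?D = "a1 * d1 - b1 * g1"
    let ?V = "{v \<in> L - {0}. Nm v = ?z / y * ?D}"
    let ?W = "{v \<in> L - {0}. Nm v = x / y * ((a1 * a2) * (g1 * b2 + d1 * d2) - (a1 * b2 + b1 * d2) * (g1 * a2))}"
    have N: "Nm d2 = d2\<^sup>2" using F by (simp add: Nm_of_F)
    have D': "(a1 * a2) * (g1 * b2 + d1 * d2) - (a1 * b2 + b1 * d2) * (g1 * a2) = a2 * d2 * ?D"
      by (simp add: algebra_simps)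
    have fib: "d2\<^sup>2 * (?z / y * ?D) = x / y * (a2 * d2 * ?D)"
      using F y by (simp add: power2_eq_square field_simps)
    have "bij_betw (\<lambda>v. d2 * v) {v \<in> L - {0}. Nm v = e} {v \<in> L - {0}. Nm v = d2\<^sup>2 * e}" for e
      by (rule bij_betwI[where g = "\<lambda>v. inverse d2 * v"])
         (use d2L in \<open>auto simp: Nm_mult Nm_inverse N\<close>)
    then have b: "bij_betw (\<lambda>v. d2 * v) ?V ?W" unfolding D' fib[symmetric] .
    have "(\<Sum>v\<in>?W. \<nu> v * \<eta> ((a1 * a2 * x / y + (g1 * b2 + d1 * d2) - Tr v) / (g1 * a2 * x))) =
        (\<Sum>v\<in>?V. \<nu> (d2 * v) * \<eta> ((a1 * a2 * x / y + (g1 * b2 + d1 * d2) - Tr (d2 * v)) / (g1 * a2 * x)))"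
      by (rule sum.reindex_bij_betw[OF b, symmetric])
    also have "\<dots> = (\<Sum>v\<in>?V. \<nu> d2 * \<eta> (b2 / (a2 * x)) * (\<nu> v * \<eta> ((a1 * ?z / y + d1 - Tr v) / (g1 * ?z))))"
    proof (rule sum.cong)
      fix v assume v: "v \<in> ?V"
      have \<nu>: "\<nu> (d2 * v) = \<nu> d2 * \<nu> v"
        by (rule mult_char_mult[OF mult_char d2L]) (use v in auto)
      have "(a1 * a2 * x / y + (g1 * b2 + d1 * d2) - Tr (d2 * v)) / (g1 * a2 * x) =
          b2 / (a2 * x) + (a1 * ?z / y + d1 - Tr v) / (g1 * ?z)"
        using F x y by (simp add: Tr_mult_F field_simps)
      also have "\<eta> \<dots> = \<eta> (b2 / (a2 * x)) * \<eta> ((a1 * ?z / y + d1 - Tr v) / (g1 * ?z))"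
        by (rule F.add_char_add[OF add_char]) (use F x y z v in auto)
      finally show "\<nu> (d2 * v) * \<eta> ((a1 * a2 * x / y + (g1 * b2 + d1 * d2) - Tr (d2 * v)) / (g1 * a2 * x)) =
        \<nu> d2 * \<eta> (b2 / (a2 * x)) * (\<nu> v * \<eta> ((a1 * ?z / y + d1 - Tr v) / (g1 * ?z)))"
        unfolding \<nu> by (simp only: mult_ac)
    qed simp
    also have "\<dots> = \<nu> d2 * \<eta> (b2 / (a2 * x)) * (\<Sum>v\<in>?V. \<nu> v * \<eta> ((a1 * ?z / y + d1 - Tr v) / (g1 * ?z)))"
      by (simp only: sum_distrib_left)
    finally show ?thesis using F by (simp add: ker_def)
  qed
  finally show ?thesis .
qed

lemma ker_mult:
  assumes F: "a1 \<in> F" "b1 \<in> F" "g1 \<in> F" "d1 \<in> F" "a2 \<in> F" "b2 \<in> F" "g2 \<in> F" "d2 \<in> F"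
    and D: "a1 * d1 - b1 * g1 \<noteq> 0" "a2 * d2 - b2 * g2 \<noteq> 0"
    and x: "x \<in> F - {0}" and y: "y \<in> F - {0}"
  shows "(\<Sum>z\<in>F - {0}. ker a1 b1 g1 d1 y z * ker a2 b2 g2 d2 z x) =
    ker (a1 * a2 + b1 * g2) (a1 * b2 + b1 * d2) (g1 * a2 + d1 * g2) (g1 * b2 + d1 * d2) y x"
proof (cases "g1 = 0")
  case True
  then show ?thesis
    using ker_mult_small_left[of a1 b1 d1 a2 b2 g2 d2 x y] assms by auto
next
  case g1: False
  show ?thesis
  proof (cases "g2 = 0")
    case True
    then show ?thesis
      using ker_mult_small_right[of a1 b1 g1 d1 a2 b2 d2 x y] assms g1 by auto
  next
    case False
    then show ?thesis
      using ker_mult_big_big[of a1 b1 g1 d1 a2 b2 g2 d2 x y] assms g1 by auto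
  qed
qed

end

section \<open>The group \<open>GL(2)\<close>\<close>

definition mat2 :: "'a \<Rightarrow> 'a \<Rightarrow> 'a \<Rightarrow> 'a \<Rightarrow> 'a^2^2"
  where "mat2 a b c d = (\<chi> i j. if i = 1 then if j = 1 then a else b else if j = 1 then c else d)"

lemma mat2_nth [simp]:
  "mat2 a b c d $ 1 $ 1 = a" "mat2 a b c d $ 1 $ 2 = b"
  "mat2 a b c d $ 2 $ 1 = c" "mat2 a b c d $ 2 $ 2 = d"
  by (simp_all add: mat2_def)

lemma mat2_eq_iff: "(A :: 'a^2^2) = B \<longleftrightarrow> A $ 1 $ 1 = B $ 1 $ 1 \<and> A $ 1 $ 2 = B $ 1 $ 2 \<and>
    A $ 2 $ 1 = B $ 2 $ 1 \<and> A $ 2 $ 2 = B $ 2 $ 2"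
  by (auto simp: vec_eq_iff forall_2)

lemma matrix_mult_nth_2:
  "((A :: 'a::comm_semiring_1^2^2) ** B) $ i $ j = A $ i $ 1 * B $ 1 $ j + A $ i $ 2 * B $ 2 $ j"
  by (simp add: matrix_matrix_mult_def sum_2)

lemma mat_1_nth_2: "(mat 1 :: 'a::comm_ring_1^2^2) $ 1 $ 1 = 1" "(mat 1 :: 'a^2^2) $ 1 $ 2 = 0"
  "(mat 1 :: 'a^2^2) $ 2 $ 1 = 0" "(mat 1 :: 'a^2^2) $ 2 $ 2 = 1"
  by (simp_all add: mat_def)

text \<open>The inverse matrix: the adjugate already divided by the determinant, a closed formula
  for \<open>inv\<close> in the group.\<close>

definition adj2 :: "'a::field^2^2 \<Rightarrow> 'a^2^2"
  where "adj2 A = mat2 (A $ 2 $ 2 / det A) (- A $ 1 $ 2 / det A) (- A $ 2 $ 1 / det A) (A $ 1 $ 1 / det A)"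

lemma mult_GL2 [simp]: "A \<otimes>\<^bsub>GL2 F\<^esub> B = A ** B" and one_GL2 [simp]: "\<one>\<^bsub>GL2 F\<^esub> = mat 1"
  by (simp_all add: GL2_def)

lemma carrier_GL2: "A \<in> carrier (GL2 F) \<longleftrightarrow>
    A $ 1 $ 1 \<in> F \<and> A $ 1 $ 2 \<in> F \<and> A $ 2 $ 1 \<in> F \<and> A $ 2 $ 2 \<in> F \<and> det A \<noteq> 0"
  by (auto simp: GL2_def forall_2)

lemma adj2_mult: "det A \<noteq> 0 \<Longrightarrow> adj2 A ** A = mat 1"
  unfolding mat2_eq_iff matrix_mult_nth_2 mat_1_nth_2 adj2_def mat2_nth
proof -
  assume D: "det A \<noteq> 0"
  have "A $ 1 $ 1 * A $ 2 $ 2 - A $ 1 $ 2 * A $ 2 $ 1 = det A" by (simp add: det_2)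
  then have "(A $ 1 $ 1 * A $ 2 $ 2 - A $ 1 $ 2 * A $ 2 $ 1) / det A = 1" using D by simp
  then show "A $ 2 $ 2 / det A * A $ 1 $ 1 + - A $ 1 $ 2 / det A * A $ 2 $ 1 = 1 \<and>
    A $ 2 $ 2 / det A * A $ 1 $ 2 + - A $ 1 $ 2 / det A * A $ 2 $ 2 = 0 \<and>
    - A $ 2 $ 1 / det A * A $ 1 $ 1 + A $ 1 $ 1 / det A * A $ 2 $ 1 = 0 \<and>
    - A $ 2 $ 1 / det A * A $ 1 $ 2 + A $ 1 $ 1 / det A * A $ 2 $ 2 = 1"
    by (simp add: diff_divide_distrib mult.commute)
qed

context subfield
begin

lemma mult_closed_GL2:
  assumes "A \<in> carrier (GL2 F)" "B \<in> carrier (GL2 F)"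
  shows "A ** B \<in> carrier (GL2 F)"
  using assms by (auto simp: carrier_GL2 matrix_mult_nth_2 det_mul)

lemma adj2_closed: "A \<in> carrier (GL2 F) \<Longrightarrow> adj2 A \<in> carrier (GL2 F)"
proof -
  assume A: "A \<in> carrier (GL2 F)"
  then have d: "det A \<in> F" "det A \<noteq> 0" by (auto simp: carrier_GL2 det_2)
  have "det (adj2 A) * det A = 1"
    using adj2_mult[OF d(2)] by (metis det_I det_mul)
  then have "det (adj2 A) \<noteq> 0" by auto
  then show ?thesis using A d by (simp add: carrier_GL2 adj2_def)
qed

lemma group_GL2: "group (GL2 F)"
proof (rule groupI)
  show "\<one>\<^bsub>GL2 F\<^esub> \<in> carrier (GL2 F)"
    by (simp add: carrier_GL2 mat_1_nth_2 det_I)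
  show "\<exists>B\<in>carrier (GL2 F). B \<otimes>\<^bsub>GL2 F\<^esub> A = \<one>\<^bsub>GL2 F\<^esub>" if "A \<in> carrier (GL2 F)" for A
    using that adj2_closed[OF that] adj2_mult[of A] by (auto simp: carrier_GL2)
qed (simp_all add: mult_closed_GL2 matrix_mul_assoc)

lemma inv_GL2:
  assumes "A \<in> carrier (GL2 F)"
  shows "inv\<^bsub>GL2 F\<^esub> A = adj2 A"
proof (rule group.inv_equality[OF group_GL2])
  show "adj2 A \<otimes>\<^bsub>GL2 F\<^esub> A = \<one>\<^bsub>GL2 F\<^esub>"
    using assms adj2_mult[of A] by (simp add: carrier_GL2)
qed (use assms adj2_closed in auto)

lemma subgroup_GL2:
  assumes "subfield K" "K \<subseteq> F"
  shows "subgroup (carrier (GL2 K)) (GL2 F)"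
proof (rule group.subgroupI[OF group_GL2])
  interpret K: subfield K by fact
  show sub: "carrier (GL2 K) \<subseteq> carrier (GL2 F)"
    using assms(2) by (auto simp: carrier_GL2)
  show "carrier (GL2 K) \<noteq> {}"
    using group.is_monoid[OF K.group_GL2] monoid.one_closed by blast
  show "inv\<^bsub>GL2 F\<^esub> A \<in> carrier (GL2 K)" if "A \<in> carrier (GL2 K)" for A
    using inv_GL2[of A] K.adj2_closed[OF that] sub that by auto
qed (use assms(1) subfield.mult_closed_GL2 in auto)

text \<open>Columns: a nonzero vector, then a vector outside its span.\<close>

lemma card_GL2: "card (carrier (GL2 F)) = (card F ^ 2 - 1) * (card F ^ 2 - card F)"
proof -
  let ?C = "F \<times> F - {(0, 0)}"
  let ?S = "\<lambda>p. F \<times> F - (\<lambda>t. (t * fst p, t * snd p)) ` F"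
  define h :: "('a \<times> 'a) \<times> ('a \<times> 'a) \<Rightarrow> 'a^2^2"
    where "h p = mat2 (fst (fst p)) (fst (snd p)) (snd (fst p)) (snd (snd p))" for p
  have h: "h p \<in> carrier (GL2 F)" if pS: "p \<in> Sigma ?C ?S" for p
  proof -
    obtain a c b d where p: "p = ((a, c), (b, d))" by (metis surj_pair)
    have F: "a \<in> F" "b \<in> F" "c \<in> F" "d \<in> F" and ac: "a \<noteq> 0 \<or> c \<noteq> 0"
      and bd: "(b, d) \<notin> (\<lambda>t. (t * a, t * c)) ` F" using pS unfolding p by auto
    have "a * d - b * c \<noteq> 0"
    proof
      assume eq: "a * d - b * c = 0"
      have "\<exists>t\<in>F. (b, d) = (t * a, t * c)"
      proof (cases "a = 0")
        case True
        then have "b = 0" "c \<noteq> 0" using eq ac by auto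
        then show ?thesis using F True by (intro bexI[of _ "d / c"]) auto
      next
        case False
        then show ?thesis using F eq by (intro bexI[of _ "b / a"]) (auto simp: field_simps)
      qed
      then show False using bd by (auto simp: image_iff)
    qed
    then show ?thesis using F by (simp add: p h_def carrier_GL2 det_2)
  qed
  have h': "((A $ 1 $ 1, A $ 2 $ 1), (A $ 1 $ 2, A $ 2 $ 2)) \<in> Sigma ?C ?S" if "A \<in> carrier (GL2 F)" for A
    using that by (auto simp: carrier_GL2 det_2)
  have "bij_betw h (Sigma ?C ?S) (carrier (GL2 F))"
  proof (rule bij_betwI)
    let ?g = "\<lambda>A :: 'a^2^2. ((A $ 1 $ 1, A $ 2 $ 1), (A $ 1 $ 2, A $ 2 $ 2))"
    show "h \<in> Sigma ?C ?S \<rightarrow> carrier (GL2 F)" by (rule funcsetI) (rule h)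
    show "?g \<in> carrier (GL2 F) \<rightarrow> Sigma ?C ?S" by (rule funcsetI) (rule h')
    show "?g (h p) = p" for p by (simp add: h_def)
    show "h (?g A) = A" for A by (simp add: h_def mat2_eq_iff)
  qed
  then have "card (carrier (GL2 F)) = card (Sigma ?C ?S)" by (rule bij_betw_same_card[symmetric])
  also have "\<dots> = (\<Sum>p\<in>?C. card (?S p))" by (rule card_SigmaI) auto
  also have "\<dots> = (\<Sum>p\<in>?C. card F ^ 2 - card F)"
  proof (rule sum.cong)
    fix p assume p: "p \<in> ?C"
    have inj: "inj_on (\<lambda>t. (t * fst p, t * snd p)) F" using p by (auto simp: inj_on_def)
    have "card (?S p) = card (F \<times> F) - card ((\<lambda>t. (t * fst p, t * snd p)) ` F)"
      by (rule card_Diff_subset) (use p in auto)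
    then show "card (?S p) = card F ^ 2 - card F"
      using card_image[OF inj] by (simp add: card_cartesian_product power2_eq_square)
  qed simp
  also have "\<dots> = (card F ^ 2 - 1) * (card F ^ 2 - card F)"
    by (simp add: card_Diff_singleton card_cartesian_product power2_eq_square)
  finally show ?thesis .
qed

end

section \<open>Properties of the cuspidal representations\<close>

context cuspidal
begin

section \<open>The delta basis: representation property and irreducibility\<close>

definition del :: "'a \<Rightarrow> 'a \<Rightarrow> complex"
  where "del y = (\<lambda>x. if x = y then 1 else 0)"

lemma del_space: "y \<in> F - {0} \<Longrightarrow> del y \<in> rep_space \<rho>"
  by (auto simp: rho_space del_def)

lemma rho_expand:
  assumes "f \<in> rep_space \<rho>"
  shows "f = (\<Sum>y\<in>F - {0}. fscale (f y) (del y))"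
proof
  fix x
  have "(\<Sum>y\<in>F - {0}. fscale (f y) (del y)) x = (\<Sum>y\<in>F - {0}. if x = y then f y else 0)"
    by (simp only: sum_fun_apply fscale_apply del_def) (rule sum.cong, auto)
  also have "\<dots> = f x" using assms by (auto simp: rho_space)
  finally show "f x = (\<Sum>y\<in>F - {0}. fscale (f y) (del y)) x" by simp
qed

lemma rho_subspace: "cfun.subspace (rep_space \<rho>)"
  by (rule cfun.subspaceI) (auto simp: rho_space)

lemma rho_is_rep: "is_rep (GL2 F) \<rho>"
  unfolding is_rep_def
proof (intro conjI ballI)
  show "linear_between (rep_space \<rho>) (rep_space \<rho>) (rep_act \<rho> A)" if A: "A \<in> carrier (GL2 F)" for A
  proof (rule linear_betweenI)
    show "rep_act \<rho> A f \<in> rep_space \<rho>" for f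
      by (simp add: rho_space rho_act[OF A])
    show "rep_act \<rho> A (f + g) = rep_act \<rho> A f + rep_act \<rho> A g" for f g
      by (auto simp: fun_eq_iff rho_act[OF A] sum.distrib distrib_left)
    show "rep_act \<rho> A (fscale c f) = fscale c (rep_act \<rho> A f)" for c f
      by (auto simp: fun_eq_iff rho_act[OF A] sum_distrib_left mult_ac)
  qed
  have one: "mat 1 \<in> carrier (GL2 F)"
    by (simp add: carrier_GL2 mat_1_nth_2 det_I)
  show "rep_act \<rho> \<one>\<^bsub>GL2 F\<^esub> f = f" if f: "f \<in> rep_space \<rho>" for f
  proof
    fix y
    show "rep_act \<rho> \<one>\<^bsub>GL2 F\<^esub> f y = f y"
    proof (cases "y \<in> F - {0}")
      case True
      have "(\<Sum>x\<in>F - {0}. ker 1 0 0 1 y x * f x) = (\<Sum>x\<in>F - {0}. if x = y then f x else 0)"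
        by (rule sum.cong) (auto simp: ker_def L.mult_char_1[OF mult_char] F.add_char_0[OF add_char])
      then show ?thesis using True by (simp add: rho_act[OF one] mat_1_nth_2)
    qed (use f in \<open>auto simp: rho_act[OF one] rho_space\<close>)
  qed
  show "rep_act \<rho> (A \<otimes>\<^bsub>GL2 F\<^esub> B) f = rep_act \<rho> A (rep_act \<rho> B f)"
    if A: "A \<in> carrier (GL2 F)" and B: "B \<in> carrier (GL2 F)" for A B f
  proof
    fix y
    show "rep_act \<rho> (A \<otimes>\<^bsub>GL2 F\<^esub> B) f y = rep_act \<rho> A (rep_act \<rho> B f) y"
    proof (cases "y \<in> F - {0}")
      case y: True
      let ?k = "\<lambda>A. ker (A $ 1 $ 1) (A $ 1 $ 2) (A $ 2 $ 1) (A $ 2 $ 2)"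
      have k: "(\<Sum>z\<in>F - {0}. ?k A y z * ?k B z x) = ?k (A ** B) y x" if "x \<in> F - {0}" for x
        unfolding matrix_mult_nth_2
        by (rule ker_mult) (use A B y that in \<open>auto simp: carrier_GL2 det_2\<close>)
      have "rep_act \<rho> A (rep_act \<rho> B f) y = (\<Sum>z\<in>F - {0}. \<Sum>x\<in>F - {0}. ?k A y z * ?k B z x * f x)"
        using y by (simp add: rho_act[OF A] rho_act[OF B] sum_distrib_left mult_ac)
      also have "\<dots> = (\<Sum>x\<in>F - {0}. (\<Sum>z\<in>F - {0}. ?k A y z * ?k B z x) * f x)"
        by (subst sum.swap) (simp add: sum_distrib_right)
      also have "\<dots> = rep_act \<rho> (A \<otimes>\<^bsub>GL2 F\<^esub> B) f y"
        using y k by (simp add: rho_act[OF F.mult_closed_GL2[OF A B]])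
      finally show ?thesis by simp
    qed (auto simp: rho_act[OF A] rho_act[OF F.mult_closed_GL2[OF A B]])
  qed
qed (rule rho_subspace)

lemma upper_mem: "a \<in> F - {0} \<Longrightarrow> b \<in> F \<Longrightarrow> d \<in> F - {0} \<Longrightarrow> mat2 a b 0 d \<in> carrier (GL2 F)"
  by (auto simp: carrier_GL2 det_2)

lemma rho_act_upper:
  assumes "a \<in> F - {0}" "b \<in> F" "d \<in> F - {0}" "y \<in> F - {0}"
  shows "rep_act \<rho> (mat2 a b 0 d) f y = \<nu> d * \<eta> (b / (d * y)) * f (d / a * y)"
proof -
  have "rep_act \<rho> (mat2 a b 0 d) f y = (\<Sum>x\<in>F - {0}. ker a b 0 d y x * f x)"
    using assms by (simp add: rho_act[OF upper_mem[OF assms(1-3)]])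
  also have "\<dots> = (\<Sum>x\<in>F - {0}. if x = d / a * y then \<nu> d * \<eta> (b / (d * y)) * f x else 0)"
    by (rule sum.cong) (simp_all add: ker_def)
  also have "\<dots> = \<nu> d * \<eta> (b / (d * y)) * f (d / a * y)"
    using assms by (subst sum.delta) auto
  finally show ?thesis .
qed

lemma rho_act_unipotent:
  assumes "b \<in> F" "y \<in> F - {0}"
  shows "rep_act \<rho> (mat2 1 b 0 1) f y = \<eta> (b / y) * f y"
  using rho_act_upper[of 1 b 1 y f] assms by (simp add: L.mult_char_1[OF mult_char])

lemma rho_act_diag_del:
  assumes "a \<in> F - {0}" "y \<in> F - {0}"
  shows "rep_act \<rho> (mat2 a 0 0 1) (del y) = del (a * y)"
proof
  fix x
  show "rep_act \<rho> (mat2 a 0 0 1) (del y) x = del (a * y) x"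
  proof (cases "x \<in> F - {0}")
    case True
    then show ?thesis
      using rho_act_upper[of a 0 1 x "del y"] assms
      by (auto simp: L.mult_char_1[OF mult_char] F.add_char_0[OF add_char] del_def field_simps)
  next
    case False
    then have "del (a * y) x = 0" using assms by (auto simp: del_def)
    then show ?thesis using False rho_act[OF upper_mem, of a 0 1 "del y" x] assms by auto
  qed
qed

text \<open>Upper unipotent matrices act diagonally in the basis \<open>del\<close>, through the
  characters b -> \<eta> (b / y), which differ for different y. Averaging against one of them
  isolates a basis vector, and diagonal matrices move it to all others.\<close>

lemma rho_irreducible: "irreducible_rep (GL2 F) \<rho>"
proof (rule irreducible_repI[OF rho_is_rep])
  show "del 1 \<in> rep_space \<rho>" by (rule del_space) auto
  have "del 1 1 \<noteq> 0" by (simp add: del_def)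
  then show "del 1 \<noteq> 0" by auto
  fix W w assume W: "cfun.subspace W" "W \<subseteq> rep_space \<rho>" and w: "w \<in> W" "w \<noteq> 0"
    and inv: "\<And>g w. g \<in> carrier (GL2 F) \<Longrightarrow> w \<in> W \<Longrightarrow> rep_act \<rho> g w \<in> W"
  obtain y0 where y0: "w y0 \<noteq> 0" using w(2) by (auto simp: fun_eq_iff)
  have ws: "w \<in> rep_space \<rho>" using W w by blast
  then have y0F: "y0 \<in> F - {0}" using y0 by (auto simp: rho_space)
  have uni: "mat2 1 b 0 1 \<in> carrier (GL2 F)" if "b \<in> F" for b
    using upper_mem[of 1 b 1] that by auto
  define P where "P = (\<Sum>b\<in>F. fscale (\<eta> (- b / y0)) (rep_act \<rho> (mat2 1 b 0 1) w))"
  have PW: "P \<in> W"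
    unfolding P_def
    by (rule cfun.subspace_sum[OF W(1)]) (rule cfun.subspace_scale[OF W(1)], rule inv, rule uni, simp, rule w(1))
  have P: "P = fscale (of_nat (card F) * w y0) (del y0)"
  proof
    fix y
    show "P y = fscale (of_nat (card F) * w y0) (del y0) y"
    proof (cases "y \<in> F - {0}")
      case True
      have "P y = (\<Sum>b\<in>F. \<eta> ((1 / y - 1 / y0) * b) * w y)"
        unfolding P_def sum_fun_apply fscale_apply
      proof (rule sum.cong)
        fix b assume b: "b \<in> F"
        have "(1 / y - 1 / y0) * b = - b / y0 + b / y" by (simp add: algebra_simps)
        moreover have "\<eta> (- b / y0 + b / y) = \<eta> (- b / y0) * \<eta> (b / y)"
          by (rule F.add_char_add[OF add_char]) (use b True y0F in auto)
        ultimately show "\<eta> (- b / y0) * rep_act \<rho> (mat2 1 b 0 1) w y = \<eta> ((1 / y - 1 / y0) * b) * w y"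
          using rho_act_unipotent[OF b True] by simp
      qed simp
      also have "\<dots> = (\<Sum>b\<in>F. \<eta> ((1 / y - 1 / y0) * b)) * w y" by (simp only: sum_distrib_right)
      also have "\<dots> = fscale (of_nat (card F) * w y0) (del y0) y"
      proof (cases "y = y0")
        case True
        then show ?thesis by (simp add: del_def F.add_char_0[OF add_char])
      next
        case False
        have "1 / y - 1 / y0 \<in> F - {0}" using False True y0F by (auto simp: field_simps)
        then show ?thesis using False F.sum_add_char_mult[OF add_char] by (simp add: del_def)
      qed
      finally show ?thesis .
    next
      case False
      have "P \<in> rep_space \<rho>" using PW W by blast
      then show ?thesis using False y0F by (auto simp: rho_space del_def)
    qed
  qed
  have "fscale (1 / (of_nat (card F) * w y0)) P \<in> W" by (rule cfun.subspace_scale[OF W(1) PW])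
  moreover have "fscale (1 / (of_nat (card F) * w y0)) P = del y0"
    using y0 card_F_nonzero by (simp add: P fun_eq_iff)
  ultimately have d0: "del y0 \<in> W" by simp
  have d: "del y \<in> W" if y: "y \<in> F - {0}" for y
  proof -
    have a: "y / y0 \<in> F - {0}" using y y0F by auto
    have "rep_act \<rho> (mat2 (y / y0) 0 0 1) (del y0) \<in> W"
      by (rule inv[OF upper_mem d0]) (use a in auto)
    then show ?thesis using rho_act_diag_del[OF a y0F] y0F by simp
  qed
  show "rep_space \<rho> \<subseteq> W"
  proof
    fix f assume "f \<in> rep_space \<rho>"
    from rho_expand[OF this] show "f \<in> W"
      using d cfun.subspace_sum[OF W(1)] cfun.subspace_scale[OF W(1)] by (metis (no_types, lifting))
  qed
qed

lemma rho_dim: "dim_at_least (rep_space \<rho>) (card F - 1)"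
  unfolding F.card_units[symmetric]
  by (rule dim_at_least_dual[where v = del]) (auto simp: del_space, auto simp: del_def)

section \<open>Traces of the cuspidal operators\<close>

definition trace :: "'a \<Rightarrow> 'a \<Rightarrow> 'a \<Rightarrow> 'a \<Rightarrow> complex"
  where "trace a b g d = (\<Sum>y\<in>F - {0}. ker a b g d y y)"

text \<open>On the diagonal the norm fibre does not depend on y. Summing the exponential over y
  gives \<open>card F\<close> if Tr v = a + d and 0 otherwise, minus 1 in every case; the constant
  part dies by \<open>sum_norm_fibre\<close>. What remains are the v for which \<open>v\<close> and
  \<open>cj v\<close> have the product and the sum of the eigenvalues.\<close>

lemma trace_big:
  assumes F: "a \<in> F" "b \<in> F" "g \<in> F - {0}" "d \<in> F"
  shows "trace a b g d = - (\<Sum>v\<in>{v \<in> L - {0}. Nm v = a * d - b * g \<and> Tr v = a + d}. \<nu> v)"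
proof -
  let ?V = "{v \<in> L - {0}. Nm v = a * d - b * g}"
  let ?r = "complex_of_nat (card F)"
  have inner: "(\<Sum>y\<in>F - {0}. \<eta> ((a + d - Tr v) / (g * y))) = (if Tr v = a + d then ?r else 0) - 1"
    if v: "v \<in> ?V" for v
  proof -
    have b: "bij_betw (\<lambda>y. 1 / (g * y)) (F - {0}) (F - {0})"
      by (rule bij_betwI[where g = "\<lambda>y. 1 / (g * y)"]) (use F in auto)
    have "(\<Sum>y\<in>F - {0}. \<eta> ((a + d - Tr v) / (g * y))) = (\<Sum>y\<in>F - {0}. \<eta> ((a + d - Tr v) * (1 / (g * y))))"
      by simp
    also have "\<dots> = (\<Sum>t\<in>F - {0}. \<eta> ((a + d - Tr v) * t))"
      by (rule sum.reindex_bij_betw[OF b])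
    also have "\<dots> = (if Tr v = a + d then ?r else 0) - 1"
    proof (cases "Tr v = a + d")
      case True
      then show ?thesis using F.two_le_card
        by (simp add: F.add_char_0[OF add_char] F.card_units of_nat_diff)
    next
      case False
      then have "a + d - Tr v \<in> F - {0}" using F v by auto
      then show ?thesis using False F.sum_add_char_mult_units[OF add_char] by simp
    qed
    finally show ?thesis .
  qed
  have "trace a b g d = (\<Sum>y\<in>F - {0}. - (1 / ?r) * (\<Sum>v\<in>?V. \<nu> v * \<eta> ((a + d - Tr v) / (g * y))))"
    unfolding trace_def by (rule sum.cong) (use F in \<open>auto simp: ker_def\<close>)
  also have "\<dots> = - (1 / ?r) * (\<Sum>v\<in>?V. \<nu> v * (\<Sum>y\<in>F - {0}. \<eta> ((a + d - Tr v) / (g * y))))"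
    unfolding sum_distrib_left[symmetric] by (subst sum.swap) (simp add: sum_distrib_left)
  also have "(\<Sum>v\<in>?V. \<nu> v * (\<Sum>y\<in>F - {0}. \<eta> ((a + d - Tr v) / (g * y)))) =
      (\<Sum>v\<in>?V. (if Tr v = a + d then ?r * \<nu> v else 0) - \<nu> v)"
    by (rule sum.cong) (simp_all only: inner, auto simp: algebra_simps)
  also have "\<dots> = (\<Sum>v\<in>{v \<in> ?V. Tr v = a + d}. ?r * \<nu> v)"
    unfolding sum_subtractf sum_norm_fibre[OF mult_char indec] by (subst sum.inter_filter) simp_all
  also have "\<dots> = ?r * (\<Sum>v\<in>{v \<in> L - {0}. Nm v = a * d - b * g \<and> Tr v = a + d}. \<nu> v)"
    unfolding sum_distrib_left by (rule sum.cong) auto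
  finally show ?thesis using card_F_nonzero by simp
qed

lemma trace_big_eigenvalue:
  assumes F: "a \<in> F" "b \<in> F" "g \<in> F - {0}" "d \<in> F" and z: "z \<in> L - {0}" "Nm z = a * d - b * g" "Tr z = a + d"
  shows "trace a b g d = - (\<Sum>v\<in>{z, cj z}. \<nu> v)"
proof -
  have "{v \<in> L - {0}. Nm v = a * d - b * g \<and> Tr v = a + d} = {z, cj z}"
    unfolding z(2,3)[symmetric] using same_Nm_Tr_iff[of z] z(1) by auto
  then show ?thesis using trace_big[OF F] by simp
qed

lemma trace_split: "a \<noteq> d \<Longrightarrow> a \<noteq> 0 \<Longrightarrow> trace a b 0 d = 0"
  unfolding trace_def by (rule sum.neutral) (auto simp: ker_def field_simps)

lemma trace_unipotent:
  assumes "a \<in> F - {0}" "b \<in> F - {0}"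
  shows "trace a b 0 a = - \<nu> a"
proof -
  have bi: "bij_betw (\<lambda>y. 1 / y) (F - {0}) (F - {0})"
    by (rule bij_betwI[where g = "\<lambda>y. 1 / y"]) auto
  have "trace a b 0 a = (\<Sum>y\<in>F - {0}. \<nu> a * \<eta> (b / a * (1 / y)))"
    unfolding trace_def by (rule sum.cong) (use assms in \<open>auto simp: ker_def\<close>)
  also have "\<dots> = (\<Sum>y\<in>F - {0}. \<nu> a * \<eta> (b / a * y))"
    by (rule sum.reindex_bij_betw[OF bi, of "\<lambda>y. \<nu> a * \<eta> (b / a * y)"])
  also have "\<dots> = - \<nu> a"
    using F.sum_add_char_mult_units[OF add_char, of "b / a"] assms
    by (simp flip: sum_distrib_left)
  finally show ?thesis .
qed

lemma trace_scalar:
  assumes "a \<in> F - {0}"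
  shows "trace a 0 0 a = of_nat (card F - 1) * \<nu> a"
proof -
  have "trace a 0 0 a = (\<Sum>y\<in>F - {0}. \<nu> a)"
    unfolding trace_def by (rule sum.cong) (use assms in \<open>auto simp: ker_def F.add_char_0[OF add_char]\<close>)
  then show ?thesis by (simp add: F.card_units)
qed

end

text \<open>Commuting with the unipotent matrices makes an intertwiner diagonal in
  \<open>del\<close>, commuting with the diagonal ones makes it scalar. So the kernels agree, hence
  the traces, and \<mu> + conj \<mu> = \<mu>' + conj \<mu>' on the units of \<open>L\<close>.
  Orthogonality of distinct characters leaves only the two stated cases.\<close>

lemma cuspidal_equiv_imp:
  assumes "cuspidal F L \<eta> \<mu>" "cuspidal F L \<eta> \<mu>'"
    and eq: "rep_equiv (GL2 F) (cuspidal_rep F L \<eta> \<mu>) (cuspidal_rep F L \<eta> \<mu>')"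
  shows "\<mu>' = \<mu> \<or> \<mu>' = conj_char F \<mu>"
proof -
  interpret m: cuspidal F L \<eta> \<mu> by fact
  interpret m': cuspidal F L \<eta> \<mu>' by fact
  obtain T where T: "intertwiner (GL2 F) m.\<rho> m'.\<rho> T" and b: "bij_betw T (rep_space m.\<rho>) (rep_space m'.\<rho>)"
    using eq unfolding rep_equiv_def by blast
  note Tl = intertwinerD(1)[OF T]
  have space: "rep_space m'.\<rho> = rep_space m.\<rho>" by (simp add: m.rho_space m'.rho_space)
  have uni: "mat2 1 b 0 1 \<in> carrier (GL2 F)" if "b \<in> F" for b
    using m.upper_mem[of 1 b 1] that by auto
  have off: "T (m.del y) z = 0" if y: "y \<in> F - {0}" and z: "z \<noteq> y" for y z
  proof (cases "z \<in> F - {0}")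
    case True
    obtain t where t: "t \<in> F" "\<eta> t \<noteq> 1"
      using m.add_char by (auto simp: nontrivial_add_char_def)
    \<comment> \<open>Chosen so that b / z - b / y = t, a point where \<eta> is not 1: this
      unipotent matrix separates the two basis vectors.\<close>
    define b where "b = t / (1 / z - 1 / y)"
    have nz: "1 / z - 1 / y \<noteq> 0" using z y True by (auto simp: field_simps)
    have bF: "b \<in> F" using t y True by (auto simp: b_def)
    have "b / z = b * (1 / z - 1 / y) + b / y" by (simp add: algebra_simps)
    also have "b * (1 / z - 1 / y) = t" using nz by (simp add: b_def)
    finally have bz: "\<eta> (b / z) = \<eta> t * \<eta> (b / y)"
      using m.F.add_char_add[OF m.add_char t(1), of "b / y"] bF y by auto
    have by0: "\<eta> (b / y) \<noteq> 0"
      using m.add_char bF y by (auto simp: nontrivial_add_char_def)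
    have "rep_act m.\<rho> (mat2 1 b 0 1) (m.del y) = fscale (\<eta> (b / y)) (m.del y)"
    proof
      fix x
      show "rep_act m.\<rho> (mat2 1 b 0 1) (m.del y) x = fscale (\<eta> (b / y)) (m.del y) x"
      proof (cases "x \<in> F - {0}")
        case True
        then show ?thesis using m.rho_act_unipotent[OF bF True] by (simp add: m.del_def)
      next
        case False
        then show ?thesis using y m.rho_act[OF uni[OF bF]] by (auto simp: m.del_def)
      qed
    qed
    then have "fscale (\<eta> (b / y)) (T (m.del y)) = rep_act m'.\<rho> (mat2 1 b 0 1) (T (m.del y))"
      using intertwinerD(3)[OF T uni[OF bF] m.del_space[OF y]] linear_betweenD(3)[OF Tl m.del_space[OF y]]
      by simp
    then have "\<eta> (b / y) * T (m.del y) z = \<eta> (b / z) * T (m.del y) z"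
      using m'.rho_act_unipotent[OF bF True] by (metis fscale_apply)
    then show ?thesis using bz by0 t(2) by simp
  next
    case False
    then show ?thesis
      using intertwinerD(2)[OF T m.del_space[OF y]] by (auto simp: m'.rho_space)
  qed
  define c where "c = T (m.del 1) 1"
  have one: "1 \<in> F - {0}" by simp
  have T1: "T (m.del 1) = fscale c (m.del 1)"
    using off[OF one] by (auto simp: fun_eq_iff m.del_def c_def)
  have Td: "T (m.del y) = fscale c (m.del y)" if y: "y \<in> F - {0}" for y
  proof -
    have A: "mat2 y 0 0 1 \<in> carrier (GL2 F)" using m.upper_mem[of y 0 1] y by auto
    have "T (m.del y) = T (rep_act m.\<rho> (mat2 y 0 0 1) (m.del 1))"
      using m.rho_act_diag_del[OF y one] by simp
    also have "\<dots> = rep_act m'.\<rho> (mat2 y 0 0 1) (fscale c (m.del 1))"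
      using intertwinerD(3)[OF T A m.del_space[OF one]] T1 by simp
    also have "\<dots> = fscale c (rep_act m'.\<rho> (mat2 y 0 0 1) (m.del 1))"
      using linear_betweenD(3)[OF is_repD(2)[OF m'.rho_is_rep A]] m.del_space[OF one] space by simp
    finally show ?thesis using m'.rho_act_diag_del[OF y one] by (simp add: m.del_def m'.del_def)
  qed
  have Tf: "T f = fscale c f" if f: "f \<in> rep_space m.\<rho>" for f
  proof -
    have "T f = T (\<Sum>y\<in>F - {0}. fscale (f y) (m.del y))" using m.rho_expand[OF f] by simp
    also have "\<dots> = (\<Sum>y\<in>F - {0}. T (fscale (f y) (m.del y)))"
      by (rule linear_between_sum[OF Tl m.rho_subspace])
         (use m.del_space cfun.subspace_scale[OF m.rho_subspace] in blast)
    also have "\<dots> = (\<Sum>y\<in>F - {0}. fscale c (fscale (f y) (m.del y)))"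
    proof (rule sum.cong)
      fix y assume y: "y \<in> F - {0}"
      show "T (fscale (f y) (m.del y)) = fscale c (fscale (f y) (m.del y))"
        unfolding linear_betweenD(3)[OF Tl m.del_space[OF y]] Td[OF y] by (auto simp: fun_eq_iff)
    qed simp
    also have "\<dots> = fscale c f"
      unfolding cfun.scale_sum_right[symmetric] using m.rho_expand[OF f] by simp
    finally show ?thesis .
  qed
  have c: "c \<noteq> 0"
  proof
    assume "c = 0"
    then have "T (m.del 1) = T 0"
      using T1 linear_between_0[OF Tl m.rho_subspace] by (auto simp: fun_eq_iff)
    then have "m.del 1 = 0"
      using b m.del_space[OF one] cfun.subspace_0[OF m.rho_subspace] unfolding bij_betw_def
      by (metis inj_onD)
    then have "m.del 1 1 = 0" by simp
    then show False by (simp add: m.del_def)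
  qed
  have kereq: "m.ker (A $ 1 $ 1) (A $ 1 $ 2) (A $ 2 $ 1) (A $ 2 $ 2) y x = m'.ker (A $ 1 $ 1) (A $ 1 $ 2) (A $ 2 $ 1) (A $ 2 $ 2) y x"
    if A: "A \<in> carrier (GL2 F)" and x: "x \<in> F - {0}" and y: "y \<in> F - {0}" for A x y
  proof -
    have d: "(\<Sum>z\<in>F - {0}. k z * m.del x z) = k x" for k :: "'a \<Rightarrow> complex"
    proof -
      have "(\<Sum>z\<in>F - {0}. k z * m.del x z) = (\<Sum>z\<in>F - {0}. if z = x then k z else 0)"
        by (rule sum.cong) (auto simp: m.del_def)
      then show ?thesis using x by simp
    qed
    have "fscale c (rep_act m.\<rho> A (m.del x)) = rep_act m'.\<rho> A (fscale c (m.del x))"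
      using intertwinerD(3)[OF T A m.del_space[OF x]] Tf[OF is_repD(5)[OF m.rho_is_rep A m.del_space[OF x]]]
        Td[OF x] by simp
    also have "\<dots> = fscale c (rep_act m'.\<rho> A (m.del x))"
      using linear_betweenD(3)[OF is_repD(2)[OF m'.rho_is_rep A]] m.del_space[OF x] space by simp
    finally have "rep_act m.\<rho> A (m.del x) y = rep_act m'.\<rho> A (m.del x) y"
      using c by (metis cfun.scale_left_imp_eq)
    then show ?thesis using y by (simp add: m.rho_act[OF A] m'.rho_act[OF A] d)
  qed
  have treq: "m.trace a b g d = m'.trace a b g d"
    if "a \<in> F" "b \<in> F" "g \<in> F" "d \<in> F" "a * d - b * g \<noteq> 0" for a b g d
  proof -
    have A: "mat2 a b g d \<in> carrier (GL2 F)" using that by (simp add: carrier_GL2 det_2)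
    show ?thesis
      unfolding m.trace_def m'.trace_def using kereq[OF A] by (intro sum.cong) auto
  qed
  have scal: "\<mu> a = \<mu>' a" if a: "a \<in> F - {0}" for a
    using treq[of a 0 0 a] a m.F.two_le_card m.trace_scalar[OF a] m'.trace_scalar[OF a] by auto
  have sum_eq: "\<mu> z + \<mu> (m.cj z) = \<mu>' z + \<mu>' (m.cj z)" if z: "z \<in> L - {0}" for z
  proof (cases "z \<in> F")
    case True
    then show ?thesis using scal[of z] z by simp
  next
    case False
    then have ne: "z \<noteq> m.cj z" using m.cj_fixed_iff by metis
    have one: "1 \<in> F - {0}" by simp
    have Nz: "- m.Nm z \<in> F" "m.Tr z \<in> F" "m.Nm z \<noteq> 0" using z by auto
    \<comment> \<open>A companion matrix of the minimal polynomial of z over \<open>F\<close>, with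
      eigenvalues z and its conjugate.\<close>
    have "m.trace 0 (- m.Nm z) 1 (m.Tr z) = m'.trace 0 (- m.Nm z) 1 (m.Tr z)"
      by (rule treq) (use Nz in auto)
    moreover have "m.trace 0 (- m.Nm z) 1 (m.Tr z) = - (\<Sum>v\<in>{z, m.cj z}. \<mu> v)"
      by (rule m.trace_big_eigenvalue[OF _ Nz(1) one Nz(2) z]) auto
    moreover have "m'.trace 0 (- m.Nm z) 1 (m.Tr z) = - (\<Sum>v\<in>{z, m.cj z}. \<mu>' v)"
      by (rule m'.trace_big_eigenvalue[OF _ Nz(1) one Nz(2) z]) auto
    ultimately have "(\<Sum>v\<in>{z, m.cj z}. \<mu> v) = (\<Sum>v\<in>{z, m.cj z}. \<mu>' v)"
      by (metis neg_equal_iff_equal)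
    then show ?thesis using ne by simp
  qed
  show ?thesis
  proof (rule ccontr)
    assume n: "\<not> (\<mu>' = \<mu> \<or> \<mu>' = conj_char F \<mu>)"
    have nz: "\<mu>' z \<noteq> 0" if "z \<in> L - {0}" for z using mult_char_nonzero[OF m'.mult_char that] .
    \<comment> \<open>The identity of sums is divided by \<mu>' and summed over all units. Three of
      the four sums vanish by orthogonality and the last one counts the units.\<close>
    have "(\<Sum>z\<in>L - {0}. \<mu> z / \<mu>' z) + (\<Sum>z\<in>L - {0}. conj_char F \<mu> z / \<mu>' z) =
        (\<Sum>z\<in>L - {0}. 1 + conj_char F \<mu>' z / \<mu>' z)"
      unfolding sum.distrib[symmetric]
    proof (rule sum.cong)
      fix z assume z: "z \<in> L - {0}"
      have "\<mu> z / \<mu>' z + conj_char F \<mu> z / \<mu>' z = (\<mu>' z + conj_char F \<mu>' z) / \<mu>' z"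
        using sum_eq[OF z] by (simp add: conj_char_def flip: add_divide_distrib)
      then show "\<mu> z / \<mu>' z + conj_char F \<mu> z / \<mu>' z = 1 + conj_char F \<mu>' z / \<mu>' z"
        using nz[OF z] by (simp add: add_divide_distrib)
    qed simp
    moreover have "(\<Sum>z\<in>L - {0}. \<mu> z / \<mu>' z) = 0"
      by (rule m.L.mult_char_orthogonal[OF m.mult_char m'.mult_char]) (use n in auto)
    moreover have "(\<Sum>z\<in>L - {0}. conj_char F \<mu> z / \<mu>' z) = 0"
      by (rule m.L.mult_char_orthogonal[OF m.conj_char_mem[OF m.mult_char] m'.mult_char]) (use n in auto)
    moreover have "(\<Sum>z\<in>L - {0}. conj_char F \<mu>' z / \<mu>' z) = 0"
      by (rule m.L.mult_char_orthogonal[OF m.conj_char_mem[OF m'.mult_char] m'.mult_char])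
         (rule m.conj_char_neq[OF m'.mult_char m'.indec])
    ultimately have "of_nat (card (L - {0})) = (0 :: complex)" by (simp add: sum.distrib)
    then show False using m.L.two_le_card by (simp add: m.L.card_units)
  qed
qed

section \<open>Induced representations\<close>

locale induction_data =
  fixes G :: "'g monoid" and K :: "'g set" and \<theta> :: "('g, 'x) rep"
  assumes group: "group G" and finite_G: "finite (carrier G)" and K: "subgroup K G"
    and \<theta>: "is_rep (G\<lparr>carrier := K\<rparr>) \<theta>"
begin

interpretation group G by (rule group)

lemma K_sub: "k \<in> K \<Longrightarrow> k \<in> carrier G"
  using subgroup.subset[OF K] by blast

lemma K_inv: "k \<in> K \<Longrightarrow> inv\<^bsub>G\<^esub> k \<in> K"
  using subgroup.m_inv_closed[OF K] .

lemma theta_subspace: "cfun.subspace (rep_space \<theta>)"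
  by (rule is_repD(1)[OF \<theta>])

lemma theta_linear: "k \<in> K \<Longrightarrow> linear_between (rep_space \<theta>) (rep_space \<theta>) (rep_act \<theta> k)"
  using is_repD(2)[OF \<theta>] by simp

lemma induced_mem: "f \<in> rep_space (induced G K \<theta>) \<longleftrightarrow>
    (\<forall>g\<in>carrier G. curry f g \<in> rep_space \<theta>) \<and>
    (\<forall>g\<in>carrier G. \<forall>k\<in>K. curry f (g \<otimes>\<^bsub>G\<^esub> k) = rep_act \<theta> (inv\<^bsub>G\<^esub> k) (curry f g)) \<and>
    (\<forall>g. g \<notin> carrier G \<longrightarrow> curry f g = 0)"
  by (simp add: induced_def)

lemma induced_act: "curry (rep_act (induced G K \<theta>) g f) g' =
    (if g' \<in> carrier G then curry f (inv\<^bsub>G\<^esub> g \<otimes>\<^bsub>G\<^esub> g') else 0)"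
  by (auto simp: induced_def fun_eq_iff)

lemma induced_is_rep: "is_rep G (induced G K \<theta>)"
proof -
  have curry_simps: "curry (f + g) i = curry f i + curry g i" "curry (fscale c f) i = fscale c (curry f i)"
    "curry 0 i = 0" for f g :: "'g \<times> 'x \<Rightarrow> complex" and c i
    by (auto simp: fun_eq_iff)
  have eqI: "f = g" if "\<And>i. curry f i = curry g i" for f g :: "'g \<times> 'x \<Rightarrow> complex"
    using that by (metis case_prod_curry ext)
  note lin = linear_betweenD[OF theta_linear[OF K_inv]] linear_between_0[OF theta_linear[OF K_inv] theta_subspace]
  show ?thesis
    unfolding is_rep_def
  proof (intro conjI ballI)
    show "cfun.subspace (rep_space (induced G K \<theta>))"
    proof (rule cfun.subspaceI)
      show "0 \<in> rep_space (induced G K \<theta>)"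
        unfolding induced_mem curry_simps using cfun.subspace_0[OF theta_subspace] lin(4) by simp
      show "f + g \<in> rep_space (induced G K \<theta>)"
        if "f \<in> rep_space (induced G K \<theta>)" "g \<in> rep_space (induced G K \<theta>)" for f g
        using that unfolding induced_mem curry_simps
        by (simp add: cfun.subspace_add[OF theta_subspace] lin(2) del: curry_conv plus_fun_apply)
      show "fscale c f \<in> rep_space (induced G K \<theta>)" if "f \<in> rep_space (induced G K \<theta>)" for c f
        using that unfolding induced_mem curry_simps
        by (simp add: cfun.subspace_scale[OF theta_subspace] lin(3) del: curry_conv fscale_apply)
    qed
    show "linear_between (rep_space (induced G K \<theta>)) (rep_space (induced G K \<theta>)) (rep_act (induced G K \<theta>) g)"
      if g: "g \<in> carrier G" for g
    proof (rule linear_betweenI)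
      show "rep_act (induced G K \<theta>) g f \<in> rep_space (induced G K \<theta>)" if f: "f \<in> rep_space (induced G K \<theta>)" for f
        using f g K_sub unfolding induced_mem induced_act by (simp add: m_assoc[symmetric] del: curry_conv)
    qed (auto intro!: eqI simp: induced_act curry_simps simp del: curry_conv plus_fun_apply fscale_apply)
    show "rep_act (induced G K \<theta>) \<one>\<^bsub>G\<^esub> f = f" if "f \<in> rep_space (induced G K \<theta>)" for f
      by (rule eqI) (use that in \<open>simp add: induced_act induced_mem del: curry_conv\<close>)
    show "rep_act (induced G K \<theta>) (g \<otimes>\<^bsub>G\<^esub> h) f = rep_act (induced G K \<theta>) g (rep_act (induced G K \<theta>) h f)"
      if "g \<in> carrier G" "h \<in> carrier G" for g h f
      by (rule eqI) (use that in \<open>simp add: induced_act inv_mult_group m_assoc del: curry_conv\<close>)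
  qed
qed

lemma coset_representatives:
  obtains R where "R \<subseteq> carrier G" "card R * card K \<le> card (carrier G)"
    "\<forall>g\<in>carrier G. \<exists>r\<in>R. \<exists>k\<in>K. g = r \<otimes>\<^bsub>G\<^esub> k"
proof
  define c where "c C = (SOME x. x \<in> C)" for C :: "'g set"
  \<comment> \<open>Inverses of representatives of right cosets represent the left cosets, along
    which induced functions transform.\<close>
  define R where "R = (\<lambda>C. inv\<^bsub>G\<^esub> (c C)) ` (rcosets\<^bsub>G\<^esub> K)"
  have c: "c C \<in> C" if "C \<in> rcosets\<^bsub>G\<^esub> K" for C
    using subgroup.rcosets_non_empty[OF K that] unfolding c_def by (simp add: some_in_eq)
  have C_sub: "C \<subseteq> carrier G" if "C \<in> rcosets\<^bsub>G\<^esub> K" for C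
    using subgroup.rcosets_carrier[OF K group that] .
  show "R \<subseteq> carrier G" using c C_sub by (auto simp: R_def)
  have fin: "finite (rcosets\<^bsub>G\<^esub> K)" using finite_G by (simp add: RCOSETS_def)
  have "card R \<le> card (rcosets\<^bsub>G\<^esub> K)" unfolding R_def by (rule card_image_le[OF fin])
  then have "card R * card K \<le> card (rcosets\<^bsub>G\<^esub> K) * card K" by simp
  also have "\<dots> = card (carrier G)" using lagrange[OF K] by (simp add: order_def)
  finally show "card R * card K \<le> card (carrier G)" .
  show "\<forall>g\<in>carrier G. \<exists>r\<in>R. \<exists>k\<in>K. g = r \<otimes>\<^bsub>G\<^esub> k"
  proof
    fix g assume g: "g \<in> carrier G"
    let ?C = "K #>\<^bsub>G\<^esub> inv\<^bsub>G\<^esub> g"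
    have C: "?C \<in> rcosets\<^bsub>G\<^esub> K" using g by (auto simp: RCOSETS_def)
    then obtain k where k: "k \<in> K" "c ?C = k \<otimes>\<^bsub>G\<^esub> inv\<^bsub>G\<^esub> g" using c by (auto simp: r_coset_def)
    have "inv\<^bsub>G\<^esub> (c ?C) \<otimes>\<^bsub>G\<^esub> k = g"
      using k g K_sub by (simp add: inv_mult_group m_assoc)
    moreover have "inv\<^bsub>G\<^esub> (c ?C) \<in> R" using C by (simp add: R_def)
    ultimately show "\<exists>r\<in>R. \<exists>k\<in>K. g = r \<otimes>\<^bsub>G\<^esub> k" using k by metis
  qed
qed

text \<open>Covariance under \<open>K\<close> reduces a function to its values at coset
  representatives, and there to the points of \<open>E\<close>. Their number is the upper bound for
  the dimension of the induced space.\<close>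

lemma induced_determining_set:
  assumes E: "finite E" "\<And>f. f \<in> rep_space \<theta> \<Longrightarrow> \<forall>e\<in>E. f e = 0 \<Longrightarrow> f = 0"
  obtains D where "finite D" "card D * card K \<le> card (carrier G) * card E"
    "\<And>f. f \<in> rep_space (induced G K \<theta>) \<Longrightarrow> \<forall>d\<in>D. f d = 0 \<Longrightarrow> f = 0"
proof -
  obtain R where R: "R \<subseteq> carrier G" "card R * card K \<le> card (carrier G)"
    and cov: "\<forall>g\<in>carrier G. \<exists>r\<in>R. \<exists>k\<in>K. g = r \<otimes>\<^bsub>G\<^esub> k"
    by (rule coset_representatives)
  have finR: "finite R" using R(1) finite_G finite_subset by blast
  show ?thesis
  proof (rule that[of "R \<times> E"])
    show "finite (R \<times> E)" using finR E(1) by simp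
    show "card (R \<times> E) * card K \<le> card (carrier G) * card E"
      using mult_le_mono1[OF R(2), of "card E"] by (simp add: card_cartesian_product mult_ac)
    fix f assume f: "f \<in> rep_space (induced G K \<theta>)" and z: "\<forall>d\<in>R \<times> E. f d = 0"
    have r0: "curry f r = 0" if "r \<in> R" for r
      by (rule E(2)) (use f z that R in \<open>auto simp: induced_mem\<close>)
    have "curry f g = 0" for g
    proof (cases "g \<in> carrier G")
      case True
      then obtain r k where rk: "r \<in> R" "k \<in> K" "g = r \<otimes>\<^bsub>G\<^esub> k" using cov by blast
      then have "curry f g = rep_act \<theta> (inv\<^bsub>G\<^esub> k) (curry f r)"
        using f R by (auto simp: induced_mem simp del: curry_conv)
      then show ?thesis
        using r0[OF rk(1)] linear_between_0[OF theta_linear[OF K_inv[OF rk(2)]] theta_subspace] by simp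
    qed (use f in \<open>auto simp: induced_mem simp del: curry_conv\<close>)
    then have "f (g, x) = 0" for g x by (metis curry_conv zero_fun_apply)
    then show "f = 0" by (auto simp: fun_eq_iff)
  qed
qed

text \<open>The map sends v to the function g -> S (\<pi>(g^-1) v). Its value at the identity is
  \<open>S v\<close>, which keeps it nonzero.\<close>

lemma frobenius:
  assumes \<pi>: "is_rep G \<pi>" and S: "intertwiner (G\<lparr>carrier := K\<rparr>) \<pi> \<theta> S"
    and v0: "v0 \<in> rep_space \<pi>" "S v0 \<noteq> 0"
  shows "\<exists>T. intertwiner G \<pi> (induced G K \<theta>) T \<and> (\<exists>v\<in>rep_space \<pi>. T v \<noteq> 0)"
proof -
  define T where "T v = (\<lambda>(g, x). if g \<in> carrier G then S (rep_act \<pi> (inv\<^bsub>G\<^esub> g) v) x else 0)" for v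
  have cT: "curry (T v) g = (if g \<in> carrier G then S (rep_act \<pi> (inv\<^bsub>G\<^esub> g) v) else 0)" for v g
    by (auto simp: T_def fun_eq_iff)
  have curry_simps: "curry (f + g) i = curry f i + curry g i" "curry (fscale c f) i = fscale c (curry f i)"
    for f g :: "'g \<times> 'x \<Rightarrow> complex" and c i
    by (auto simp: fun_eq_iff)
  have eqI: "f = g" if "\<And>i. curry f i = curry g i" for f g :: "'g \<times> 'x \<Rightarrow> complex"
    using that by (metis case_prod_curry ext)
  note Sl = linear_betweenD[OF intertwinerD(1)[OF S]]
  note \<pi>l = linear_betweenD[OF is_repD(2)[OF \<pi>]]
  have "intertwiner G \<pi> (induced G K \<theta>) T"
    unfolding intertwiner_def
  proof (intro conjI ballI linear_betweenI)
    show "T v \<in> rep_space (induced G K \<theta>)" if v: "v \<in> rep_space \<pi>" for v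
      unfolding induced_mem
    proof (intro conjI ballI allI impI)
      show "curry (T v) g \<in> rep_space \<theta>" if "g \<in> carrier G" for g
        using that v Sl(1) \<pi>l(1) by (simp add: cT)
      show "curry (T v) (g \<otimes>\<^bsub>G\<^esub> k) = rep_act \<theta> (inv\<^bsub>G\<^esub> k) (curry (T v) g)"
        if g: "g \<in> carrier G" and k: "k \<in> K" for g k
      proof -
        have kG: "k \<in> carrier G" by (rule K_sub[OF k])
        have "rep_act \<pi> (inv\<^bsub>G\<^esub> (g \<otimes>\<^bsub>G\<^esub> k)) v = rep_act \<pi> (inv\<^bsub>G\<^esub> k) (rep_act \<pi> (inv\<^bsub>G\<^esub> g) v)"
          using g kG v is_repD(4)[OF \<pi>, of "inv\<^bsub>G\<^esub> k" "inv\<^bsub>G\<^esub> g" v] by (simp add: inv_mult_group)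
        then have "curry (T v) (g \<otimes>\<^bsub>G\<^esub> k) = S (rep_act \<pi> (inv\<^bsub>G\<^esub> k) (rep_act \<pi> (inv\<^bsub>G\<^esub> g) v))"
          using g kG by (simp add: cT del: curry_conv)
        also have "\<dots> = rep_act \<theta> (inv\<^bsub>G\<^esub> k) (S (rep_act \<pi> (inv\<^bsub>G\<^esub> g) v))"
          using intertwinerD(3)[OF S] K_inv[OF k] is_repD(5)[OF \<pi>, of "inv\<^bsub>G\<^esub> g" v] g v by simp
        finally show ?thesis using g by (simp add: cT del: curry_conv)
      qed
    qed (simp add: cT)
    show "T (u + v) = T u + T v" if "u \<in> rep_space \<pi>" "v \<in> rep_space \<pi>" for u v
      by (rule eqI) (use that in \<open>simp add: cT curry_simps \<pi>l(1,2) Sl(2) del: curry_conv plus_fun_apply\<close>)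
    show "T (fscale c v) = fscale c (T v)" if "v \<in> rep_space \<pi>" for c v
      by (rule eqI) (use that in \<open>simp add: cT curry_simps \<pi>l(1,3) Sl(3) del: curry_conv fscale_apply\<close>)
    show "T (rep_act \<pi> h v) = rep_act (induced G K \<theta>) h (T v)" if h: "h \<in> carrier G" and v: "v \<in> rep_space \<pi>" for h v
    proof (rule eqI)
      fix g
      show "curry (T (rep_act \<pi> h v)) g = curry (rep_act (induced G K \<theta>) h (T v)) g"
      proof (cases "g \<in> carrier G")
        case True
        have "inv\<^bsub>G\<^esub> (inv\<^bsub>G\<^esub> h \<otimes>\<^bsub>G\<^esub> g) = inv\<^bsub>G\<^esub> g \<otimes>\<^bsub>G\<^esub> h"
          using True h by (simp add: inv_mult_group)
        then show ?thesis
          using True h v is_repD(4)[OF \<pi>, of "inv\<^bsub>G\<^esub> g" h v] unfolding induced_act cT by simp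
      qed (simp add: induced_act cT del: curry_conv)
    qed
  qed
  moreover have "curry (T v0) \<one>\<^bsub>G\<^esub> \<noteq> 0"
    using v0 is_repD(3)[OF \<pi>] by (simp add: cT del: curry_conv)
  then have "T v0 \<noteq> 0" by (auto simp: fun_eq_iff)
  ultimately show ?thesis using v0 by blast
qed

end

section \<open>Parabolic representations\<close>

locale parabolic = subfield F for F :: "'a::{field,finite} set" +
  fixes \<xi>1 \<xi>2 :: "'a \<Rightarrow> complex"
  assumes \<xi>1: "\<xi>1 \<in> mult_chars F" and \<xi>2: "\<xi>2 \<in> mult_chars F"
begin

abbreviation "\<tau> \<equiv> parabolic_rep F \<xi>1 \<xi>2"
abbreviation "GL \<equiv> carrier (GL2 F)"
abbreviation "UT \<equiv> upper_triangular F"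

definition chi :: "'a^2^2 \<Rightarrow> complex"
  where "chi B = \<xi>1 (B $ 1 $ 1) * \<xi>2 (B $ 2 $ 2)"

lemma UT_iff: "B \<in> UT \<longleftrightarrow> B $ 1 $ 1 \<in> F - {0} \<and> B $ 1 $ 2 \<in> F \<and> B $ 2 $ 1 = 0 \<and> B $ 2 $ 2 \<in> F - {0}"
  by (auto simp: upper_triangular_def carrier_GL2 det_2)

lemma UT_GL: "B \<in> UT \<Longrightarrow> B \<in> GL"
  by (simp add: upper_triangular_def)

lemma chi_nonzero: "B \<in> UT \<Longrightarrow> chi B \<noteq> 0"
  using mult_char_nonzero[OF \<xi>1] mult_char_nonzero[OF \<xi>2] by (auto simp: chi_def UT_iff)

lemma UT_mult: "A \<in> UT \<Longrightarrow> B \<in> UT \<Longrightarrow> A ** B \<in> UT"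
  by (auto simp: UT_iff matrix_mult_nth_2)

lemma chi_mult: "A \<in> UT \<Longrightarrow> B \<in> UT \<Longrightarrow> chi (A ** B) = chi A * chi B"
  using mult_char_mult[OF \<xi>1] mult_char_mult[OF \<xi>2] by (auto simp: chi_def UT_iff matrix_mult_nth_2)

lemma UT_one: "mat 1 \<in> UT" and chi_one: "chi (mat 1) = 1"
  using \<xi>1 \<xi>2 by (auto simp: UT_iff chi_def mat_1_nth_2 mult_char_1)

lemma UT_adj2: "B \<in> UT \<Longrightarrow> adj2 B \<in> UT"
  by (auto simp: UT_iff adj2_def det_2)

lemma adj2_cancel:
  assumes "A \<in> GL"
  shows "adj2 A ** A = mat 1" "A ** adj2 A = mat 1" "adj2 A ** (A ** B) = B" "A ** (adj2 A ** B) = B"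
    "(B ** A) ** adj2 A = B" "(B ** adj2 A) ** A = B" "adj2 (adj2 A) = A"
proof -
  interpret G: group "GL2 F" by (rule group_GL2)
  have i: "inv\<^bsub>GL2 F\<^esub> A = adj2 A" by (rule inv_GL2[OF assms])
  show 1: "adj2 A ** A = mat 1" "A ** adj2 A = mat 1"
    using G.l_inv[OF assms] G.r_inv[OF assms] i by simp_all
  then show "adj2 A ** (A ** B) = B" "A ** (adj2 A ** B) = B"
    by (simp_all add: matrix_mul_assoc)
  show "(B ** A) ** adj2 A = B" "(B ** adj2 A) ** A = B"
    using 1 by (simp_all flip: matrix_mul_assoc)
  show "adj2 (adj2 A) = A"
    using G.inv_inv[OF assms] i inv_GL2[OF adj2_closed[OF assms]] by simp
qed

lemma chi_adj2: "B \<in> UT \<Longrightarrow> chi (adj2 B) = 1 / chi B"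
  using chi_mult[OF UT_adj2, of B B] chi_one chi_nonzero[of B] adj2_cancel(1)[OF UT_GL]
  by (auto simp: field_simps)

lemma subgroup_UT: "subgroup UT (GL2 F)"
proof (rule group.subgroupI[OF group_GL2])
  show "inv\<^bsub>GL2 F\<^esub> B \<in> UT" if "B \<in> UT" for B
    using inv_GL2[OF UT_GL[OF that]] UT_adj2[OF that] by simp
qed (use UT_GL UT_one UT_mult in auto)

sublocale ind: induction_data "GL2 F" UT
  "\<lparr>rep_space = UNIV, rep_act = (\<lambda>A. fscale (\<xi>1 (A $ 1 $ 1) * \<xi>2 (A $ 2 $ 2)))\<rparr> :: ('a^2^2, unit) rep"
proof (rule induction_data.intro)
  show "is_rep (GL2 F\<lparr>carrier := UT\<rparr>)
      (\<lparr>rep_space = UNIV, rep_act = (\<lambda>A. fscale (\<xi>1 (A $ 1 $ 1) * \<xi>2 (A $ 2 $ 2)))\<rparr> :: ('a^2^2, unit) rep)"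
    unfolding is_rep_def linear_between_def chi_def[symmetric]
    by (auto simp: fun_eq_iff chi_one chi_mult algebra_simps)
qed (simp_all add: group_GL2 subgroup_UT)

lemma tau_is_rep: "is_rep (GL2 F) \<tau>"
  unfolding parabolic_rep_def by (rule ind.induced_is_rep)

lemma tau_subspace: "cfun.subspace (rep_space \<tau>)"
  by (rule is_repD(1)[OF tau_is_rep])

lemma tau_mem: "f \<in> rep_space \<tau> \<longleftrightarrow>
    (\<forall>A\<in>GL. \<forall>B\<in>UT. f (A ** B, ()) = f (A, ()) / chi B) \<and> (\<forall>A. A \<notin> GL \<longrightarrow> f (A, ()) = 0)"
proof -
  have 1: "inv\<^bsub>GL2 F\<^esub> B = adj2 B" "\<xi>1 (adj2 B $ 1 $ 1) * \<xi>2 (adj2 B $ 2 $ 2) = 1 / chi B" if "B \<in> UT" for B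
    using inv_GL2[OF UT_GL[OF that]] chi_adj2[OF that] by (simp_all add: chi_def)
  show ?thesis
    unfolding parabolic_rep_def ind.induced_mem by (auto simp: fun_eq_iff 1)
qed

lemma tau_act: "A \<in> GL \<Longrightarrow> rep_act \<tau> A f (B, ()) = (if B \<in> GL then f (adj2 A ** B, ()) else 0)"
  by (simp add: parabolic_rep_def induced_def inv_GL2)

lemma tau_eqI: "(\<And>A. f (A, ()) = g (A, ())) \<Longrightarrow> f = g" for f g :: "('a^2^2) \<times> unit \<Rightarrow> complex"
  by (auto simp: fun_eq_iff)

text \<open>The function supported on the coset \<open>g UT\<close> with value 1 at
  \<open>g\<close>. For the identity it is the vector on which \<open>UT\<close> acts through
  \<open>chi\<close>.\<close>

definition phi :: "'a^2^2 \<Rightarrow> ('a^2^2) \<times> unit \<Rightarrow> complex"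
  where "phi g = (\<lambda>(A, _). if A \<in> GL \<and> adj2 g ** A \<in> UT then 1 / chi (adj2 g ** A) else 0)"

lemma UT_mult_iff: "A \<in> GL \<Longrightarrow> B \<in> UT \<Longrightarrow> A ** B \<in> UT \<longleftrightarrow> A \<in> UT"
  using UT_mult[of A B] UT_mult[of "A ** B" "adj2 B"] UT_adj2 adj2_cancel(5)[OF UT_GL] by metis

lemma phi_space:
  assumes "g \<in> GL"
  shows "phi g \<in> rep_space \<tau>"
  unfolding tau_mem
proof (intro conjI ballI allI impI)
  fix A B assume AB: "A \<in> GL" "B \<in> UT"
  have "adj2 g ** A \<in> GL" using adj2_closed[OF assms] AB mult_closed_GL2 by blast
  then show "phi g (A ** B, ()) = phi g (A, ()) / chi B"
    using AB mult_closed_GL2[OF AB(1) UT_GL[OF AB(2)]]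
    by (simp add: phi_def matrix_mul_assoc UT_mult_iff chi_mult)
qed (simp add: phi_def)

lemma phi_self: "g \<in> GL \<Longrightarrow> phi g (g, ()) = 1"
  by (simp add: phi_def adj2_cancel UT_one chi_one)

lemma tau_dim: "dim_at_least (rep_space \<tau>) (card F + 1)"
proof -
  \<comment> \<open>One matrix for each of the \<open>card F + 1\<close> points of the projective
    line: the first columns are (1, 0) and (x, 1).\<close>
  define E where "E = (\<lambda>g. (g, ())) ` insert (mat 1) ((\<lambda>x. mat2 x 1 1 0) ` F)"
  have c: "card E = card F + 1"
  proof -
    have "inj_on (\<lambda>x. mat2 x 1 1 0 :: 'a^2^2) F" by (rule inj_onI) (simp add: mat2_eq_iff)
    moreover have "mat 1 \<notin> (\<lambda>x. mat2 x 1 1 0 :: 'a^2^2) ` F" by (auto simp: mat2_eq_iff mat_1_nth_2)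
    ultimately show ?thesis
      unfolding E_def by (subst card_image) (auto simp: inj_on_def card_image)
  qed
  have E: "fst e \<in> GL" if "e \<in> E" for e
    using that by (auto simp: E_def carrier_GL2 det_2 mat_1_nth_2)
  have one: "adj2 (mat 1) = (mat 1 :: 'a^2^2)"
    using adj2_cancel(2)[OF UT_GL[OF UT_one]] by simp
  have low: "(adj2 g ** h) $ 2 $ 1 \<noteq> 0" if "(g, ()) \<in> E" "(h, ()) \<in> E" "g \<noteq> h" for g h
    using that by (auto simp: E_def matrix_mult_nth_2 adj2_def det_2 mat_1_nth_2)
  have "dim_at_least (rep_space \<tau>) (card E)"
  proof (rule dim_at_least_dual[where v = "\<lambda>e. phi (fst e)"])
    show "finite E" by (simp add: E_def)
    show "phi (fst e) \<in> rep_space \<tau>" if "e \<in> E" for e by (rule phi_space[OF E[OF that]])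
    show "phi (fst e) e' = (if e = e' then 1 else 0)" if "e \<in> E" "e' \<in> E" for e e'
    proof (cases "e = e'")
      case True
      then show ?thesis using phi_self[OF E[OF that(1)]] by (cases e') auto
    next
      case False
      then show ?thesis using low[of "fst e" "fst e'"] that by (cases e; cases e') (auto simp: phi_def UT_iff)
    qed
  qed
  then show ?thesis by (simp add: c)
qed

lemma phi_one: "phi (mat 1) (A, ()) = (if A \<in> UT then 1 / chi A else 0)"
proof -
  have "adj2 (mat 1) = (mat 1 :: 'a^2^2)"
    using adj2_cancel(2)[OF UT_GL[OF UT_one]] by simp
  then show ?thesis using UT_GL[of A] by (auto simp: phi_def)
qed

lemma phi_one_eigen:
  assumes B: "B \<in> UT"
  shows "rep_act \<tau> B (phi (mat 1)) = fscale (chi B) (phi (mat 1))"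
proof (rule tau_eqI)
  fix A
  have iff: "adj2 B ** A \<in> UT \<longleftrightarrow> A \<in> UT"
    using UT_mult[OF B, of "adj2 B ** A"] UT_mult[OF UT_adj2[OF B], of A] adj2_cancel(4)[OF UT_GL[OF B]] by metis
  show "rep_act \<tau> B (phi (mat 1)) (A, ()) = fscale (chi B) (phi (mat 1)) (A, ())"
    using iff B UT_GL[of A] chi_nonzero[OF B]
    by (auto simp: tau_act[OF UT_GL[OF B]] phi_one chi_mult UT_adj2 chi_adj2)
qed

end

text \<open>If \<open>A\<close> is not upper triangular, the torus fixing the lines of \<open>e\<^sub>1\<close> and \<open>A e\<^sub>1\<close> acts on
  \<open>h A\<close> in two ways.\<close>

lemma eigenfunction_big_cell:
  assumes p: "parabolic F \<xi>1 \<xi>2" and p': "parabolic F \<xi>1' \<xi>2'"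
    and h: "h \<in> rep_space (parabolic_rep F \<xi>1' \<xi>2')"
    and eig: "\<And>B. B \<in> upper_triangular F \<Longrightarrow>
      rep_act (parabolic_rep F \<xi>1' \<xi>2') B h = fscale (parabolic.chi \<xi>1 \<xi>2 B) h"
    and A: "A \<in> carrier (GL2 F)" "A \<notin> upper_triangular F" and nz: "h (A, ()) \<noteq> 0"
  shows "\<xi>1 = \<xi>2' \<and> \<xi>2 = \<xi>1'"
proof -
  interpret p: parabolic F \<xi>1 \<xi>2 by fact
  interpret p': parabolic F \<xi>1' \<xi>2' by fact
  have c: "A $ 2 $ 1 \<noteq> 0" and AF: "A $ 1 $ 1 \<in> F" "A $ 1 $ 2 \<in> F" "A $ 2 $ 1 \<in> F" "A $ 2 $ 2 \<in> F"
    using A by (auto simp: upper_triangular_def carrier_GL2)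
  have key: "\<xi>1 t * \<xi>2 u = \<xi>1' u * \<xi>2' t" if tu: "t \<in> F - {0}" "u \<in> F - {0}" for t u
  proof -
    \<comment> \<open>\<open>B\<close> has the eigenvectors e1 and A e1 with eigenvalues t and u.
      Conjugation by \<open>A\<close> turns it into \<open>B'\<close>, again triangular but with the
      diagonal reversed.\<close>
    define B where "B = mat2 t ((u - t) * A $ 1 $ 1 / A $ 2 $ 1) 0 u"
    define B' where "B' = mat2 u ((u - t) * A $ 2 $ 2 / A $ 2 $ 1) 0 t"
    have BU: "B \<in> upper_triangular F" "B' \<in> upper_triangular F"
      using tu AF by (auto simp: B_def B'_def p.UT_iff)
    have BA: "B ** A = A ** B'"
      using c by (simp add: mat2_eq_iff matrix_mult_nth_2 B_def B'_def) (simp add: field_simps)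
    have BAG: "B ** A \<in> carrier (GL2 F)" by (rule p.mult_closed_GL2[OF p.UT_GL[OF BU(1)] A(1)])
    have "h (A, ()) = p.chi B * h (B ** A, ())"
      using fun_cong[OF eig[OF BU(1)], of "(B ** A, ())"] BAG
      by (simp add: p'.tau_act[OF p.UT_GL[OF BU(1)]] p.adj2_cancel(3)[OF p.UT_GL[OF BU(1)]])
    also have "h (B ** A, ()) = h (A, ()) / p'.chi B'"
      unfolding BA using h A(1) BU(2) by (simp add: p'.tau_mem)
    finally have "p.chi B = p'.chi B'"
      using nz p'.chi_nonzero[OF BU(2)] by (simp add: field_simps)
    then show ?thesis by (simp add: p.chi_def p'.chi_def B_def B'_def)
  qed
  have one: "1 \<in> F - {0}" by simp
  have "\<xi>1 t = \<xi>2' t" "\<xi>2 t = \<xi>1' t" if "t \<in> F - {0}" for t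
    using key[OF that one] key[OF one that] p.mult_char_1[OF p.\<xi>1] p.mult_char_1[OF p.\<xi>2]
      p.mult_char_1[OF p'.\<xi>1] p.mult_char_1[OF p'.\<xi>2] by simp_all
  then show ?thesis
    using mult_char_eqI[OF p.\<xi>1 p'.\<xi>2] mult_char_eqI[OF p.\<xi>2 p'.\<xi>1] by blast
qed

context parabolic
begin

text \<open>Averaging a vector of an invariant subspace over \<open>UT\<close> against
  \<open>chi\<close> gives a \<open>chi\<close>-eigenvector. As \<xi>1 \<noteq> \<xi>2, it vanishes
  off \<open>UT\<close>, so it is a multiple of \<open>phi (mat 1)\<close>, whose translates span
  everything.\<close>

lemma tau_irreducible:
  assumes ne: "\<xi>1 \<noteq> \<xi>2"
  shows "irreducible_rep (GL2 F) \<tau>"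
proof (rule irreducible_repI[OF tau_is_rep phi_space[OF UT_GL[OF UT_one]]])
  have one: "mat 1 \<in> GL" by (rule UT_GL[OF UT_one])
  show "phi (mat 1) \<noteq> 0" using phi_self[OF one] by (metis zero_fun_apply zero_neq_one)
  fix W w assume W: "cfun.subspace W" "W \<subseteq> rep_space \<tau>" and w: "w \<in> W" "w \<noteq> 0"
    and inv: "\<And>g w. g \<in> GL \<Longrightarrow> w \<in> W \<Longrightarrow> rep_act \<tau> g w \<in> W"
  obtain A where A: "w (A, ()) \<noteq> 0" using w(2) by (auto simp: fun_eq_iff)
  have "w \<in> rep_space \<tau>" using w(1) W(2) by blast
  then have AG: "A \<in> GL" using A unfolding tau_mem by blast
  \<comment> \<open>Moves a point where \<open>w\<close> is nonzero to the identity, so that the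
    average below does not vanish.\<close>
  define f where "f = rep_act \<tau> (adj2 A) w"
  have fW: "f \<in> W" unfolding f_def by (rule inv[OF adj2_closed[OF AG] w(1)])
  then have f: "f \<in> rep_space \<tau>" using W by blast
  have f1: "f (mat 1, ()) \<noteq> 0"
    using A one by (simp add: f_def tau_act[OF adj2_closed[OF AG]] adj2_cancel(7)[OF AG])
  define P where "P = (\<Sum>B\<in>UT. fscale (1 / chi B) (rep_act \<tau> B f))"
  have PW: "P \<in> W"
    unfolding P_def
    by (rule cfun.subspace_sum[OF W(1)]) (rule cfun.subspace_scale[OF W(1)], rule inv, erule UT_GL, rule fW)
  have P: "P \<in> rep_space \<tau>" using PW W by blast
  have Papp: "P (A, ()) = (\<Sum>B\<in>UT. f (adj2 B ** A, ()) / chi B)" if "A \<in> GL" for A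
    unfolding P_def sum_fun_apply using that by (intro sum.cong) (simp_all add: tau_act[OF UT_GL])
  have Peig: "rep_act \<tau> C P = fscale (chi C) P" if C: "C \<in> UT" for C
  proof (rule tau_eqI)
    fix A
    show "rep_act \<tau> C P (A, ()) = fscale (chi C) P (A, ())"
    proof (cases "A \<in> GL")
      case True
      have CA: "adj2 C ** A \<in> GL" by (rule mult_closed_GL2[OF adj2_closed[OF UT_GL[OF C]] True])
      have b: "bij_betw (\<lambda>B. C ** B) UT UT"
        by (rule bij_betwI[where g = "\<lambda>B. adj2 C ** B"])
           (use C UT_mult UT_adj2 adj2_cancel[OF UT_GL[OF C]] in auto)
      have "P (adj2 C ** A, ()) = (\<Sum>B\<in>UT. f (adj2 (C ** B) ** A, ()) / chi (C ** B) * chi C)"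
        unfolding Papp[OF CA]
      proof (rule sum.cong)
        fix B assume B: "B \<in> UT"
        have "adj2 (C ** B) = adj2 B ** adj2 C"
          using group.inv_mult_group[OF group_GL2 UT_GL[OF C] UT_GL[OF B]]
          by (simp add: inv_GL2 UT_GL B C UT_mult)
        then show "f (adj2 B ** (adj2 C ** A), ()) / chi B = f (adj2 (C ** B) ** A, ()) / chi (C ** B) * chi C"
          using chi_nonzero[OF C] by (simp add: chi_mult[OF C B] matrix_mul_assoc)
      qed simp
      also have "\<dots> = chi C * P (A, ())"
        using sum.reindex_bij_betw[OF b, of "\<lambda>B. f (adj2 B ** A, ()) / chi B * chi C"]
        by (simp add: Papp[OF True] sum_distrib_left mult.commute)
      finally show ?thesis using True by (simp add: tau_act[OF UT_GL[OF C]])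
    qed (use P in \<open>simp add: tau_act[OF UT_GL[OF C]] tau_mem\<close>)
  qed
  have P0: "P (A, ()) = 0" if "A \<in> GL" "A \<notin> UT" for A
    using eigenfunction_big_cell[OF parabolic_axioms parabolic_axioms P Peig that] ne by blast
  have P1: "P (mat 1, ()) = of_nat (card UT) * f (mat 1, ())"
  proof -
    have "f (adj2 B ** mat 1, ()) / chi B = f (mat 1, ())" if B: "B \<in> UT" for B
    proof -
      have "f (mat 1 ** adj2 B, ()) = f (mat 1, ()) / chi (adj2 B)"
        using f one UT_adj2[OF B] unfolding tau_mem by blast
      then show ?thesis using chi_nonzero[OF B] by (simp add: chi_adj2[OF B])
    qed
    then show ?thesis unfolding Papp[OF one] by simp
  qed
  have "P = fscale (P (mat 1, ())) (phi (mat 1))"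
  proof (rule tau_eqI)
    fix A
    consider "A \<in> UT" | "A \<in> GL" "A \<notin> UT" | "A \<notin> GL" by blast
    then show "P (A, ()) = fscale (P (mat 1, ())) (phi (mat 1)) (A, ())"
    proof cases
      case 1
      then have "P (mat 1 ** A, ()) = P (mat 1, ()) / chi A"
        using P one unfolding tau_mem by blast
      then show ?thesis using 1 by (simp add: phi_one)
    next
      case 2
      then show ?thesis using P0 by (simp add: phi_one)
    next
      case 3
      then show ?thesis using P UT_GL[of A] by (auto simp: phi_one tau_mem)
    qed
  qed
  moreover have p1: "P (mat 1, ()) \<noteq> 0" using P1 f1 UT_one by (auto simp: card_eq_0_iff)
  ultimately have "fscale (1 / P (mat 1, ())) P = phi (mat 1)"
    by (metis (no_types, lifting) cfun.scale_scale cfun.scale_one divide_self_if times_divide_eq_left mult_1)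
  then have phiW: "phi (mat 1) \<in> W" using cfun.subspace_scale[OF W(1) PW] by metis
  show "rep_space \<tau> \<subseteq> W"
  proof
    fix f assume f: "f \<in> rep_space \<tau>"
    \<comment> \<open>Each coset is met once for every element of \<open>UT\<close>, so this
      combination of translates is \<open>card UT\<close> times \<open>f\<close>.\<close>
    define Q where "Q = (\<Sum>g\<in>GL. fscale (f (g, ())) (rep_act \<tau> g (phi (mat 1))))"
    have QW: "Q \<in> W"
      unfolding Q_def
      by (rule cfun.subspace_sum[OF W(1)]) (rule cfun.subspace_scale[OF W(1)], erule inv, rule phiW)
    have "Q = fscale (of_nat (card UT)) f"
    proof (rule tau_eqI)
      fix A
      show "Q (A, ()) = fscale (of_nat (card UT)) f (A, ())"
      proof (cases "A \<in> GL")
        case True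
        have b: "bij_betw (\<lambda>B. A ** adj2 B) UT {g \<in> GL. adj2 g ** A \<in> UT}"
        proof (rule bij_betwI[where g = "\<lambda>g. adj2 g ** A"])
          have inv: "adj2 (A ** adj2 B) = B ** adj2 A" if "B \<in> UT" for B
            using group.inv_mult_group[OF group_GL2 True adj2_closed[OF UT_GL[OF that]]]
            by (simp add: inv_GL2 True UT_GL that mult_closed_GL2 adj2_closed adj2_cancel(7)[OF UT_GL[OF that]])
          show "(\<lambda>B. A ** adj2 B) \<in> UT \<rightarrow> {g \<in> GL. adj2 g ** A \<in> UT}"
            using True UT_GL mult_closed_GL2 adj2_closed by (auto simp: inv adj2_cancel(6)[OF True])
          show "adj2 (A ** adj2 B) ** A = B" if "B \<in> UT" for B
            by (simp add: inv[OF that] adj2_cancel(6)[OF True])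
          show "A ** adj2 (adj2 g ** A) = g" if "g \<in> {g \<in> GL. adj2 g ** A \<in> UT}" for g
          proof -
            have g: "g \<in> GL" using that by simp
            have "adj2 (adj2 g ** A) = adj2 A ** g"
              using group.inv_mult_group[OF group_GL2 adj2_closed[OF g] True]
              by (simp add: inv_GL2 True g mult_closed_GL2 adj2_closed adj2_cancel(7)[OF g])
            then show ?thesis by (simp add: adj2_cancel(4)[OF True])
          qed
        qed auto
        have "Q (A, ()) = (\<Sum>g\<in>GL. if adj2 g ** A \<in> UT then f (g, ()) / chi (adj2 g ** A) else 0)"
          unfolding Q_def sum_fun_apply using True by (intro sum.cong) (simp_all add: tau_act phi_one)
        also have "\<dots> = (\<Sum>g\<in>{g \<in> GL. adj2 g ** A \<in> UT}. f (g, ()) / chi (adj2 g ** A))"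
          by (subst sum.inter_filter) simp_all
        also have "\<dots> = (\<Sum>B\<in>UT. f (A ** adj2 B, ()) / chi (adj2 (A ** adj2 B) ** A))"
          by (rule sum.reindex_bij_betw[OF b, symmetric])
        also have "\<dots> = (\<Sum>B\<in>UT. f (A, ()))"
        proof (rule sum.cong)
          fix B assume B: "B \<in> UT"
          have "f (A ** adj2 B, ()) = f (A, ()) * chi B"
            using f True UT_adj2[OF B] chi_adj2[OF B] unfolding tau_mem by simp
          moreover have "adj2 (A ** adj2 B) ** A = B"
            using group.inv_mult_group[OF group_GL2 True adj2_closed[OF UT_GL[OF B]]]
            by (simp add: inv_GL2 True UT_GL B mult_closed_GL2 adj2_closed adj2_cancel(7)[OF UT_GL[OF B]]
               adj2_cancel(6)[OF True])
          ultimately show "f (A ** adj2 B, ()) / chi (adj2 (A ** adj2 B) ** A) = f (A, ())"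
            using chi_nonzero[OF B] by simp
        qed simp
        finally show ?thesis by simp
      next
        case False
        then have "Q (A, ()) = 0" using QW W by (auto simp: tau_mem)
        then show ?thesis using f False by (simp add: tau_mem)
      qed
    qed
    moreover have "of_nat (card UT) \<noteq> (0 :: complex)" using UT_one by (auto simp: card_eq_0_iff)
    ultimately have "fscale (1 / of_nat (card UT)) Q = f" by (simp add: fun_eq_iff)
    then show "f \<in> W" using cfun.subspace_scale[OF W(1) QW] by metis
  qed
qed

text \<open>The image of \<open>phi (mat 1)\<close> is an eigenvector of \<open>UT\<close> for
  \<open>chi\<close> in the second representation. If it is nonzero somewhere off \<open>UT\<close>,
  the characters are interchanged; if it is nonzero on \<open>UT\<close>, they agree.\<close>

lemma parabolic_equiv_imp:
  assumes p': "parabolic F \<xi>1' \<xi>2'" and eq: "rep_equiv (GL2 F) \<tau> (parabolic_rep F \<xi>1' \<xi>2')"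
  shows "(\<xi>1, \<xi>2) = (\<xi>1', \<xi>2') \<or> (\<xi>1, \<xi>2) = (\<xi>2', \<xi>1')"
proof -
  interpret p': parabolic F \<xi>1' \<xi>2' by fact
  obtain T where T: "intertwiner (GL2 F) \<tau> p'.\<tau> T" and b: "bij_betw T (rep_space \<tau>) (rep_space p'.\<tau>)"
    using eq unfolding rep_equiv_def by blast
  have one: "mat 1 \<in> GL" by (rule UT_GL[OF UT_one])
  note ph = phi_space[OF one]
  define h where "h = T (phi (mat 1))"
  have h: "h \<in> rep_space p'.\<tau>" unfolding h_def by (rule intertwinerD(2)[OF T ph])
  have eig: "rep_act p'.\<tau> B h = fscale (chi B) h" if "B \<in> UT" for B
    using intertwinerD(3)[OF T UT_GL[OF that] ph] linear_betweenD(3)[OF intertwinerD(1)[OF T] ph]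
    by (simp add: h_def phi_one_eigen[OF that])
  have "phi (mat 1) \<noteq> 0" using phi_self[OF one] by (metis zero_fun_apply zero_neq_one)
  then have "h \<noteq> 0"
    using b ph unfolding bij_betw_def linear_between_inj[OF intertwinerD(1)[OF T] tau_subspace] h_def by blast
  then obtain A where A: "h (A, ()) \<noteq> 0" by (auto simp: fun_eq_iff)
  have AG: "A \<in> GL" using h A by (auto simp: p'.tau_mem)
  show ?thesis
  proof (cases "A \<in> UT")
    case False
    then show ?thesis
      using eigenfunction_big_cell[OF parabolic_axioms p' h eig AG False A] by auto
  next
    case True
    have "h (mat 1 ** A, ()) = h (mat 1, ()) / p'.chi A"
      using h one True unfolding p'.tau_mem by blast
    then have h1: "h (mat 1, ()) \<noteq> 0" using A by auto
    have key: "chi B = p'.chi B" if B: "B \<in> UT" for B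
    proof -
      have "h (adj2 B ** mat 1, ()) = chi B * h (mat 1, ())"
        using fun_cong[OF eig[OF B], of "(mat 1, ())"] one by (simp add: p'.tau_act[OF UT_GL[OF B]])
      moreover have "h (mat 1 ** adj2 B, ()) = h (mat 1, ()) / p'.chi (adj2 B)"
        using h one UT_adj2[OF B] unfolding p'.tau_mem by blast
      ultimately show ?thesis using h1 by (simp add: p'.chi_adj2[OF B])
    qed
    have "\<xi>1 t = \<xi>1' t" "\<xi>2 t = \<xi>2' t" if t: "t \<in> F - {0}" for t
      using key[of "mat2 t 0 0 1"] key[of "mat2 1 0 0 t"] t mult_char_1[OF \<xi>1] mult_char_1[OF \<xi>2]
        mult_char_1[OF p'.\<xi>1] mult_char_1[OF p'.\<xi>2]
      by (auto simp: UT_iff chi_def p'.chi_def)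
    then show ?thesis using mult_char_eqI[OF \<xi>1 p'.\<xi>1] mult_char_eqI[OF \<xi>2 p'.\<xi>2] by blast
  qed
qed

text \<open>The coset function \<open>phi (mat 1)\<close> is fixed by the unipotent matrices, and the cuspidal
  representation has no nonzero vector with this property.\<close>

lemma parabolic_cuspidal_inequiv:
  assumes "cuspidal F L \<eta> \<mu>"
  shows "\<not> rep_equiv (GL2 F) \<tau> (cuspidal_rep F L \<eta> \<mu>)"
proof
  interpret m: cuspidal F L \<eta> \<mu> by fact
  assume "rep_equiv (GL2 F) \<tau> m.\<rho>"
  then obtain T where T: "intertwiner (GL2 F) \<tau> m.\<rho> T" and b: "bij_betw T (rep_space \<tau>) (rep_space m.\<rho>)"
    unfolding rep_equiv_def by blast
  have one: "mat 1 \<in> GL" by (rule UT_GL[OF UT_one])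
  note ph = phi_space[OF one]
  define f where "f = T (phi (mat 1))"
  have f: "f \<in> rep_space m.\<rho>" unfolding f_def by (rule intertwinerD(2)[OF T ph])
  have "f y = 0" if y: "y \<in> F - {0}" for y
  proof -
    obtain t where t: "t \<in> F" "\<eta> t \<noteq> 1" using m.add_char by (auto simp: nontrivial_add_char_def)
    let ?U = "mat2 1 (t * y) 0 1"
    have U: "?U \<in> UT" using t y by (auto simp: UT_iff)
    have "chi ?U = 1" using mult_char_1[OF \<xi>1] mult_char_1[OF \<xi>2] by (simp add: chi_def)
    then have "rep_act m.\<rho> ?U f = f"
      using intertwinerD(3)[OF T UT_GL[OF U] ph] phi_one_eigen[OF U] by (simp add: f_def)
    then have "\<eta> t * f y = f y"
      using m.rho_act_unipotent[of "t * y" y f] t y by auto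
    then show ?thesis using t(2) by simp
  qed
  then have "f = 0" using f by (auto simp: m.rho_space fun_eq_iff)
  moreover have "phi (mat 1) \<noteq> 0" using phi_self[OF one] by (metis zero_fun_apply zero_neq_one)
  ultimately show False
    using b ph unfolding bij_betw_def linear_between_inj[OF intertwinerD(1)[OF T] tau_subspace] f_def by blast
qed

end

section \<open>Restriction from \<open>GL(2, F)\<close> to \<open>GL(2, K)\<close>\<close>

text \<open>The average over the group of the rank-one map f -> l(f) u. With evaluations for
  \<open>l\<close> and delta functions for \<open>u\<close>, suitable entries of these averages add
  up to sums of traces, and this is how nonzero intertwiners are detected.\<close>

lemma average_intertwiner:
  assumes G: "group G" and fin: "finite (carrier G)" and \<pi>: "is_rep G \<pi>" and \<sigma>: "is_rep G \<sigma>"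
    and u: "u \<in> rep_space \<sigma>"
    and l: "\<And>v w. l (v + w) = l v + l w" "\<And>c v. l (fscale c v) = c * l v"
  shows "intertwiner G \<pi> \<sigma> (\<lambda>f. \<Sum>k\<in>carrier G. fscale (l (rep_act \<pi> (inv\<^bsub>G\<^esub> k) f)) (rep_act \<sigma> k u))"
proof -
  interpret group G by fact
  note \<pi>l = linear_betweenD[OF is_repD(2)[OF \<pi>]]
  note s = is_repD(1)[OF \<sigma>]
  have act: "rep_act \<sigma> k u \<in> rep_space \<sigma>" if "k \<in> carrier G" for k
    by (rule is_repD(5)[OF \<sigma> that u])
  show ?thesis
    unfolding intertwiner_def
  proof (intro conjI ballI linear_betweenI)
    show "(\<Sum>k\<in>carrier G. fscale (l (rep_act \<pi> (inv\<^bsub>G\<^esub> k) f)) (rep_act \<sigma> k u)) \<in> rep_space \<sigma>" for f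
      by (intro cfun.subspace_sum[OF s] cfun.subspace_scale[OF s] act)
    show "(\<Sum>k\<in>carrier G. fscale (l (rep_act \<pi> (inv\<^bsub>G\<^esub> k) (f + g))) (rep_act \<sigma> k u)) =
        (\<Sum>k\<in>carrier G. fscale (l (rep_act \<pi> (inv\<^bsub>G\<^esub> k) f)) (rep_act \<sigma> k u)) +
        (\<Sum>k\<in>carrier G. fscale (l (rep_act \<pi> (inv\<^bsub>G\<^esub> k) g)) (rep_act \<sigma> k u))"
      if "f \<in> rep_space \<pi>" "g \<in> rep_space \<pi>" for f g
      unfolding sum.distrib[symmetric]
      by (rule sum.cong) (use that in \<open>simp_all add: \<pi>l l cfun.scale_left_distrib del: plus_fun_apply fscale_apply\<close>)
    show "(\<Sum>k\<in>carrier G. fscale (l (rep_act \<pi> (inv\<^bsub>G\<^esub> k) (fscale c f))) (rep_act \<sigma> k u)) =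
        fscale c (\<Sum>k\<in>carrier G. fscale (l (rep_act \<pi> (inv\<^bsub>G\<^esub> k) f)) (rep_act \<sigma> k u))"
      if "f \<in> rep_space \<pi>" for c f
      unfolding cfun.scale_sum_right
      by (rule sum.cong) (use that in \<open>simp_all add: \<pi>l l cfun.scale_scale del: fscale_apply\<close>)
    fix h f assume h: "h \<in> carrier G" and f: "f \<in> rep_space \<pi>"
    have b: "bij_betw (\<lambda>k. h \<otimes>\<^bsub>G\<^esub> k) (carrier G) (carrier G)"
      by (rule bij_betwI[where g = "\<lambda>k. inv\<^bsub>G\<^esub> h \<otimes>\<^bsub>G\<^esub> k"]) (use h in \<open>auto simp: m_assoc[symmetric]\<close>)
    have "(\<Sum>k\<in>carrier G. fscale (l (rep_act \<pi> (inv\<^bsub>G\<^esub> k) (rep_act \<pi> h f))) (rep_act \<sigma> k u)) =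
        (\<Sum>k\<in>carrier G. fscale (l (rep_act \<pi> (inv\<^bsub>G\<^esub> (h \<otimes>\<^bsub>G\<^esub> k)) (rep_act \<pi> h f))) (rep_act \<sigma> (h \<otimes>\<^bsub>G\<^esub> k) u))"
      by (rule sum.reindex_bij_betw[OF b, symmetric])
    also have "\<dots> = (\<Sum>k\<in>carrier G. rep_act \<sigma> h (fscale (l (rep_act \<pi> (inv\<^bsub>G\<^esub> k) f)) (rep_act \<sigma> k u)))"
    proof (rule sum.cong)
      fix k assume k: "k \<in> carrier G"
      have "rep_act \<pi> (inv\<^bsub>G\<^esub> (h \<otimes>\<^bsub>G\<^esub> k)) (rep_act \<pi> h f) = rep_act \<pi> (inv\<^bsub>G\<^esub> (h \<otimes>\<^bsub>G\<^esub> k) \<otimes>\<^bsub>G\<^esub> h) f"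
        using is_repD(4)[OF \<pi>] h k f by simp
      also have "inv\<^bsub>G\<^esub> (h \<otimes>\<^bsub>G\<^esub> k) \<otimes>\<^bsub>G\<^esub> h = inv\<^bsub>G\<^esub> k"
        using h k by (simp add: inv_mult_group m_assoc)
      finally show "fscale (l (rep_act \<pi> (inv\<^bsub>G\<^esub> (h \<otimes>\<^bsub>G\<^esub> k)) (rep_act \<pi> h f))) (rep_act \<sigma> (h \<otimes>\<^bsub>G\<^esub> k) u) =
          rep_act \<sigma> h (fscale (l (rep_act \<pi> (inv\<^bsub>G\<^esub> k) f)) (rep_act \<sigma> k u))"
        using is_repD(4)[OF \<sigma> h k u] linear_betweenD(3)[OF is_repD(2)[OF \<sigma> h] act[OF k]] by simp
    qed simp
    also have "\<dots> = rep_act \<sigma> h (\<Sum>k\<in>carrier G. fscale (l (rep_act \<pi> (inv\<^bsub>G\<^esub> k) f)) (rep_act \<sigma> k u))"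
      by (rule linear_between_sum[OF is_repD(2)[OF \<sigma> h] s, symmetric]) (intro cfun.subspace_scale[OF s] act)
    finally show "(\<Sum>k\<in>carrier G. fscale (l (rep_act \<pi> (inv\<^bsub>G\<^esub> k) (rep_act \<pi> h f))) (rep_act \<sigma> k u)) =
        rep_act \<sigma> h (\<Sum>k\<in>carrier G. fscale (l (rep_act \<pi> (inv\<^bsub>G\<^esub> k) f)) (rep_act \<sigma> k u))" .
  qed
qed

lemma (in cuspidal) rho_act_del_diagonal:
  assumes A: "A \<in> carrier (GL2 F)" and y: "y \<in> F - {0}"
  shows "rep_act \<rho> A (del y) y = ker (A $ 1 $ 1) (A $ 1 $ 2) (A $ 2 $ 1) (A $ 2 $ 2) y y"
proof -
  have "(\<Sum>x\<in>F - {0}. ker (A $ 1 $ 1) (A $ 1 $ 2) (A $ 2 $ 1) (A $ 2 $ 2) y x * del y x) =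
      (\<Sum>x\<in>F - {0}. if x = y then ker (A $ 1 $ 1) (A $ 1 $ 2) (A $ 2 $ 1) (A $ 2 $ 2) y x else 0)"
    by (rule sum.cong) (auto simp: del_def)
  then show ?thesis using y by (simp add: rho_act[OF A])
qed

lemma (in cuspidal) sum_rho_act_del_diagonal:
  "A \<in> carrier (GL2 F) \<Longrightarrow> (\<Sum>y\<in>F - {0}. rep_act \<rho> A (del y) y) = trace (A $ 1 $ 1) (A $ 1 $ 2) (A $ 2 $ 1) (A $ 2 $ 2)"
  unfolding trace_def by (rule sum.cong) (simp_all add: rho_act_del_diagonal)

lemma GL2_update: "GL2 F\<lparr>carrier := carrier (GL2 K)\<rparr> = GL2 K"
  by (simp add: GL2_def)

text \<open>\<open>K\<close> and \<open>F\<close> have orders q and q^2, and the whole type is the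
  field of order q^4 on which the characters for the cuspidal representations of GL(2, F) live.
  Oddness of q enters through \<open>two\<close>, by way of the double eigenvalue e = (a + d) /
  2.\<close>

locale quartic_tower = low: cuspidal K F \<eta>1 \<nu> + high: quadratic_extension F UNIV
  for K F :: "'a::{field,finite} set" and \<eta>1 \<nu> :: "'a \<Rightarrow> complex" +
  fixes \<eta>2 :: "'a \<Rightarrow> complex"
  assumes \<eta>2: "nontrivial_add_char F \<eta>2" and two: "(2::'a) \<noteq> 0"
    and nonsquare: "\<not> (\<exists>\<psi>\<in>mult_chars K. \<forall>x\<in>K - {0}. \<nu> x = (\<psi> x)\<^sup>2)"
begin

abbreviation "q \<equiv> card K"

lemma K_F [simp, intro]: "x \<in> K \<Longrightarrow> x \<in> F"
  by (rule low.FL)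

lemma GL2_K_F: "A \<in> carrier (GL2 K) \<Longrightarrow> A \<in> carrier (GL2 F)"
  by (auto simp: carrier_GL2)

lemma subfields: "subfield K" "subfield F" "subfield (UNIV :: 'a set)"
  using low.F.subfield_axioms low.L.subfield_axioms high.L.subfield_axioms by blast+

lemma restrict_rep: "is_rep (GL2 F) \<pi> \<Longrightarrow> is_rep (GL2 K) \<pi>"
  unfolding is_rep_def using GL2_K_F by auto

lemma high_cj: "high.cj v = low.cj (low.cj v)"
  by (simp add: conj_over_def low.card_L power2_eq_square power_mult)

text \<open>The q-th power permutes the roots of a quadratic polynomial over \<open>K\<close>, so
  its square, which is conjugation over \<open>F\<close>, fixes them. A pair of roots that is
  conjugate over \<open>F\<close> therefore collapses to a double root.\<close>

lemma high_root_double: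
  assumes "T \<in> K" "D \<in> K" "high.Nm v = D" "high.Tr v = T"
  shows "T\<^sup>2 = 4 * D"
proof -
  have root: "v * v - T * v + D = 0"
    using assms(3,4) by (simp add: high.Nm_def high.Tr_def algebra_simps flip: assms(3,4))
  have "low.cj (v * v - T * v + D) = 0" unfolding root by simp
  then have root': "low.cj v * low.cj v - T * low.cj v + D = 0"
    using assms(1,2) by (simp add: low.cj_add low.cj_diff low.cj_mult)
  have "(low.cj v - v) * (low.cj v + v - T) =
      (low.cj v * low.cj v - T * low.cj v + D) - (v * v - T * v + D)" by (simp add: algebra_simps)
  also have "\<dots> = 0" unfolding root root' by simp
  finally have "low.cj v = v \<or> low.cj v + v = T" by simp
  then have "low.cj v = v \<or> low.cj v = T - v" by (metis eq_diff_eq)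
  then have "low.cj (low.cj v) = v"
  proof
    assume "low.cj v = T - v"
    then show ?thesis using assms(1) by (simp add: low.cj_diff)
  qed simp
  then have "D = v * v" "T = v + v"
    using assms(3,4) by (auto simp: high.Nm_def high.Tr_def high_cj)
  then show ?thesis by (simp add: power2_eq_square algebra_simps)
qed

lemma high_cuspidal:
  "\<mu> \<in> mult_chars UNIV \<Longrightarrow> indecomposable F UNIV \<mu> \<Longrightarrow> cuspidal F UNIV \<eta>2 \<mu>"
  by (intro cuspidal.intro cuspidal_axioms.intro high.quadratic_extension_axioms \<eta>2)

subsection \<open>Intertwiners on the cuspidal representations\<close>

text \<open>The first trace is taken at the inverse matrix. By \<open>high_root_double\<close> and
  \<open>trace_split\<close> the product vanishes unless both eigenvalues are the same e in
  \<open>K\<close>. Then the traces are multiples of \<mu> (1 / e) and \<nu> e with factors of equal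
  sign, and the product of these two values is 1.\<close>

lemma trace_product_nonneg:
  assumes \<mu>: "cuspidal F UNIV \<eta>2 \<mu>" and res: "\<And>x. x \<in> K - {0} \<Longrightarrow> \<mu> x = \<nu> x"
    and A: "a \<in> K" "b \<in> K" "g \<in> K" "d \<in> K" and D: "D = a * d - b * g" "D \<noteq> 0"
  shows "0 \<le> Re (cuspidal.trace F UNIV \<eta>2 \<mu> (d / D) (- b / D) (- g / D) (a / D) * low.trace a b g d)"
proof -
  interpret m: cuspidal F UNIV \<eta>2 \<mu> by fact
  have DK: "D \<in> K - {0}" using A D by auto
  have one: "\<mu> (1 / e) * \<nu> e = 1" if e: "e \<in> K - {0}" for e
    using high.L.mult_char_inverse[OF m.mult_char, of e] res[OF e] mult_char_nonzero[OF low.mult_char, of e] e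
    by (auto simp: inverse_eq_divide)
  show ?thesis
  proof (cases "g = 0")
    case g: False
    have gF: "- g / D \<in> F - {0}" using g A DK by auto
    have mF: "d / D \<in> F" "- b / D \<in> F" "a / D \<in> F" using A DK by auto
    have D': "(d / D) * (a / D) - (- b / D) * (- g / D) = 1 / D"
    proof -
      have "(d / D) * (a / D) - (- b / D) * (- g / D) = D / (D * D)"
        unfolding D(1) by (simp add: diff_divide_distrib algebra_simps)
      then show ?thesis using D(2) by simp
    qed
    have T': "d / D + a / D = (a + d) / D" by (simp add: add_divide_distrib)
    show ?thesis
    proof (cases "(a + d)\<^sup>2 = 4 * D")
      case True
      define e where "e = (a + d) / 2"
      have "2 = 1 + (1::'a)" by simp
      then have "(2::'a) \<in> K" by (metis low.F.closed(2,3))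
      then have eK: "e \<in> K" using A unfolding e_def by auto
      have e2: "2 * e = a + d" using two by (simp add: e_def)
      have "4 * (e * e) = (2 * e)\<^sup>2" by (simp add: power2_eq_square)
      also have "\<dots> = 4 * D" unfolding e2 by (rule True)
      finally have "2 * (2 * (e * e)) = 2 * (2 * D)" by simp
      then have ee: "e * e = D" using two by (metis mult_left_cancel)
      then have e: "e \<in> K - {0}" using eK D(2) by auto
      have eF: "1 / e \<in> F - {0}" using e by auto
      have "low.trace a b g d = - (\<Sum>v\<in>{e, low.cj e}. \<nu> v)"
        by (rule low.trace_big_eigenvalue)
           (use A g e ee e2 D in \<open>auto simp: low.Nm_def low.Tr_def\<close>)
      moreover have "m.trace (d / D) (- b / D) (- g / D) (a / D) = - (\<Sum>v\<in>{1 / e, high.cj (1 / e)}. \<mu> v)"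
      proof (rule m.trace_big_eigenvalue[OF mF(1,2) gF mF(3)])
        show "high.Nm (1 / e) = d / D * (a / D) - - b / D * (- g / D)"
          unfolding D' using eF e ee by (simp add: high.Nm_def)
        show "high.Tr (1 / e) = d / D + a / D"
          unfolding T' using eF e ee e2[symmetric] by (simp add: high.Tr_def flip: ee)
      qed (use e in auto)
      ultimately show ?thesis using one[OF e] e eF by (simp add: high.cj_F)
    next
      case False
      have "{v \<in> UNIV - {0}. high.Nm v = d / D * (a / D) - - b / D * (- g / D) \<and> high.Tr v = d / D + a / D} = {}"
      proof -
        have "((a + d) / D)\<^sup>2 = 4 * (1 / D)" if "high.Nm v = 1 / D" "high.Tr v = (a + d) / D" for v
          by (rule high_root_double[OF _ _ that]) (use A DK in auto)
        moreover have "(a + d)\<^sup>2 = ((a + d) / D)\<^sup>2 * D\<^sup>2" "4 * (1 / D) * D\<^sup>2 = 4 * D"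
          using D(2) by (simp_all add: power_divide power2_eq_square)
        ultimately have "(a + d)\<^sup>2 = 4 * D" if "high.Nm v = 1 / D" "high.Tr v = (a + d) / D" for v
          using that by metis
        then show ?thesis using False unfolding D' T' by blast
      qed
      then show ?thesis using m.trace_big[OF mF(1,2) gF mF(3)] by (simp only:) simp
    qed
  next
    case g: True
    then have ad: "a \<in> K - {0}" "d \<in> K - {0}" using A D by auto
    show ?thesis
    proof (cases "a = d")
      case False
      then show ?thesis using low.trace_split[of a d b] ad g by simp
    next
      case True
      have Da: "D = a * a" using D g True by simp
      then have inv: "d / D = 1 / a" "a / D = 1 / a" using ad True by simp_all
      have aF: "1 / a \<in> F - {0}" using ad by auto
      show ?thesis
      proof (cases "b = 0")
        case b: True
        have "m.trace (1 / a) 0 0 (1 / a) * low.trace a 0 0 a =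
            of_nat ((card F - 1) * (card K - 1)) * (\<mu> (1 / a) * \<nu> a)"
          unfolding m.trace_scalar[OF aF] low.trace_scalar[OF ad(1)] by simp
        then show ?thesis using one[OF ad(1)] b g True unfolding inv by (simp del: of_nat_mult)
      next
        case b: False
        have "- b / D \<in> F - {0}" using A b DK by auto
        then have "m.trace (1 / a) (- b / D) 0 (1 / a) = - \<mu> (1 / a)" by (rule m.trace_unipotent[OF aF])
        moreover have "low.trace a b 0 a = - \<nu> a"
          by (rule low.trace_unipotent) (use A b ad in auto)
        ultimately show ?thesis using one[OF ad(1)] g True unfolding inv by simp
      qed
    qed
  qed
qed

text \<open>If all averaged maps vanish, so does their diagonal sum, which is the sum over k of the
  traces at k^-1 and at k multiplied together. Its terms have nonnegative real part, and the one at
  the identity is (q^2 - 1)(q - 1).\<close>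

lemma cuspidal_intertwiner:
  assumes \<mu>: "cuspidal F UNIV \<eta>2 \<mu>" and res: "\<And>x. x \<in> K - {0} \<Longrightarrow> \<mu> x = \<nu> x"
  shows "\<exists>S. intertwiner (GL2 K) (cuspidal_rep F UNIV \<eta>2 \<mu>) low.\<rho> S \<and>
    (\<exists>v\<in>rep_space (cuspidal_rep F UNIV \<eta>2 \<mu>). S v \<noteq> 0)"
proof (rule ccontr)
  assume none: "\<not> ?thesis"
  interpret m: cuspidal F UNIV \<eta>2 \<mu> by fact
  let ?G = "carrier (GL2 K)"
  have inv: "inv\<^bsub>GL2 K\<^esub> k = adj2 k" "adj2 k \<in> carrier (GL2 F)" if "k \<in> ?G" for k
    using low.F.inv_GL2[OF that] GL2_K_F[OF low.F.adj2_closed[OF that]] by auto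
  \<comment> \<open>The functional is evaluation at \<open>b\<close>, the vector
    \<open>del a\<close>. Applied to \<open>del b\<close> and read off at \<open>a\<close>, this
    gives diagonal entries of both operators.\<close>
  define S where "S a b f = (\<Sum>k\<in>?G. fscale (rep_act m.\<rho> (inv\<^bsub>GL2 K\<^esub> k) f b) (rep_act low.\<rho> k (low.del a)))"
    for a b f
  have "intertwiner (GL2 K) m.\<rho> low.\<rho> (S a b)" if "a \<in> K - {0}" for a b
    unfolding S_def
    by (rule average_intertwiner[OF low.F.group_GL2 _ restrict_rep[OF m.rho_is_rep] low.rho_is_rep low.del_space[OF that],
        of "\<lambda>f. f b"]) auto
  then have "S a b (m.del b) = 0" if "a \<in> K - {0}" "b \<in> F - {0}" for a b
    using none m.del_space[OF that(2)] that(1) by blast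
  then have "(\<Sum>a\<in>K - {0}. \<Sum>b\<in>F - {0}. S a b (m.del b) a) = 0" by (simp add: sum.neutral)
  also have "(\<Sum>a\<in>K - {0}. \<Sum>b\<in>F - {0}. S a b (m.del b) a) =
      (\<Sum>a\<in>K - {0}. \<Sum>b\<in>F - {0}. \<Sum>k\<in>?G. rep_act m.\<rho> (adj2 k) (m.del b) b * rep_act low.\<rho> k (low.del a) a)"
    unfolding S_def sum_fun_apply by (intro sum.cong refl) (simp add: inv)
  also have "\<dots> = (\<Sum>a\<in>K - {0}. \<Sum>k\<in>?G. \<Sum>b\<in>F - {0}. rep_act m.\<rho> (adj2 k) (m.del b) b * rep_act low.\<rho> k (low.del a) a)"
    by (intro sum.cong refl sum.swap)
  also have "\<dots> = (\<Sum>k\<in>?G. \<Sum>a\<in>K - {0}. \<Sum>b\<in>F - {0}. rep_act m.\<rho> (adj2 k) (m.del b) b * rep_act low.\<rho> k (low.del a) a)"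
    by (rule sum.swap)
  also have "\<dots> = (\<Sum>k\<in>?G. (\<Sum>b\<in>F - {0}. rep_act m.\<rho> (adj2 k) (m.del b) b) * (\<Sum>a\<in>K - {0}. rep_act low.\<rho> k (low.del a) a))"
    by (intro sum.cong refl) (simp only: sum_product sum.swap[of _ "K - {0}"])
  finally have zero: "(\<Sum>k\<in>?G. (\<Sum>b\<in>F - {0}. rep_act m.\<rho> (adj2 k) (m.del b) b) * (\<Sum>a\<in>K - {0}. rep_act low.\<rho> k (low.del a) a)) = 0" .
  define t where "t k = (\<Sum>b\<in>F - {0}. rep_act m.\<rho> (adj2 k) (m.del b) b) * (\<Sum>a\<in>K - {0}. rep_act low.\<rho> k (low.del a) a)" for k
  have t: "t k = m.trace (k $ 2 $ 2 / det k) (- k $ 1 $ 2 / det k) (- k $ 2 $ 1 / det k) (k $ 1 $ 1 / det k) *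
      low.trace (k $ 1 $ 1) (k $ 1 $ 2) (k $ 2 $ 1) (k $ 2 $ 2)" if "k \<in> ?G" for k
    unfolding t_def m.sum_rho_act_del_diagonal[OF inv(2)[OF that]] low.sum_rho_act_del_diagonal[OF that]
    by (simp add: adj2_def)
  have nonneg: "0 \<le> Re (t k)" if "k \<in> ?G" for k
    unfolding t[OF that]
    by (rule trace_product_nonneg[OF \<mu> res]) (use that in \<open>auto simp: carrier_GL2 det_2\<close>)
  have one: "mat 1 \<in> ?G" by (simp add: carrier_GL2 mat_1_nth_2 det_I)
  have "t (mat 1) = of_nat (card F - 1) * of_nat (card K - 1)"
    unfolding t[OF one] using m.trace_scalar[of 1] low.trace_scalar[of 1]
      high.L.mult_char_1[OF m.mult_char] low.L.mult_char_1[OF low.mult_char]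
    by (simp add: mat_1_nth_2 det_I)
  then have "0 < Re (t (mat 1))" using low.L.two_le_card low.F.two_le_card by simp
  moreover have "Re (t (mat 1)) \<le> (\<Sum>k\<in>?G. Re (t k))"
    by (rule member_le_sum) (use one nonneg in auto)
  moreover have "(\<Sum>k\<in>?G. Re (t k)) = 0"
    using zero unfolding t_def[symmetric] by (metis Re_sum zero_complex.sel(1))
  ultimately show False by simp
qed

subsection \<open>Intertwiners on the parabolic representations\<close>

text \<open>For \<open>z\<close> in \<open>F - K\<close> the matrices over \<open>K\<close> having \<open>(z, 1)\<close> as an eigenvector are those of the
  multiplications by \<open>\<lambda> \<in> F\<close> with respect to the basis \<open>(z, 1)\<close>.\<close>

context
  fixes z :: 'a
  assumes z: "z \<in> F" "z \<notin> K"
begin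

text \<open>The coefficient of \<open>z\<close> when w is expanded in the basis (z, 1) of
  \<open>F\<close> over \<open>K\<close>; comparing w with its conjugate eliminates the other
  coefficient.\<close>

definition coord :: "'a \<Rightarrow> 'a" where "coord w = (w - low.cj w) / (z - low.cj z)"
definition mulmat :: "'a \<Rightarrow> 'a^2^2"
  where "mulmat w = mat2 (w - coord w * z + coord w * low.Tr z) (- coord w * low.Nm z) (coord w) (w - coord w * z)"

lemma z_cj: "z - low.cj z \<noteq> 0"
  using z low.cj_fixed_iff[of z] by auto

lemma coord_K: "w \<in> F \<Longrightarrow> coord w \<in> K" "w \<in> F \<Longrightarrow> w - coord w * z \<in> K"
proof -
  assume w: "w \<in> F"
  have "low.cj (coord w) = (low.cj w - w) / (low.cj z - z)"
    using w z by (simp add: coord_def low.cj_divide low.cj_diff)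
  also have "\<dots> = coord w" unfolding coord_def by (metis minus_diff_eq minus_divide_divide)
  finally show c: "coord w \<in> K" by (simp add: low.cj_fixed_iff)
  have "coord w * (z - low.cj z) = w - low.cj w" using z_cj by (simp add: coord_def)
  then have "low.cj (w - coord w * z) = w - coord w * z"
    using c by (simp add: low.cj_diff low.cj_mult algebra_simps)
  then show "w - coord w * z \<in> K" by (simp add: low.cj_fixed_iff)
qed

lemma coord_eq_0_iff: "coord w = 0 \<longleftrightarrow> w \<in> K"
  using z_cj low.cj_fixed_iff[of w] by (auto simp: coord_def)

lemma coord_unique: "c \<in> K \<Longrightarrow> d \<in> K \<Longrightarrow> coord (c * z + d) = c"
  using z_cj by (simp add: coord_def low.cj_add low.cj_mult right_diff_distrib[symmetric])

lemma cj_eq: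
  assumes "w \<in> F"
  shows "low.cj w = w - coord w * z + coord w * low.cj z"
proof -
  have "coord w * (z - low.cj z) = w - low.cj w" using z_cj by (simp add: coord_def)
  then show ?thesis by (simp add: algebra_simps)
qed

lemma det_mulmat: "w \<in> F \<Longrightarrow> det (mulmat w) = low.Nm w"
  unfolding low.Nm_def cj_eq by (simp add: mulmat_def det_2 low.Nm_def low.Tr_def algebra_simps)

lemma trace_mulmat: "w \<in> F \<Longrightarrow> mulmat w $ 1 $ 1 + mulmat w $ 2 $ 2 = low.Tr w"
  using cj_eq[of w] by (simp add: mulmat_def low.Tr_def algebra_simps)

lemma mulmat_GL2: "w \<in> F - {0} \<Longrightarrow> mulmat w \<in> carrier (GL2 K)"
  using coord_K[of w] det_mulmat[of w] z by (auto simp: carrier_GL2 mulmat_def simp del: low.Nm_eq_0_iff) (simp_all add: low.Nm_def)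

text \<open>Its first column is the common eigenvector (z, 1), so conjugation by it makes the
  nonsplit torus upper triangular over \<open>F\<close>.\<close>

definition g0 :: "'a^2^2" where "g0 = mat2 z 1 1 0"

lemma g0_GL2: "g0 \<in> carrier (GL2 F)"
  using z by (simp add: g0_def carrier_GL2 det_2)

lemma conjugate_g0:
  "(adj2 g0 ** (k ** g0)) $ 1 $ 1 = k $ 2 $ 1 * z + k $ 2 $ 2"
  "(adj2 g0 ** (k ** g0)) $ 2 $ 1 = k $ 1 $ 1 * z + k $ 1 $ 2 - z * (k $ 2 $ 1 * z + k $ 2 $ 2)"
  "(adj2 g0 ** (k ** g0)) $ 2 $ 2 = k $ 1 $ 1 - z * k $ 2 $ 1"
  by (simp_all add: matrix_mult_nth_2 adj2_def g0_def det_2)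

lemma conjugate_mulmat:
  assumes "w \<in> F - {0}"
  shows "adj2 g0 ** (mulmat w ** g0) \<in> upper_triangular F"
    "(adj2 g0 ** (mulmat w ** g0)) $ 1 $ 1 = w" "(adj2 g0 ** (mulmat w ** g0)) $ 2 $ 2 = low.cj w"
proof -
  have w: "w \<in> F" using assms by simp
  show e1: "(adj2 g0 ** (mulmat w ** g0)) $ 1 $ 1 = w"
    unfolding conjugate_g0 by (simp add: mulmat_def)
  show e2: "(adj2 g0 ** (mulmat w ** g0)) $ 2 $ 2 = low.cj w"
    unfolding conjugate_g0 cj_eq[OF w] by (simp add: mulmat_def low.Tr_def algebra_simps)
  have e3: "(adj2 g0 ** (mulmat w ** g0)) $ 2 $ 1 = 0"
    unfolding conjugate_g0 by (simp add: mulmat_def low.Tr_def low.Nm_def algebra_simps)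
  have "adj2 g0 ** (mulmat w ** g0) \<in> carrier (GL2 F)"
    by (intro low.L.mult_closed_GL2 low.L.adj2_closed g0_GL2 GL2_K_F mulmat_GL2 assms)
  then show "adj2 g0 ** (mulmat w ** g0) \<in> upper_triangular F"
    using e3 by (simp add: upper_triangular_def)
qed

text \<open>Triangularity says that (z, 1) is an eigenvector of \<open>k\<close>. Conjugation over
  \<open>K\<close> supplies the eigenvector (cj z, 1), and the two together determine the first row
  of \<open>k\<close> from the second.\<close>

lemma mulmat_cover:
  assumes k: "k \<in> carrier (GL2 K)" and u: "adj2 g0 ** (k ** g0) \<in> upper_triangular F"
  shows "k $ 2 $ 1 * z + k $ 2 $ 2 \<in> F - {0}" "mulmat (k $ 2 $ 1 * z + k $ 2 $ 2) = k"
proof -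
  let ?w = "k $ 2 $ 1 * z + k $ 2 $ 2"
  have kK: "k $ 1 $ 1 \<in> K" "k $ 1 $ 2 \<in> K" "k $ 2 $ 1 \<in> K" "k $ 2 $ 2 \<in> K" and d: "det k \<noteq> 0"
    using k by (auto simp: carrier_GL2)
  have eq: "k $ 1 $ 1 * z + k $ 1 $ 2 = z * ?w"
    using u conjugate_g0(2)[of k] by (simp add: upper_triangular_def)
  then have "low.cj (k $ 1 $ 1 * z + k $ 1 $ 2) = low.cj (z * ?w)" by simp
  then have eq': "k $ 1 $ 1 * low.cj z + k $ 1 $ 2 = low.cj z * (k $ 2 $ 1 * low.cj z + k $ 2 $ 2)"
    using kK by (simp add: low.cj_add low.cj_mult)
  have "(z - low.cj z) * (k $ 1 $ 1 - k $ 2 $ 2 - k $ 2 $ 1 * low.Tr z) =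
      (k $ 1 $ 1 * z + k $ 1 $ 2 - z * ?w) -
      (k $ 1 $ 1 * low.cj z + k $ 1 $ 2 - low.cj z * (k $ 2 $ 1 * low.cj z + k $ 2 $ 2))"
    by (simp add: low.Tr_def algebra_simps)
  also have "\<dots> = 0" unfolding eq eq' by simp
  finally have "k $ 1 $ 1 - k $ 2 $ 2 - k $ 2 $ 1 * low.Tr z = 0" using z_cj by simp
  then have tr: "k $ 1 $ 1 = k $ 2 $ 2 + k $ 2 $ 1 * low.Tr z"
    by (metis add.commute diff_eq_eq eq_iff_diff_eq_0)
  have "k $ 1 $ 2 = z * ?w - k $ 1 $ 1 * z" using eq by (simp add: algebra_simps)
  then have k12: "k $ 1 $ 2 = - k $ 2 $ 1 * low.Nm z"
    unfolding tr by (simp add: low.Tr_def low.Nm_def algebra_simps)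
  show "mulmat ?w = k"
    unfolding mat2_eq_iff mulmat_def coord_unique[OF kK(3,4)] using tr k12 by simp
  have "?w \<noteq> 0"
  proof
    assume w0: "?w = 0"
    have "det k = k $ 1 $ 1 * ?w - k $ 2 $ 1 * (k $ 1 $ 1 * z + k $ 1 $ 2)"
      by (simp add: det_2 algebra_simps)
    also have "\<dots> = 0" unfolding eq w0 by simp
    finally show False using d by simp
  qed
  then show "?w \<in> F - {0}" using kK z by auto
qed

text \<open>Multiplication by w has the eigenvalues w and \<open>cj w\<close>, and its matrix is
  scalar exactly for w in \<open>K\<close>.\<close>

lemma low_trace_mulmat:
  assumes w: "w \<in> F - {0}"
  shows "low.trace (mulmat w $ 1 $ 1) (mulmat w $ 1 $ 2) (mulmat w $ 2 $ 1) (mulmat w $ 2 $ 2) =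
    (if w \<in> K then of_nat (q - 1) * \<nu> w else - (\<nu> w + \<nu> (low.cj w)))"
proof (cases "w \<in> K")
  case True
  then have "coord w = 0" by (simp add: coord_eq_0_iff)
  then show ?thesis using low.trace_scalar[of w] True w by (simp add: mulmat_def)
next
  case False
  have M: "mulmat w \<in> carrier (GL2 K)" by (rule mulmat_GL2[OF w])
  have "mulmat w $ 2 $ 1 \<noteq> 0" using False by (simp add: mulmat_def coord_eq_0_iff)
  then have "low.trace (mulmat w $ 1 $ 1) (mulmat w $ 1 $ 2) (mulmat w $ 2 $ 1) (mulmat w $ 2 $ 2) =
      - (\<Sum>v\<in>{w, low.cj w}. \<nu> v)"
    using M det_mulmat[of w] trace_mulmat[of w] w
    by (intro low.trace_big_eigenvalue) (auto simp: carrier_GL2 det_2)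
  moreover have "low.cj w \<noteq> w" using False low.cj_fixed_iff by metis
  ultimately show ?thesis using False by auto
qed

end

text \<open>The test vector is the coset function at \<open>g0\<close>, the functional evaluation at
  \<open>g0\<close>: only the stabiliser of that coset in GL(2, K) contributes. As z lies outside
  \<open>K\<close>, this is the nonsplit torus parametrised by the units of \<open>F\<close>, and
  the sum pairs the trace of the cuspidal representation with the character \<omega>.\<close>

lemma parabolic_intertwiner:
  assumes p: "parabolic F \<xi>1 \<xi>2" and res: "\<And>x. x \<in> K - {0} \<Longrightarrow> \<xi>1 x * \<xi>2 x = \<nu> x"
    and ne: "(\<lambda>w. conj_char K \<xi>1 w * \<xi>2 w) \<noteq> \<nu>" "(\<lambda>w. conj_char K \<xi>1 w * \<xi>2 w) \<noteq> conj_char K \<nu>"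
  shows "\<exists>S. intertwiner (GL2 K) (parabolic_rep F \<xi>1 \<xi>2) low.\<rho> S \<and>
    (\<exists>v\<in>rep_space (parabolic_rep F \<xi>1 \<xi>2). S v \<noteq> 0)"
proof (rule ccontr)
  assume none: "\<not> ?thesis"
  interpret p: parabolic F \<xi>1 \<xi>2 by fact
  let ?G = "carrier (GL2 K)"
  have "card K < card F" using low.F.two_le_card by (simp add: low.card_L power2_eq_square)
  then have "\<not> F \<subseteq> K" using card_mono[of K F] by auto
  then obtain z where z: "z \<in> F" "z \<notin> K" by blast
  let ?g = "g0 z" and ?m = "mulmat z"
  note gG = g0_GL2[OF z]
  have inv: "inv\<^bsub>GL2 K\<^esub> k = adj2 k" "adj2 k \<in> carrier (GL2 F)" "adj2 (adj2 k) = k" if "k \<in> ?G" for k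
    using low.F.inv_GL2[OF that] GL2_K_F[OF low.F.adj2_closed[OF that]] p.adj2_cancel(7)[OF GL2_K_F[OF that]] by auto
  define S where "S y f = (\<Sum>k\<in>?G. fscale (rep_act p.\<tau> (inv\<^bsub>GL2 K\<^esub> k) f (?g, ())) (rep_act low.\<rho> k (low.del y)))"
    for y f
  have "intertwiner (GL2 K) p.\<tau> low.\<rho> (S y)" if "y \<in> K - {0}" for y
    unfolding S_def
    by (rule average_intertwiner[OF low.F.group_GL2 _ restrict_rep[OF p.tau_is_rep] low.rho_is_rep low.del_space[OF that],
        of "\<lambda>f. f (?g, ())"]) auto
  then have "S y (p.phi ?g) = 0" if "y \<in> K - {0}" for y
    using none p.phi_space[OF gG] that by blast
  then have "(\<Sum>y\<in>K - {0}. S y (p.phi ?g) y) = 0" by (simp add: sum.neutral)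
  also have "(\<Sum>y\<in>K - {0}. S y (p.phi ?g) y) =
      (\<Sum>y\<in>K - {0}. \<Sum>k\<in>?G. p.phi ?g (k ** ?g, ()) * rep_act low.\<rho> k (low.del y) y)"
    unfolding S_def sum_fun_apply
    by (intro sum.cong refl) (simp add: inv p.tau_act[OF inv(2)] gG)
  also have "\<dots> = (\<Sum>k\<in>?G. p.phi ?g (k ** ?g, ()) * (\<Sum>y\<in>K - {0}. rep_act low.\<rho> k (low.del y) y))"
    by (subst sum.swap) (simp only: sum_distrib_left)
  also have "\<dots> = (\<Sum>k\<in>?G. if adj2 ?g ** (k ** ?g) \<in> upper_triangular F
      then low.trace (k $ 1 $ 1) (k $ 1 $ 2) (k $ 2 $ 1) (k $ 2 $ 2) / p.chi (adj2 ?g ** (k ** ?g)) else 0)"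
    by (rule sum.cong)
       (auto simp: p.phi_def low.sum_rho_act_del_diagonal low.L.mult_closed_GL2[OF GL2_K_F gG])
  also have "\<dots> = (\<Sum>k\<in>{k \<in> ?G. adj2 ?g ** (k ** ?g) \<in> upper_triangular F}.
      low.trace (k $ 1 $ 1) (k $ 1 $ 2) (k $ 2 $ 1) (k $ 2 $ 2) / p.chi (adj2 ?g ** (k ** ?g)))"
    by (subst sum.inter_filter) simp_all
  also have "\<dots> = (\<Sum>w\<in>F - {0}. low.trace (?m w $ 1 $ 1) (?m w $ 1 $ 2) (?m w $ 2 $ 1) (?m w $ 2 $ 2) /
      p.chi (adj2 ?g ** (?m w ** ?g)))"
  proof (rule sum.reindex_bij_betw[symmetric])
    show "bij_betw ?m (F - {0}) {k \<in> ?G. adj2 ?g ** (k ** ?g) \<in> upper_triangular F}"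
    proof (rule bij_betwI[where g = "\<lambda>k. k $ 2 $ 1 * z + k $ 2 $ 2"])
      show "?m w $ 2 $ 1 * z + ?m w $ 2 $ 2 = w" for w
        by (simp add: mulmat_def[OF z])
    qed (use mulmat_GL2[OF z] conjugate_mulmat[OF z] mulmat_cover[OF z] in auto)
  qed
  also have "\<dots> = (\<Sum>w\<in>F - {0}. (if w \<in> K then of_nat (q - 1) * \<nu> w else - (\<nu> w + \<nu> (low.cj w))) / (\<xi>1 w * \<xi>2 (low.cj w)))"
    by (rule sum.cong) (simp_all only: low_trace_mulmat[OF z] p.chi_def conjugate_mulmat[OF z])
  finally have zero: "(\<Sum>w\<in>F - {0}. (if w \<in> K then of_nat (q - 1) * \<nu> w else - (\<nu> w + \<nu> (low.cj w))) / (\<xi>1 w * \<xi>2 (low.cj w))) = 0" .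
  define \<omega> where "\<omega> w = \<xi>1 w * \<xi>2 (low.cj w)" for w
  have \<omega>: "\<omega> \<in> mult_chars F"
    using p.\<xi>1 low.conj_char_mem[OF p.\<xi>2] unfolding \<omega>_def conj_char_def mult_chars_def by auto
  \<comment> \<open>The two excluded equalities say that \<omega> is conj \<nu> or \<nu>, the cases
    in which orthogonality below would fail.\<close>
  have conj\<omega>: "conj_char K \<omega> = (\<lambda>w. conj_char K \<xi>1 w * \<xi>2 w)"
  proof (rule mult_char_eqI[of _ F])
    show "conj_char K \<omega> \<in> mult_chars F" by (rule low.conj_char_mem[OF \<omega>])
    show "(\<lambda>w. conj_char K \<xi>1 w * \<xi>2 w) \<in> mult_chars F"
      using p.\<xi>2 low.conj_char_mem[OF p.\<xi>1] unfolding conj_char_def mult_chars_def by auto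
  qed (simp add: conj_char_def \<omega>_def)
  have n1: "\<nu> \<noteq> \<omega>" using conj\<omega> ne(2) by auto
  have n2: "conj_char K \<nu> \<noteq> \<omega>" using conj\<omega> ne(1) low.conj_char_conj_char[OF low.mult_char] by auto
  have \<omega>K: "\<omega> x = \<nu> x" if "x \<in> K - {0}" for x using res[OF that] that by (simp add: \<omega>_def)
  \<comment> \<open>On \<open>K\<close> the characters \<nu>, conj \<nu> and \<omega> agree. Writing
    q - 1 = (q + 1) - 2 gives both cases of the trace the same subtracted terms, and these vanish
    when summed over all units of \<open>F\<close>.\<close>
  have "(\<Sum>w\<in>F - {0}. (if w \<in> K then of_nat (q - 1) * \<nu> w else - (\<nu> w + \<nu> (low.cj w))) / \<omega> w) =
      (\<Sum>w\<in>F - {0}. (if w \<in> K then of_nat (q + 1) else 0) - (\<nu> w / \<omega> w + conj_char K \<nu> w / \<omega> w))"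
  proof (rule sum.cong)
    fix w assume w: "w \<in> F - {0}"
    show "(if w \<in> K then of_nat (q - 1) * \<nu> w else - (\<nu> w + \<nu> (low.cj w))) / \<omega> w =
      (if w \<in> K then of_nat (q + 1) else 0) - (\<nu> w / \<omega> w + conj_char K \<nu> w / \<omega> w)"
    proof (cases "w \<in> K")
      case True
      then have "\<omega> w = \<nu> w" "\<nu> w \<noteq> 0" using \<omega>K w mult_char_nonzero[OF low.mult_char w] by auto
      then show ?thesis using True low.F.two_le_card by (simp add: conj_char_def of_nat_diff)
    next
      case False
      then show ?thesis by (simp add: conj_char_def add_divide_distrib diff_divide_distrib)
    qed
  qed simp
  also have "\<dots> = (\<Sum>w\<in>F - {0}. if w \<in> K then of_nat (q + 1) else 0)"
    unfolding sum_subtractf sum.distrib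
    using low.L.mult_char_orthogonal[OF low.mult_char \<omega> n1]
      low.L.mult_char_orthogonal[OF low.conj_char_mem[OF low.mult_char] \<omega> n2] by simp
  also have "\<dots> = (\<Sum>w\<in>{w \<in> F - {0}. w \<in> K}. of_nat (q + 1))"
    by (subst sum.inter_filter) simp_all
  also have "{w \<in> F - {0}. w \<in> K} = K - {0}" by auto
  finally have "of_nat (q - 1) * of_nat (q + 1) = (0 :: complex)"
    using zero unfolding \<omega>_def[symmetric] by (simp add: low.F.card_units)
  then have "of_nat ((q - 1) * (q + 1)) = (0 :: complex)" by (simp only: of_nat_mult)
  then have "(q - 1) * (q + 1) = 0" by (simp only: of_nat_eq_0_iff)
  then show False using low.F.two_le_card by simp
qed

subsection \<open>Counting the constituents\<close>

text \<open>Ordered pairs: each unordered pair of the decomposition occurs twice here and is halved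
  by a transversal for \<open>prod.swap\<close>.\<close>

definition parabolic_pairs :: "(('a \<Rightarrow> complex) \<times> ('a \<Rightarrow> complex)) set"
  where "parabolic_pairs = {(\<xi>1, \<xi>2). \<xi>1 \<in> mult_chars F \<and> \<xi>2 \<in> mult_chars F \<and> \<xi>1 \<noteq> \<xi>2 \<and>
    (\<forall>x\<in>K - {0}. \<xi>1 x * \<xi>2 x = \<nu> x) \<and>
    (\<lambda>w. conj_char K \<xi>1 w * \<xi>2 w) \<noteq> \<nu> \<and>
    (\<lambda>w. conj_char K \<xi>1 w * \<xi>2 w) \<noteq> conj_char K \<nu>}"

definition cuspidal_chars :: "('a \<Rightarrow> complex) set"
  where "cuspidal_chars = {\<mu> \<in> mult_chars UNIV. indecomposable F UNIV \<mu> \<and> (\<forall>x\<in>K - {0}. \<mu> x = \<nu> x)}"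

lemma restrict_mult_char:
  assumes \<psi>: "\<psi> \<in> mult_chars E" and "K \<subseteq> E"
  shows "(\<lambda>x. if x \<in> K - {0} then \<psi> x else 0) \<in> mult_chars K"
proof -
  have "x \<in> E - {0}" if "x \<in> K - {0}" for x using assms(2) that by auto
  then show ?thesis
    using mult_char_nonzero[OF \<psi>] mult_char_mult[OF \<psi>] unfolding mult_chars_def by simp
qed

text \<open>The form in which the hypothesis on \<nu> is applied to characters of larger fields: it
  excludes \<xi>1 = \<xi>2 and makes every \<mu> with the right restriction indecomposable.\<close>

lemma not_square:
  assumes "\<psi> \<in> mult_chars E" "K \<subseteq> E"
  shows "\<exists>x\<in>K - {0}. \<nu> x \<noteq> \<psi> x * \<psi> x"
proof (rule ccontr)
  assume *: "\<not> ?thesis"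
  define \<phi> where "\<phi> = (\<lambda>x. if x \<in> K - {0} then \<psi> x else 0)"
  have "\<phi> \<in> mult_chars K" unfolding \<phi>_def by (rule restrict_mult_char[OF assms])
  moreover have "\<forall>x\<in>K - {0}. \<nu> x = (\<phi> x)\<^sup>2" using * by (auto simp: \<phi>_def power2_eq_square)
  ultimately show False using nonsquare by blast
qed

lemma finite_parabolic_pairs: "finite parabolic_pairs"
  by (rule finite_subset[of _ "mult_chars F \<times> mult_chars F"])
     (auto simp: parabolic_pairs_def low.L.finite_mult_chars)

lemma finite_cuspidal_chars: "finite cuspidal_chars"
  by (rule finite_subset[of _ "mult_chars UNIV"])
     (auto simp: cuspidal_chars_def high.L.finite_mult_chars)

lemma card_F_minus_1: "card F - 1 = (q + 1) * (q - 1)"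
  using low.F.two_le_card by (cases "q") (simp_all add: low.card_L power2_eq_square)

text \<open>Each of the q^2 - 1 choices of \<xi>1 admits q + 1 characters \<xi>2 with the prescribed
  restriction. At most two of them fall to the excluded products, because \<xi>2 is recovered from
  its product with conj \<xi>1.\<close>

lemma card_parabolic_pairs: "(q\<^sup>2 - 1) * (q - 1) \<le> card parabolic_pairs"
proof -
  define A where "A \<xi>1 = {\<xi>2 \<in> mult_chars F. \<forall>x\<in>K - {0}. \<xi>2 x = (if x \<in> K - {0} then \<nu> x / \<xi>1 x else 0)}"
    for \<xi>1 :: "'a \<Rightarrow> complex"
  define B where "B \<xi>1 = {\<xi>2 \<in> A \<xi>1. (\<lambda>w. conj_char K \<xi>1 w * \<xi>2 w) \<in> {\<nu>, conj_char K \<nu>}}"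
    for \<xi>1 :: "'a \<Rightarrow> complex"
  have sub: "Sigma (mult_chars F) (\<lambda>\<xi>1. A \<xi>1 - B \<xi>1) \<subseteq> parabolic_pairs"
  proof (rule subsetI)
    fix p assume "p \<in> Sigma (mult_chars F) (\<lambda>\<xi>1. A \<xi>1 - B \<xi>1)"
    then obtain \<xi>1 \<xi>2 where p: "p = (\<xi>1, \<xi>2)" and \<xi>: "\<xi>1 \<in> mult_chars F" "\<xi>2 \<in> A \<xi>1" "\<xi>2 \<notin> B \<xi>1" by blast
    have \<xi>2: "\<xi>2 \<in> mult_chars F" using \<xi>(2) by (simp add: A_def)
    have prod: "\<xi>1 x * \<xi>2 x = \<nu> x" if "x \<in> K - {0}" for x
      using \<xi>(2) that mult_char_nonzero[OF \<xi>(1), of x] by (auto simp: A_def)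
    have "\<xi>1 \<noteq> \<xi>2"
      using not_square[OF \<xi>(1) low.F_subset_L] prod by auto
    then show "p \<in> parabolic_pairs"
      using \<xi> \<xi>2 prod by (auto simp: p parabolic_pairs_def B_def)
  qed
  have cardA: "card (A \<xi>1) = q + 1" if \<xi>1: "\<xi>1 \<in> mult_chars F" for \<xi>1
    unfolding A_def
  proof (rule low.L.card_mult_chars_extending[OF subfields(1) low.F_subset_L card_F_minus_1])
    show "(\<lambda>x. if x \<in> K - {0} then \<nu> x / \<xi>1 x else 0) \<in> mult_chars K"
      using low.mult_char \<xi>1 unfolding mult_chars_def by auto
  qed
  have finA: "finite (A \<xi>1)" for \<xi>1
    by (rule finite_subset[OF _ low.L.finite_mult_chars]) (auto simp: A_def)
  have cardB: "card (B \<xi>1) \<le> 2" if \<xi>1: "\<xi>1 \<in> mult_chars F" for \<xi>1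
  proof -
    have inj: "inj_on (\<lambda>\<xi>2 w. conj_char K \<xi>1 w * \<xi>2 w) (B \<xi>1)"
    proof (rule inj_onI)
      fix \<xi> \<xi>' assume B: "\<xi> \<in> B \<xi>1" "\<xi>' \<in> B \<xi>1"
        and eq: "(\<lambda>w. conj_char K \<xi>1 w * \<xi> w) = (\<lambda>w. conj_char K \<xi>1 w * \<xi>' w)"
      show "\<xi> = \<xi>'"
      proof (rule mult_char_eqI[of _ F])
        show "\<xi> w = \<xi>' w" if "w \<in> F - {0}" for w
          using fun_cong[OF eq, of w] mult_char_nonzero[OF low.conj_char_mem[OF \<xi>1] that] by simp
      qed (use B in \<open>auto simp: A_def B_def\<close>)
    qed
    have "card (B \<xi>1) = card ((\<lambda>\<xi>2 w. conj_char K \<xi>1 w * \<xi>2 w) ` B \<xi>1)"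
      by (rule card_image[OF inj, symmetric])
    also have "\<dots> \<le> card {\<nu>, conj_char K \<nu>}" by (rule card_mono) (auto simp: B_def)
    also have "\<dots> \<le> 2" by (simp add: card_insert_if)
    finally show ?thesis .
  qed
  have "(q\<^sup>2 - 1) * (q - 1) = (\<Sum>\<xi>1\<in>mult_chars F. q - 1)"
    using low.L.card_mult_chars by (simp add: low.card_L)
  also have "\<dots> \<le> (\<Sum>\<xi>1\<in>mult_chars F. card (A \<xi>1 - B \<xi>1))"
  proof (rule sum_mono)
    fix \<xi>1 assume \<xi>1: "\<xi>1 \<in> mult_chars F"
    have "B \<xi>1 \<subseteq> A \<xi>1" by (auto simp: B_def)
    then have "card (A \<xi>1 - B \<xi>1) = card (A \<xi>1) - card (B \<xi>1)"
      using finA finite_subset by (intro card_Diff_subset) blast+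
    then show "q - 1 \<le> card (A \<xi>1 - B \<xi>1)" using cardA[OF \<xi>1] cardB[OF \<xi>1] by simp
  qed
  also have "\<dots> = card (Sigma (mult_chars F) (\<lambda>\<xi>1. A \<xi>1 - B \<xi>1))"
    using low.L.finite_mult_chars finA by (intro card_SigmaI[symmetric]) auto
  also have "\<dots> \<le> card parabolic_pairs" by (rule card_mono[OF finite_parabolic_pairs sub])
  finally show ?thesis .
qed

text \<open>Indecomposability is automatic, since a character \<psi> (w cj w) restricts to \<psi>
  (x^2) on \<open>K\<close>. What remains is the index of the units of \<open>K\<close> in those of
  the field of order q^4, namely (q^4 - 1) / (q - 1).\<close>

lemma card_cuspidal_chars: "card cuspidal_chars = (q + 1) * (q\<^sup>2 + 1)"
proof -
  let ?\<nu> = "\<lambda>x. if x \<in> K - {0} then \<nu> x else 0"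
  have ind: "indecomposable F UNIV \<mu>" if \<mu>: "\<mu> \<in> mult_chars UNIV" and res: "\<forall>x\<in>K - {0}. \<mu> x = \<nu> x" for \<mu>
    unfolding indecomposable_def
  proof
    assume "\<exists>\<psi>\<in>mult_chars F. \<forall>w\<in>UNIV - {0}. \<mu> w = \<psi> (w * high.cj w)"
    then obtain \<psi> where \<psi>: "\<psi> \<in> mult_chars F" "\<And>w. w \<noteq> 0 \<Longrightarrow> \<mu> w = \<psi> (w * high.cj w)" by auto
    have "\<nu> x = \<psi> x * \<psi> x" if x: "x \<in> K - {0}" for x
    proof -
      have xF: "x \<in> F - {0}" using x by auto
      have "\<mu> x = \<psi> (x * x)" using \<psi>(2)[of x] xF by simp
      also have "\<dots> = \<psi> x * \<psi> x" by (rule mult_char_mult[OF \<psi>(1) xF xF])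
      finally show ?thesis using res x by simp
    qed
    then show False using not_square[OF \<psi>(1) low.F_subset_L] by blast
  qed
  have "cuspidal_chars = {\<mu> \<in> mult_chars UNIV. \<forall>x\<in>K - {0}. \<mu> x = ?\<nu> x}"
    using ind by (auto simp: cuspidal_chars_def)
  also have "card \<dots> = (q + 1) * (q\<^sup>2 + 1)"
  proof (rule high.L.card_mult_chars_extending[OF subfields(1) subset_UNIV])
    obtain k where k: "q = Suc k" using low.F.two_le_card by (cases q) auto
    have "CARD('a) = q ^ 4" by (simp add: high.card_L low.card_L flip: power_mult)
    then show "CARD('a) - 1 = (q + 1) * (q\<^sup>2 + 1) * (q - 1)"
      unfolding k by (simp add: algebra_simps power2_eq_square power4_eq_xxxx)
    show "?\<nu> \<in> mult_chars K" by (rule restrict_mult_char[OF low.mult_char low.F_subset_L])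
  qed
  finally show ?thesis .
qed

end

text \<open>All that is needed of a transversal: the set \<open>S\<close> is covered twice, and different members are
  not exchanged.\<close>

definition half_system :: "('i \<Rightarrow> 'i) \<Rightarrow> 'i set \<Rightarrow> 'i set \<Rightarrow> bool"
  where "half_system sw S I \<longleftrightarrow> I \<subseteq> S \<and> (\<forall>s\<in>I. \<forall>t\<in>I. t = sw s \<longrightarrow> t = s) \<and> S \<subseteq> I \<union> sw ` I"

lemma half_system_transversal:
  assumes I: "is_transversal sw S I" and sw: "\<And>s. s \<in> S \<Longrightarrow> sw (sw s) = s"
  shows "half_system sw S I"
  unfolding half_system_def
proof (intro conjI ballI impI subsetI)
  have ex: "\<exists>!t. t \<in> I \<and> t \<in> {s, sw s}" if "s \<in> S" for s
    using I that unfolding is_transversal_def by blast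
  have sub: "I \<subseteq> S" using I unfolding is_transversal_def by blast
  show "t = s" if "s \<in> I" "t \<in> I" "t = sw s" for s t
    using ex[of s] sub that by blast
  show "s \<in> I \<union> sw ` I" if s: "s \<in> S" for s
  proof -
    obtain t where "t \<in> I" "t = s \<or> t = sw s" using ex[OF s] by blast
    then show ?thesis using sw[OF s] by force
  qed
  show "x \<in> S" if "x \<in> I" for x using sub that by blast
qed

text \<open>A greedy choice: a new element is added unless it is the partner of a chosen one. The
  multiplicity-free statement mentions no transversal, so half systems have to be produced for
  it.\<close>

lemma half_system_exists:
  assumes "finite S" "\<And>s. s \<in> S \<Longrightarrow> sw (sw s) = s"
  shows "\<exists>I. half_system sw S I"
  using assms
proof (induction S rule: finite_induct)
  case empty
  then show ?case by (auto simp: half_system_def)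
next
  case (insert s S)
  then obtain I where I: "I \<subseteq> S" "\<forall>s\<in>I. \<forall>t\<in>I. t = sw s \<longrightarrow> t = s" "S \<subseteq> I \<union> sw ` I"
    unfolding half_system_def by blast
  show ?case
  proof (cases "s \<in> sw ` I")
    case True
    then show ?thesis using I by (intro exI[of _ I]) (auto simp: half_system_def)
  next
    case False
    have "t = sw s \<Longrightarrow> t \<in> I \<Longrightarrow> False" for t
      using False insert.prems[of s] by (metis imageI insertI1)
    then show ?thesis
      using I False by (intro exI[of _ "insert s I"]) (auto simp: half_system_def)
  qed
qed

lemma half_system_card:
  assumes "half_system sw S I" "finite S"
  shows "card S \<le> 2 * card I"
proof -
  have fin: "finite I" using assms finite_subset unfolding half_system_def by blast
  have "card S \<le> card (I \<union> sw ` I)"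
    using assms(1) fin by (intro card_mono) (auto simp: half_system_def)
  also have "\<dots> \<le> card I + card (sw ` I)" by (rule card_Un_le)
  also have "\<dots> \<le> card I + card I" using card_image_le[OF fin] by (intro add_left_mono)
  finally show ?thesis by simp
qed

context quartic_tower
begin

text \<open>With k = q - 1 the factors are free of subtraction. The number \<open>e\<close> is q
  (q^4 - 1), the index of the groups times q - 1; twice \<open>e\<close> splits along 2 q = (q - 1)
  + (q + 1) into the parabolic and the cuspidal part.\<close>

lemma dimension_count:
  assumes P: "(q\<^sup>2 - 1) * (q - 1) \<le> 2 * a" and M: "(q + 1) * (q\<^sup>2 + 1) \<le> 2 * b"
    and D: "d * card (carrier (GL2 K)) \<le> card (carrier (GL2 F)) * (q - 1)"
  shows "d \<le> a * (card F + 1) + b * (card F - 1)"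
proof -
  obtain k where k: "q = Suc k" "k > 0" using low.F.two_le_card by (cases q) auto
  have G: "card (carrier (GL2 K)) = (q\<^sup>2 - 1) * (q\<^sup>2 - q)"
    "card (carrier (GL2 F)) = ((q\<^sup>2)\<^sup>2 - 1) * ((q\<^sup>2)\<^sup>2 - q\<^sup>2)"
    using low.F.card_GL2 low.L.card_GL2 by (simp_all add: low.card_L)
  define e where "e = q * ((q\<^sup>2 - 1) * (q\<^sup>2 + 1))"
  have kk: "q\<^sup>2 - 1 = k * (k + 2)" "q\<^sup>2 - q = k * (k + 1)" "(q\<^sup>2)\<^sup>2 - 1 = k * (k + 2) * (q\<^sup>2 + 1)"
    "(q\<^sup>2)\<^sup>2 - q\<^sup>2 = (k + 1)\<^sup>2 * (k * (k + 2))" "q - 1 = k" "q = k + 1"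
    unfolding k by (simp_all add: power2_eq_square algebra_simps)
  have "card (carrier (GL2 F)) * (q - 1) = e * card (carrier (GL2 K))"
    unfolding G e_def kk(1-5) unfolding kk(6) by (simp add: power2_eq_square algebra_simps)
  then have "d * card (carrier (GL2 K)) \<le> e * card (carrier (GL2 K))" using D by simp
  moreover have "0 < card (carrier (GL2 K))" unfolding G kk(1,2) using k by simp
  ultimately have de: "d \<le> e" by simp
  have "2 * e = (q\<^sup>2 - 1) * (q - 1) * (q\<^sup>2 + 1) + (q + 1) * (q\<^sup>2 + 1) * (q\<^sup>2 - 1)"
    unfolding e_def kk(1,5) unfolding kk(6) by (simp add: algebra_simps)
  also have "\<dots> \<le> 2 * a * (q\<^sup>2 + 1) + 2 * b * (q\<^sup>2 - 1)"
    by (intro add_mono mult_right_mono P M) auto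
  finally show ?thesis using de by (simp add: low.card_L algebra_simps)
qed

text \<open>Stated for half systems, so that it serves both the given transversals and the sets
  chosen for multiplicity freeness.\<close>

lemma decomposition_of_induced:
  assumes P: "half_system prod.swap parabolic_pairs P" and M: "half_system (conj_char F) cuspidal_chars M"
  shows "multiplicity_free (GL2 F) (induced (GL2 F) (carrier (GL2 K)) low.\<rho>)"
    and "rep_equiv (GL2 F) (induced (GL2 F) (carrier (GL2 K)) low.\<rho>)
      (rep_plus (rep_Sum P (\<lambda>(\<xi>1, \<xi>2). parabolic_rep F \<xi>1 \<xi>2))
        (rep_Sum M (\<lambda>\<mu>. cuspidal_rep F UNIV \<eta>2 \<mu>)))"
proof -
  interpret ind: induction_data "GL2 F" "carrier (GL2 K)" low.\<rho>
    by (rule induction_data.intro)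
       (use low.L.group_GL2 low.L.subgroup_GL2[OF subfields(1) low.F_subset_L] low.rho_is_rep in
         \<open>simp_all add: GL2_update\<close>)
  have det: "f = 0" if "f \<in> rep_space low.\<rho>" "\<forall>e\<in>K - {0}. f e = 0" for f
    using that by (auto simp: low.rho_space fun_eq_iff)
  obtain D where D: "finite D" "card D * card (carrier (GL2 K)) \<le> card (carrier (GL2 F)) * card (K - {0})"
    "\<And>f. f \<in> rep_space (induced (GL2 F) (carrier (GL2 K)) low.\<rho>) \<Longrightarrow> \<forall>d\<in>D. f d = 0 \<Longrightarrow> f = 0"
    using ind.induced_determining_set[of "K - {0}"] det by (metis finite)
  have PS: "P \<subseteq> parabolic_pairs" and MS: "M \<subseteq> cuspidal_chars"
    using P M by (auto simp: half_system_def)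
  have finP: "finite P" "finite M"
    using PS MS finite_parabolic_pairs finite_cuspidal_chars finite_subset by blast+
  have par: "parabolic F (fst p) (snd p)" if "p \<in> P" for p
    using that PS by (intro parabolic.intro parabolic_axioms.intro subfields) (auto simp: parabolic_pairs_def)
  have cus: "cuspidal F UNIV \<eta>2 \<mu>" if "\<mu> \<in> M" for \<mu>
    using that MS high_cuspidal by (auto simp: cuspidal_chars_def)
  let ?\<pi> = "\<lambda>(\<xi>1, \<xi>2). parabolic_rep F \<xi>1 \<xi>2"
  let ?R = "induced (GL2 F) (carrier (GL2 K)) low.\<rho>"
  have \<pi>_irr: "irreducible_rep (GL2 F) (?\<pi> p)" if "p \<in> P" for p
    using parabolic.tau_irreducible[OF par[OF that]] that PS by (auto simp: parabolic_pairs_def split_def)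
  have \<rho>_irr: "irreducible_rep (GL2 F) (cuspidal_rep F UNIV \<eta>2 \<mu>)" if "\<mu> \<in> M" for \<mu>
    by (rule cuspidal.rho_irreducible[OF cus[OF that]])
  have T: "\<exists>T. intertwiner (GL2 F) (?\<pi> p) ?R T \<and> (\<exists>v\<in>rep_space (?\<pi> p). T v \<noteq> 0)" if p: "p \<in> P" for p
  proof -
    have "\<exists>S. intertwiner (GL2 K) (?\<pi> p) low.\<rho> S \<and> (\<exists>v\<in>rep_space (?\<pi> p). S v \<noteq> 0)"
      using parabolic_intertwiner[OF par[OF p]] p PS by (auto simp: parabolic_pairs_def split_def)
    then obtain S v where "intertwiner (GL2 K) (?\<pi> p) low.\<rho> S" "v \<in> rep_space (?\<pi> p)" "S v \<noteq> 0" by blast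
    then show ?thesis
      using ind.frobenius[OF irreducible_repD(1)[OF \<pi>_irr[OF p]], of S v] by (simp add: GL2_update)
  qed
  have S: "\<exists>T. intertwiner (GL2 F) (cuspidal_rep F UNIV \<eta>2 \<mu>) ?R T \<and>
      (\<exists>v\<in>rep_space (cuspidal_rep F UNIV \<eta>2 \<mu>). T v \<noteq> 0)" if \<mu>: "\<mu> \<in> M" for \<mu>
  proof -
    have "\<exists>S. intertwiner (GL2 K) (cuspidal_rep F UNIV \<eta>2 \<mu>) low.\<rho> S \<and>
        (\<exists>v\<in>rep_space (cuspidal_rep F UNIV \<eta>2 \<mu>). S v \<noteq> 0)"
      by (rule cuspidal_intertwiner[OF cus[OF \<mu>]]) (use \<mu> MS in \<open>auto simp: cuspidal_chars_def\<close>)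
    then obtain S v where "intertwiner (GL2 K) (cuspidal_rep F UNIV \<eta>2 \<mu>) low.\<rho> S"
      "v \<in> rep_space (cuspidal_rep F UNIV \<eta>2 \<mu>)" "S v \<noteq> 0" by blast
    then show ?thesis
      using ind.frobenius[OF irreducible_repD(1)[OF \<rho>_irr[OF \<mu>]], of S v] by (simp add: GL2_update)
  qed
  have i1: "\<not> rep_equiv (GL2 F) (?\<pi> p) (?\<pi> p')" if p: "p \<in> P" "p' \<in> P" "p \<noteq> p'" for p p'
  proof
    assume "rep_equiv (GL2 F) (?\<pi> p) (?\<pi> p')"
    then have "p = p' \<or> p = prod.swap p'"
      using parabolic.parabolic_equiv_imp[OF par[OF p(1)] par[OF p(2)]]
      by (simp add: split_def prod_eq_iff)
    then show False using p P unfolding half_system_def by blast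
  qed
  have i2: "\<not> rep_equiv (GL2 F) (cuspidal_rep F UNIV \<eta>2 \<mu>) (cuspidal_rep F UNIV \<eta>2 \<mu>')"
    if m: "\<mu> \<in> M" "\<mu>' \<in> M" "\<mu> \<noteq> \<mu>'" for \<mu> \<mu>'
  proof
    assume "rep_equiv (GL2 F) (cuspidal_rep F UNIV \<eta>2 \<mu>) (cuspidal_rep F UNIV \<eta>2 \<mu>')"
    then have "\<mu>' = conj_char F \<mu>"
      using cuspidal_equiv_imp[OF cus[OF m(1)] cus[OF m(2)]] m(3) by auto
    moreover have "\<forall>s\<in>M. \<forall>t\<in>M. t = conj_char F s \<longrightarrow> t = s"
      using M by (simp add: half_system_def)
    ultimately have "\<mu>' = \<mu>" using m(1,2) by blast
    then show False using m(3) by simp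
  qed
  have i3: "\<not> rep_equiv (GL2 F) (?\<pi> p) (cuspidal_rep F UNIV \<eta>2 \<mu>)" if "p \<in> P" "\<mu> \<in> M" for p \<mu>
    using parabolic.parabolic_cuspidal_inequiv[OF par[OF that(1)] cus[OF that(2)]] by (simp add: split_def)
  have d1: "dim_at_least (rep_space (?\<pi> p)) (card F + 1)" if "p \<in> P" for p
    using parabolic.tau_dim[OF par[OF that]] by (simp add: split_def)
  have d2: "dim_at_least (rep_space (cuspidal_rep F UNIV \<eta>2 \<mu>)) (card F - 1)" if "\<mu> \<in> M" for \<mu>
    by (rule cuspidal.rho_dim[OF cus[OF that]])
  have c: "card D \<le> card P * (card F + 1) + card M * (card F - 1)"
  proof (rule dimension_count)
    show "(q\<^sup>2 - 1) * (q - 1) \<le> 2 * card P"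
      using card_parabolic_pairs half_system_card[OF P finite_parabolic_pairs] by simp
    show "(q + 1) * (q\<^sup>2 + 1) \<le> 2 * card M"
      using card_cuspidal_chars half_system_card[OF M finite_cuspidal_chars] by simp
  qed (use D(2) in \<open>simp add: low.F.card_units\<close>)
  note dec = decomposition[OF ind.induced_is_rep finP \<pi>_irr \<rho>_irr T S i1 i2 i3 d1 d2 D(1) D(3) c]
  show "multiplicity_free (GL2 F) ?R" by (rule dec(1))
  show "rep_equiv (GL2 F) ?R (rep_plus (rep_Sum P ?\<pi>) (rep_Sum M (\<lambda>\<mu>. cuspidal_rep F UNIV \<eta>2 \<mu>)))"
    by (rule dec(2))
qed

lemma conj_conj_cuspidal: "\<mu> \<in> cuspidal_chars \<Longrightarrow> conj_char F (conj_char F \<mu>) = \<mu>"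
  by (rule high.conj_char_conj_char) (simp add: cuspidal_chars_def)

end

section \<open>From the hypotheses of the theorem to the tower of fields\<close>

lemma quartic_towerI:
  fixes p h q :: nat
    and Fq Fq2 :: "'a::{field,finite} set"
  assumes "prime p" and "odd p" and "h \<ge> 1" and "q = p ^ h"
    and "CARD('a) = q ^ 4"
    and "is_subfield Fq" and "card Fq = q"
    and "is_subfield Fq2" and "card Fq2 = q ^ 2"
    and "nontrivial_add_char Fq \<eta>1" and "nontrivial_add_char Fq2 \<eta>2"
    and "\<nu> \<in> mult_chars Fq2" and "indecomposable Fq Fq2 \<nu>"
    and "\<not> (\<exists>\<psi>\<in>mult_chars Fq. \<forall>x\<in>Fq - {0}. \<nu> x = (\<psi> x)^2)"
  shows "quartic_tower Fq Fq2 \<eta>1 \<nu> \<eta>2"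
proof -
  interpret K: subfield Fq by unfold_locales fact
  interpret F: subfield Fq2 by unfold_locales fact
  have U: "subfield (UNIV :: 'a set)" by unfold_locales (simp add: is_subfield_def)
  have prime: "prime CHAR('a)"
    by (rule prime_CHAR_semidom) (simp add: finite_imp_CHAR_pos)
  \<comment> \<open>The characteristic is a prime dividing the order q^4 = p^(4 h) of the ambient
    field, so it is p.\<close>
  have "CHAR('a) dvd p ^ (h * 4)"
    using CHAR_dvd_CARD[where 'a = 'a] assms(4,5) by (simp add: power_mult)
  then have "CHAR('a) dvd p" using prime prime_dvd_power by blast
  then have char: "CHAR('a) = p" using prime \<open>prime p\<close> by (simp add: primes_dvd_imp_eq)
  have "\<not> p dvd 2" using \<open>odd p\<close> \<open>prime p\<close> primes_dvd_imp_eq[of p 2] by auto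
  then have two: "(2::'a) \<noteq> 0" using of_nat_eq_0_iff_char_dvd[where 'a = 'a, of 2] char by simp
  \<comment> \<open>Containment follows from the orders: x^q = x implies x^(q^2) = x.\<close>
  have "Fq \<subseteq> Fq2"
  proof
    fix x assume "x \<in> Fq"
    then have "x ^ q = x" using K.power_card assms(7) by simp
    then have "x ^ card Fq2 = x" by (simp add: assms(9) power2_eq_square power_mult)
    then show "x \<in> Fq2" using F.mem_iff by simp
  qed
  moreover have "card Fq = CHAR('a) ^ h" "card Fq2 = CHAR('a) ^ (h * 2)"
    using assms(4,7,9) by (simp_all add: char power_mult)
  moreover have "CARD('a) = (card Fq2)\<^sup>2" using assms(5,9) by (simp flip: power_mult)
  ultimately have "quadratic_extension Fq Fq2" "quadratic_extension Fq2 UNIV"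
    using assms(7,9) K.subfield_axioms F.subfield_axioms U
    by (auto intro!: quadratic_extension.intro quadratic_extension_axioms.intro)
  then show ?thesis
    using assms(10-14) two
    by (intro quartic_tower.intro cuspidal.intro cuspidal_axioms.intro quartic_tower_axioms.intro) auto
qed

theorem proposition7p1:
  fixes p h q :: nat
    and Fq Fq2 :: "'a::{field,finite} set"
    and \<eta>1 \<eta>2 \<nu> :: "'a \<Rightarrow> complex"
  assumes "prime p" and "odd p" and "h \<ge> 1" and "q = p ^ h"
    and "CARD('a) = q ^ 4"
    and "is_subfield Fq" and "card Fq = q"
    and "is_subfield Fq2" and "card Fq2 = q ^ 2"
    and "nontrivial_add_char Fq \<eta>1" and "nontrivial_add_char Fq2 \<eta>2"
    and "\<nu> \<in> mult_chars Fq2" and "indecomposable Fq Fq2 \<nu>"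
    and "\<not> (\<exists>\<psi>\<in>mult_chars Fq. \<forall>x\<in>Fq - {0}. \<nu> x = (\<psi> x)^2)"
  shows "multiplicity_free_triple (GL2 Fq2) (carrier (GL2 Fq)) (cuspidal_rep Fq Fq2 \<eta>1 \<nu>) \<and>
    (\<forall>P M.
       is_transversal prod.swap
         {(\<xi>1, \<xi>2). \<xi>1 \<in> mult_chars Fq2 \<and> \<xi>2 \<in> mult_chars Fq2 \<and> \<xi>1 \<noteq> \<xi>2 \<and>
            (\<forall>x\<in>Fq - {0}. \<xi>1 x * \<xi>2 x = \<nu> x) \<and>
            (\<lambda>w. conj_char Fq \<xi>1 w * \<xi>2 w) \<noteq> \<nu> \<and>
            (\<lambda>w. conj_char Fq \<xi>1 w * \<xi>2 w) \<noteq> conj_char Fq \<nu>} P \<and>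
       is_transversal (conj_char Fq2)
         {\<mu> \<in> mult_chars UNIV. indecomposable Fq2 UNIV \<mu> \<and> (\<forall>x\<in>Fq - {0}. \<mu> x = \<nu> x)} M
       \<longrightarrow>
       rep_equiv (GL2 Fq2)
         (induced (GL2 Fq2) (carrier (GL2 Fq)) (cuspidal_rep Fq Fq2 \<eta>1 \<nu>))
         (rep_plus
           (rep_Sum P (\<lambda>(\<xi>1, \<xi>2). parabolic_rep Fq2 \<xi>1 \<xi>2))
           (rep_Sum M (\<lambda>\<mu>. cuspidal_rep Fq2 UNIV \<eta>2 \<mu>))))"
proof -
  interpret quartic_tower Fq Fq2 \<eta>1 \<nu> \<eta>2
    by (rule quartic_towerI[OF assms])
  let ?R = "induced (GL2 Fq2) (carrier (GL2 Fq)) (cuspidal_rep Fq Fq2 \<eta>1 \<nu>)"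
  have "\<exists>P. half_system prod.swap parabolic_pairs P"
    by (rule half_system_exists[OF finite_parabolic_pairs]) simp
  moreover have "\<exists>M. half_system (conj_char Fq2) cuspidal_chars M"
    by (rule half_system_exists[OF finite_cuspidal_chars conj_conj_cuspidal])
  ultimately have "multiplicity_free (GL2 Fq2) ?R"
    using decomposition_of_induced(1) by blast
  then have mf: "multiplicity_free_triple (GL2 Fq2) (carrier (GL2 Fq)) (cuspidal_rep Fq Fq2 \<eta>1 \<nu>)"
    unfolding multiplicity_free_triple_def GL2_update
    using low.L.group_GL2 low.L.subgroup_GL2[OF subfields(1) low.F_subset_L] low.rho_irreducible by simp
  show ?thesis
  proof (intro conjI allI impI)
    fix P M
    assume "is_transversal prod.swap
         {(\<xi>1, \<xi>2). \<xi>1 \<in> mult_chars Fq2 \<and> \<xi>2 \<in> mult_chars Fq2 \<and> \<xi>1 \<noteq> \<xi>2 \<and>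
            (\<forall>x\<in>Fq - {0}. \<xi>1 x * \<xi>2 x = \<nu> x) \<and>
            (\<lambda>w. conj_char Fq \<xi>1 w * \<xi>2 w) \<noteq> \<nu> \<and>
            (\<lambda>w. conj_char Fq \<xi>1 w * \<xi>2 w) \<noteq> conj_char Fq \<nu>} P \<and>
       is_transversal (conj_char Fq2)
         {\<mu> \<in> mult_chars UNIV. indecomposable Fq2 UNIV \<mu> \<and> (\<forall>x\<in>Fq - {0}. \<mu> x = \<nu> x)} M"
    then have "is_transversal prod.swap parabolic_pairs P" "is_transversal (conj_char Fq2) cuspidal_chars M"
      by (simp_all add: parabolic_pairs_def cuspidal_chars_def)
    then have "half_system prod.swap parabolic_pairs P" "half_system (conj_char Fq2) cuspidal_chars M"
      using half_system_transversal[OF _ swap_swap] half_system_transversal[OF _ conj_conj_cuspidal]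
      by blast+
    then show "rep_equiv (GL2 Fq2) ?R
         (rep_plus
           (rep_Sum P (\<lambda>(\<xi>1, \<xi>2). parabolic_rep Fq2 \<xi>1 \<xi>2))
           (rep_Sum M (\<lambda>\<mu>. cuspidal_rep Fq2 UNIV \<eta>2 \<mu>)))"
      by (rule decomposition_of_induced(2))
  qed (rule mf)
qed

end
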